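(* Let $f:(0,1]\to\mathbf R$ be a function smooth and positive on $(0,1)$, real-analytic at $1$, with $f(1)=0$ and $f'(1)=-1$, such that for $u(z):=f(|z|^2)$, $z\in\mathbf M^2$, the function $\log\frac1u$ is strictly plurisubharmonic on $\mathbf M^2$. Then $u$ is not balanced; that is, there is no constant $c\ne0$ such that $$ K_{u^3\wedge^2(\frac i2\partial\overline\partial\log\frac1u)}(z,z)=\frac{c}{u(z)^3}\qquad\text{for all }z\in\mathbf M^2 . $$
   Context: Kepler manifold and its unit ball: $\mathbf H^n:=\{z\in\mathbf C^{n+1}: z\cdot z=0,\ z\ne0\}$, where $z\cdot w=\sum_j z_jw_j$; it is an $n$-dimensional complex submanifold of $\mathbf C^{n+1}$. $\mathbf M^n:=\{z\in\mathbf H^n:|z|<1\}$. Here $n=2$. For a positive function $u$ on $\mathbf M^n$ with $\log\frac1u$ strictly plurisubharmonic, put $\omega=\frac i2\partial\overline\partial\log\frac1u$. The volume element $\wedge^n\omega$ is normalized so that in local holomorphic coordinates $\wedge^n\omega=\det\bigl[\partial^2\log\frac1u/\partial z_j\partial\overline z_k\bigr]\,(\tfrac i2)^n dz_1\wedge d\overline z_1\wedge\dots\wedge dz_n\wedge d\overline z_n$. $K_{u^{n+1}\wedge^n\omega}(x,y)$ denotes the reproducing kernel (weighted Bergman kernel) of the Hilbert space of all holomorphic functions on $\mathbf M^n$ that are square-integrable with respect to the measure $u^{n+1}\wedge^n\omega$. "Real-analytic at $1$" means that $f$ coincides on some interval $(1-\varepsilon,1]$ with a convergent power series in $t-1$.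 *)

theory Defs
  imports "HOL-Analysis.Analysis"
begin

section \<open>Kepler manifold and its unit ball\<close>

definition kepler_manifold :: "(complex ^ 'm) set" where
  "kepler_manifold = {z. (\<Sum>j\<in>UNIV. z $ j * z $ j) = 0 \<and> z \<noteq> 0}"

definition kepler_ball :: "(complex ^ 'm) set" where
  "kepler_ball = {z \<in> kepler_manifold. norm z < 1}"

section \<open>Holomorphy in several variables and on submanifolds\<close>

text \<open>Complex differentiability: the real Frechet derivative exists and is complex linear.\<close>

definition cholomorphic_on :: "(complex ^ 'n \<Rightarrow> complex) \<Rightarrow> (complex ^ 'n) set \<Rightarrow> bool" where
  "cholomorphic_on g U \<longleftrightarrow>
     (\<forall>x\<in>U. \<exists>D. (g has_derivative D) (at x) \<and> (\<forall>c v. D (c *s v) = c * D v))"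

text \<open>Local holomorphic coordinates on \<open>M\<close>, given by the inverse \<open>\<phi>\<close> of the coordinate map.
  When \<open>M\<close> is a complex submanifold of dimension \<open>CARD('n)\<close> (the only case in which this is used),
  an injective holomorphic immersion \<open>\<phi>\<close> of an open \<open>U\<close> into \<open>M\<close> is automatically biholomorphic
  onto an open subset of \<open>M\<close>, by the inverse function theorem.\<close>

definition holomorphic_chart ::
  "(complex ^ 'm) set \<Rightarrow> (complex ^ 'n) set \<Rightarrow> (complex ^ 'n \<Rightarrow> complex ^ 'm) \<Rightarrow> bool" where
  "holomorphic_chart M U \<phi> \<longleftrightarrow>
     open U \<and> \<phi> ` U \<subseteq> M \<and> inj_on \<phi> U \<and>
     (\<forall>i. cholomorphic_on (\<lambda>x. \<phi> x $ i) U) \<and>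
     (\<forall>x\<in>U. inj (frechet_derivative \<phi> (at x)))"

text \<open>From here on \<open>M\<close> is a complex surface, so charts are defined on subsets of \<open>complex ^ 2\<close>.\<close>

definition holomorphic_on_surface :: "(complex ^ 'm) set \<Rightarrow> (complex ^ 'm \<Rightarrow> complex) \<Rightarrow> bool" where
  "holomorphic_on_surface M g \<longleftrightarrow>
     (\<forall>(U :: (complex ^ 2) set) \<phi>. holomorphic_chart M U \<phi> \<longrightarrow> cholomorphic_on (\<lambda>x. g (\<phi> x)) U)"

section \<open>Wirtinger derivatives and the complex Hessian\<close>

definition d_z :: "'n \<Rightarrow> (complex ^ 'n \<Rightarrow> complex) \<Rightarrow> complex ^ 'n \<Rightarrow> complex" where
  "d_z j F x = (frechet_derivative F (at x) (axis j 1)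
                - \<i> * frechet_derivative F (at x) (axis j \<i>)) / 2"

definition d_zbar :: "'n \<Rightarrow> (complex ^ 'n \<Rightarrow> complex) \<Rightarrow> complex ^ 'n \<Rightarrow> complex" where
  "d_zbar j F x = (frechet_derivative F (at x) (axis j 1)
                   + \<i> * frechet_derivative F (at x) (axis j \<i>)) / 2"

definition complex_hessian :: "(complex ^ 'n \<Rightarrow> real) \<Rightarrow> complex ^ 'n \<Rightarrow> complex ^ 'n ^ 'n" where
  "complex_hessian F x = (\<chi> j k. d_z j (d_zbar k (\<lambda>y. complex_of_real (F y))) x)"

text \<open>Strict plurisubharmonicity, for smooth functions: the complex Hessian is positive definite.
  It is Hermitian, so the sum below is real.\<close>

definition strictly_psh :: "(complex ^ 'm) set \<Rightarrow> (complex ^ 'm \<Rightarrow> real) \<Rightarrow> bool" where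
  "strictly_psh M \<psi> \<longleftrightarrow>
     (\<forall>(U :: (complex ^ 2) set) \<phi>. holomorphic_chart M U \<phi> \<longrightarrow>
        (\<forall>x\<in>U. \<forall>v. v \<noteq> 0 \<longrightarrow>
           0 < Re (\<Sum>j\<in>UNIV. \<Sum>k\<in>UNIV.
                     complex_hessian (\<lambda>y. \<psi> (\<phi> y)) x $ j $ k * v $ j * cnj (v $ k))))"

section \<open>Volume measure, weighted Bergman kernel, balanced functions\<close>

text \<open>\<open>\<nu>\<close> is the measure on \<open>M\<close> given by the second wedge power of the Kaehler form
  \<open>\<omega>\<close> with potential \<open>\<psi>\<close>, normalized (without a factor \<open>2!\<close>) to be the determinant of the
  complex Hessian times \<open>(i/2)\<^sup>2 dz\<^sub>1 \<and> dz\<^sub>1\<^sup>- \<and> dz\<^sub>2 \<and> dz\<^sub>2\<^sup>-\<close> in local coordinates; the latter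
  factor is Lebesgue measure on \<open>complex ^ 2\<close>. For smooth strictly plurisubharmonic \<open>\<psi>\<close> such a
  measure exists, since the determinant transforms by \<open>\<bar>det \<tau>'\<bar>\<^sup>2\<close>, the real Jacobian, under a
  holomorphic change of coordinates \<open>\<tau>\<close>; it is unique, since countably many charts cover \<open>M\<close>.\<close>

definition is_volume_measure ::
  "(complex ^ 'm) set \<Rightarrow> (complex ^ 'm \<Rightarrow> real) \<Rightarrow> (complex ^ 'm) measure \<Rightarrow> bool" where
  "is_volume_measure M \<psi> \<nu> \<longleftrightarrow>
     sets \<nu> = sets (restrict_space borel M) \<and>
     (\<forall>(U :: (complex ^ 2) set) \<phi>. holomorphic_chart M U \<phi> \<longrightarrow>
        (\<forall>B\<in>sets \<nu>. B \<subseteq> \<phi> ` U \<longrightarrow>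
           emeasure \<nu> B =
             (\<integral>\<^sup>+x\<in>{x\<in>U. \<phi> x \<in> B}.
                ennreal (Re (det (complex_hessian (\<lambda>y. \<psi> (\<phi> y)) x))) \<partial>lborel)))"

definition bergman_space ::
  "(complex ^ 'm) set \<Rightarrow> (complex ^ 'm) measure \<Rightarrow> (complex ^ 'm \<Rightarrow> complex) set" where
  "bergman_space M \<mu> =
     {g. holomorphic_on_surface M g \<and> integrable \<mu> (\<lambda>z. (cmod (g z))\<^sup>2)}"

definition is_bergman_kernel ::
  "(complex ^ 'm) set \<Rightarrow> (complex ^ 'm) measure \<Rightarrow> (complex ^ 'm \<Rightarrow> complex ^ 'm \<Rightarrow> complex) \<Rightarrow> bool"
where
  "is_bergman_kernel M \<mu> K \<longleftrightarrow>
     (\<forall>y\<in>M. (\<lambda>x. K x y) \<in> bergman_space M \<mu> \<and>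
        (\<forall>g\<in>bergman_space M \<mu>. g y = (\<integral>x. g x * cnj (K x y) \<partial>\<mu>)))"

text \<open>The quantifiers over \<open>\<nu>\<close> and \<open>K\<close> merely name the volume measure of \<open>\<omega>\<close> and the
  reproducing kernel with respect to \<open>u\<^sup>3 \<omega> \<and> \<omega>\<close>: both exist (point evaluations on the
  weighted Bergman space are bounded) and are unique, \<open>K\<close> as a function on \<open>M \<times> M\<close>.\<close>

definition balanced :: "(complex ^ 'm) set \<Rightarrow> (complex ^ 'm \<Rightarrow> real) \<Rightarrow> bool" where
  "balanced M u \<longleftrightarrow>
     (\<exists>\<nu> K c. is_volume_measure M (\<lambda>z. ln (1 / u z)) \<nu> \<and>
        is_bergman_kernel M (density \<nu> (\<lambda>z. ennreal (u z ^ 3))) K \<and>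
        c \<noteq> 0 \<and> (\<forall>z\<in>M. K z z = c / complex_of_real (u z ^ 3)))"

section \<open>Radial profile functions\<close>

definition smooth_on_open :: "real set \<Rightarrow> (real \<Rightarrow> real) \<Rightarrow> bool" where
  "smooth_on_open S f \<longleftrightarrow> (\<forall>k. \<forall>t\<in>S. ((deriv ^^ k) f) differentiable (at t))"

definition real_analytic_at_left :: "(real \<Rightarrow> real) \<Rightarrow> real \<Rightarrow> bool" where
  "real_analytic_at_left f b \<longleftrightarrow>
     (\<exists>\<epsilon>>0. \<exists>a. \<forall>t\<in>{b - \<epsilon><..b}. (\<lambda>k. a k * (t - b) ^ k) sums f t)"

end

theory Submission
  imports Defs "HOL-Complex_Analysis.Complex_Analysis"
begin

text \<open>
  Why no such \<open>u\<close> is balanced. The quadratic map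
  \<open>(a, b) \<mapsto> (a\<^sup>2 - b\<^sup>2, \<i>(a\<^sup>2 + b\<^sup>2), 2ab) / \<surd>2\<close> sends the punctured unit ball of \<open>\<complex>\<^sup>2\<close> onto
  the unit ball of the Kepler manifold; it identifies exactly \<open>x\<close> with \<open>-x\<close> and
  satisfies \<open>\<bar>z\<bar> = \<bar>a\<bar>\<^sup>2 + \<bar>b\<bar>\<^sup>2\<close>. Through it, holomorphic functions become even holomorphic
  functions on the punctured ball and \<open>u\<^sup>3 \<omega> \<and> \<omega>\<close> becomes a radial weight times Lebesgue measure.
  Write \<open>\<theta> = t d/dt\<close>, \<open>V = -2 \<theta>f ((\<theta>f)\<^sup>2 - f \<theta>\<^sup>2f)\<close> and \<open>J\<^sub>m = \<integral> t\<^sup>m V(t) dt/t\<close> over \<open>(0,1)\<close>.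
  Averaging the reproducing property over the rotations of \<open>a\<close> and of \<open>b\<close> shows that at a
  point over \<open>(a, 0)\<close> only the powers \<open>a\<^bsup>2m\<^esup>\<close> contribute to the kernel (\<open>kernel_diagonal\<close>), so that
  \<open>\<pi>\<^sup>2 K(z,z) = \<Sum> (2m+1) t\<^sup>m / J\<^sub>m\<close> with \<open>t = \<bar>z\<bar>\<^sup>2\<close>, the sum running over those \<open>m\<close>
  for which \<open>J\<^sub>m\<close> is finite. If \<open>u\<close> is balanced, \<open>A = c / f\<^sup>3\<close> has the Taylor coefficients
  \<open>(2m+1) / J\<^sub>m\<close> at 0, with a positive constant \<open>c\<close>. This contradicts the behaviour at
  \<open>t = 1\<close> (\<open>no_balanced_profile\<close>), in three steps.

  At \<open>t = 1\<close> the function \<open>A\<close> has a pole of order three plus a real-analytic remainder. The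
  polar part is the generating function of a quadratic polynomial \<open>P\<close>. The coefficients
  \<open>(2m+1) / J\<^sub>m - P(m)\<close> therefore have a generating function that stays bounded near 1
  under all powers of \<open>\<theta>\<close>, and such a sequence has no nonzero leading term \<open>m\<^sup>j\<close>
  (\<open>coefficient_limit_zero_if_bounded_near_1\<close>). On the other hand \<open>V\<close> is analytic at 1,
  so integration by parts expands \<open>2m + 1 - P(m) J\<^sub>m\<close> in powers of \<open>1/m\<close>, and all the
  coefficients must vanish (\<open>moment_reciprocal_polynomial\<close>). With
  \<open>P(m) = p\<^sub>2 m\<^sup>2 + p\<^sub>1 m + p\<^sub>0\<close> this means two relations between Taylor
  coefficients at 1 and the Euler equation \<open>p\<^sub>2 \<theta>\<^sup>2V - p\<^sub>1 \<theta>V + p\<^sub>0 V = 0\<close>. Inserting the expansion of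
  \<open>f\<close>, the two relations force \<open>p\<^sub>2 = 1\<close>, \<open>p\<^sub>1 = 3/2\<close> and \<open>\<theta>V(1) = V(1)\<close>.

  Since \<open>9 V A\<^sup>4 = 2c \<theta>A (A \<theta>\<^sup>2A - (\<theta>A)\<^sup>2)\<close>, the function \<open>V\<close> is a quotient of power series at 0, and
  the Euler equation holds for the Laurent series at 0 too. An exponent \<open>k\<close> that occurs
  there is a root of \<open>k\<^sup>2 - 3k/2 + p\<^sub>0\<close>; the sum of the two roots is not an integer, so only one
  exponent occurs and \<open>V = C t\<^sup>k\<close> (\<open>quotient_is_monomial\<close>). The relation at 1 gives \<open>k = 1\<close>.

  Then \<open>J\<^sub>0\<close> is finite, so \<open>A(0) \<noteq> 0\<close>. But the right-hand side of the displayed identity vanishes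
  to second order at 0, and the left-hand side only to first order.
\<close>

unbundle no Formal_Power_Series.fps_syntax \<comment> \<open>so that \<open>$\<close> denotes vector components only\<close>

section \<open>Power series that stay bounded near 1\<close>

text \<open>Once all but finitely many coefficients are nonnegative, each tail sum is the limit of
  its values at \<open>t < 1\<close>, and these are bounded by the value of the series and the finitely many
  exceptional coefficients.\<close>

lemma summable_if_power_series_bounded_near_1:
  fixes h :: "nat \<Rightarrow> real"
  assumes R: "\<And>t. b < t \<Longrightarrow> t < 1 \<Longrightarrow> (\<lambda>m. h m * t ^ m) sums R t"
    and C: "\<And>t. b < t \<Longrightarrow> t < 1 \<Longrightarrow> R t \<le> C"
    and b: "0 \<le> b" "b < 1" and pos: "eventually (\<lambda>m. 0 \<le> h m) sequentially"
  shows "summable h"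
proof -
  obtain M where M: "\<And>m. m \<ge> M \<Longrightarrow> 0 \<le> h m"
    using pos by (auto simp: eventually_sequentially)
  have "(\<Sum>i<n. h (i + M)) \<le> C + (\<Sum>i<M. \<bar>h i\<bar>)" for n
  proof (rule tendsto_upperbound[where F = "at_left 1"])
    show "((\<lambda>t. \<Sum>i<n. h (i + M) * t ^ (i + M)) \<longlongrightarrow> (\<Sum>i<n. h (i + M))) (at_left 1)"
      by (rule tendsto_eq_intros refl | simp)+
    have "(\<Sum>i<n. h (i + M) * t ^ (i + M)) \<le> C + (\<Sum>i<M. \<bar>h i\<bar>)"
      if t: "b < t" "t < 1" for t
    proof -
      have t0: "0 < t" using b t by simp
      have "(\<lambda>m. h (m + M) * t ^ (m + M)) sums (R t - (\<Sum>i<M. h i * t ^ i))"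
        using R[OF t] by (subst sums_iff_shift) simp
      moreover have "(\<Sum>i<n. h (i + M) * t ^ (i + M)) \<le> suminf (\<lambda>m. h (m + M) * t ^ (m + M))"
        using calculation M t0 by (intro sum_le_suminf) (auto simp: sums_iff)
      ultimately have "(\<Sum>i<n. h (i + M) * t ^ (i + M)) \<le> R t - (\<Sum>i<M. h i * t ^ i)"
        by (simp add: sums_iff)
      moreover have "- (\<Sum>i<M. h i * t ^ i) \<le> (\<Sum>i<M. \<bar>h i\<bar>)"
        unfolding sum_negf[symmetric]
      proof (rule sum_mono)
        fix i
        have "\<bar>h i\<bar> * t ^ i \<le> \<bar>h i\<bar> * 1"
          using t t0 by (intro mult_left_mono power_le_one) auto
        then show "- (h i * t ^ i) \<le> \<bar>h i\<bar>"
          using t0 by (smt (verit) abs_mult abs_of_pos mult.commute mult_minus_left zero_less_power abs_ge_minus_self)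
      qed
      ultimately show ?thesis using C[OF t] by simp
    qed
    then show "\<forall>\<^sub>F t in at_left 1. (\<Sum>i<n. h (i + M) * t ^ (i + M)) \<le> C + (\<Sum>i<M. \<bar>h i\<bar>)"
      using b by (auto simp: eventually_at_left_field)
  qed simp
  then have "summable (\<lambda>i. h (i + M))"
    using M by (intro summableI_nonneg_bounded) auto
  then show ?thesis by (simp add: summable_iff_shift)
qed

text \<open>The sequence \<open>r\<close> is to have a leading term \<open>\<rho> m\<^sup>2\<^sup>-\<^sup>i\<close>. If \<open>\<rho> \<noteq> 0\<close>, then \<open>m\<^sup>i r\<^sub>m\<close> has
  eventually constant sign; hence it is summable and tends to 0, and so does its quotient by \<open>m\<^sup>2\<close>.
  The factor \<open>m\<^sup>i\<close> corresponds to applying \<open>t d/dt\<close> to the generating function \<open>i\<close> times.\<close>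

lemma coefficient_limit_zero_if_bounded_near_1:
  fixes r :: "nat \<Rightarrow> real"
  assumes bdd: "\<And>i. \<exists>R C b. 0 \<le> b \<and> b < 1 \<and>
      (\<forall>t. b < t \<longrightarrow> t < 1 \<longrightarrow> (\<lambda>m. real m ^ i * r m * t ^ m) sums R t \<and> \<bar>R t\<bar> \<le> (C::real))"
    and lim: "(\<lambda>m. real m ^ i * r m / real m ^ 2) \<longlonglongrightarrow> \<rho>"
  shows "\<rho> = 0"
proof (rule ccontr)
  assume "\<rho> \<noteq> 0"
  define s where "s = sgn \<rho>"
  have s: "s * \<rho> > 0" "s \<noteq> 0" using \<open>\<rho> \<noteq> 0\<close> by (auto simp: s_def sgn_real_def)
  obtain R C b where b: "0 \<le> b" "b < 1"
    and R: "\<And>t. b < t \<Longrightarrow> t < 1 \<Longrightarrow> (\<lambda>m. real m ^ i * r m * t ^ m) sums R t"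
    and C: "\<And>t. b < t \<Longrightarrow> t < 1 \<Longrightarrow> \<bar>R t\<bar> \<le> C"
    using bdd[of i] by blast
  have "(\<lambda>m. s * (real m ^ i * r m / real m ^ 2)) \<longlonglongrightarrow> s * \<rho>"
    by (intro tendsto_intros lim)
  then have "\<forall>\<^sub>F m in sequentially. 0 < s * (real m ^ i * r m / real m ^ 2)"
    using s by (simp add: order_tendstoD)
  then have ev: "\<forall>\<^sub>F m in sequentially. 0 \<le> s * (real m ^ i * r m)"
    by eventually_elim (simp add: zero_less_divide_iff)
  have "summable (\<lambda>m. s * (real m ^ i * r m))"
  proof (rule summable_if_power_series_bounded_near_1[OF _ _ b ev])
    fix t assume t: "b < t" "t < 1"
    show "(\<lambda>m. s * (real m ^ i * r m) * t ^ m) sums (s * R t)"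
      using sums_mult[OF R[OF t], of s] by (simp add: mult.assoc)
    show "s * R t \<le> C"
      using C[OF t] by (auto simp: s_def sgn_real_def split: if_splits)
  qed
  then have "(\<lambda>m. s * (real m ^ i * r m)) \<longlonglongrightarrow> 0"
    by (rule summable_LIMSEQ_zero)
  then have "(\<lambda>m. s * (real m ^ i * r m) * (1 / real m ^ 2)) \<longlonglongrightarrow> 0 * 0"
    by (intro tendsto_mult) (auto, real_asymp)
  then have "(\<lambda>m. s * (real m ^ i * r m / real m ^ 2)) \<longlonglongrightarrow> 0" by simp
  then have "s * \<rho> = 0"
    using LIMSEQ_unique \<open>(\<lambda>m. s * (real m ^ i * r m / real m ^ 2)) \<longlonglongrightarrow> s * \<rho>\<close> by blast
  with s show False by simp
qed

section \<open>The Euler operator on formal power series\<close>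

text \<open>The operator \<open>t d/dt\<close> on expansions in powers of \<open>t - c\<close>.\<close>

definition fps_euler :: "real \<Rightarrow> real fps \<Rightarrow> real fps" where
  "fps_euler c F = (fps_const c + fps_X) * fps_deriv F"

lemma fps_conv_radius_mult_ge:
  assumes "r \<le> fps_conv_radius f" "r \<le> fps_conv_radius g"
  shows "r \<le> fps_conv_radius (f * g :: real fps)"
  using fps_conv_radius_mult[of f g] assms by (meson min.bounded_iff order_trans)

lemma fps_conv_radius_add_ge:
  assumes "r \<le> fps_conv_radius f" "r \<le> fps_conv_radius g"
  shows "r \<le> fps_conv_radius (f + g :: real fps)"
  using fps_conv_radius_add[of f g] assms by (meson min.bounded_iff order_trans)

lemma fps_conv_radius_diff_ge:
  assumes "r \<le> fps_conv_radius f" "r \<le> fps_conv_radius g"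
  shows "r \<le> fps_conv_radius (f - g :: real fps)"
  using fps_conv_radius_diff[of f g] assms by (meson min.bounded_iff order_trans)

lemma fps_conv_radius_power_ge:
  assumes "r \<le> fps_conv_radius f"
  shows "r \<le> fps_conv_radius (f ^ n :: real fps)"
  using fps_conv_radius_power[of f n] assms by (rule order_trans[rotated])

lemma fps_conv_radius_euler_ge:
  assumes "r \<le> fps_conv_radius F"
  shows "r \<le> fps_conv_radius (fps_euler c F)"
  unfolding fps_euler_def
  by (intro fps_conv_radius_mult_ge fps_conv_radius_add_ge order_trans[OF assms fps_conv_radius_deriv])
     auto

lemma fps_conv_radius_euler_pow_ge:
  assumes "r \<le> fps_conv_radius F"
  shows "r \<le> fps_conv_radius ((fps_euler c ^^ i) F)"
  by (induction i) (auto intro: assms fps_conv_radius_euler_ge)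

lemmas fps_radius_intros = fps_conv_radius_mult_ge fps_conv_radius_add_ge fps_conv_radius_diff_ge
  fps_conv_radius_power_ge fps_conv_radius_euler_ge fps_conv_radius_euler_pow_ge

text \<open>Convergence and value are kept together, so that the value of a polynomial expression
  in several series follows by introduction rules alone.\<close>

definition fps_value :: "real fps \<Rightarrow> real \<Rightarrow> real \<Rightarrow> bool" where
  "fps_value F x y \<longleftrightarrow> ereal \<bar>x\<bar> < fps_conv_radius F \<and> eval_fps F x = y"

lemma fps_value_eval: "ereal \<bar>x\<bar> < fps_conv_radius F \<Longrightarrow> fps_value F x (eval_fps F x)"
  by (simp add: fps_value_def)

lemma fps_value_const: "fps_value (fps_const c) x c"
  by (simp add: fps_value_def)

lemma fps_value_numeral: "fps_value (numeral n) x (numeral n)"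
  by (simp add: fps_value_def)

lemma fps_value_X: "fps_value fps_X x x"
  by (simp add: fps_value_def)

lemma fps_value_X_power: "fps_value (fps_X ^ n) x (x ^ n)"
  by (simp add: fps_value_def)

lemma fps_value_add: "fps_value F x y \<Longrightarrow> fps_value G x z \<Longrightarrow> fps_value (F + G) x (y + z)"
  unfolding fps_value_def using less_le_trans[OF _ fps_conv_radius_add[of F G], of "ereal \<bar>x\<bar>"]
  by (auto simp: eval_fps_add)

lemma fps_value_diff: "fps_value F x y \<Longrightarrow> fps_value G x z \<Longrightarrow> fps_value (F - G) x (y - z)"
  unfolding fps_value_def using less_le_trans[OF _ fps_conv_radius_diff[of F G], of "ereal \<bar>x\<bar>"]
  by (auto simp: eval_fps_diff)

lemma fps_value_mult: "fps_value F x y \<Longrightarrow> fps_value G x z \<Longrightarrow> fps_value (F * G) x (y * z)"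
  unfolding fps_value_def using less_le_trans[OF _ fps_conv_radius_mult[of F G], of "ereal \<bar>x\<bar>"]
  by (auto simp: eval_fps_mult)

lemma fps_value_power: "fps_value F x y \<Longrightarrow> fps_value (F ^ n) x (y ^ n)"
  unfolding fps_value_def using less_le_trans[OF _ fps_conv_radius_power[of F n], of "ereal \<bar>x\<bar>"]
  by (auto simp: eval_fps_power)

lemmas fps_value_intros = fps_value_const fps_value_numeral fps_value_X fps_value_X_power
  fps_value_add fps_value_diff fps_value_mult fps_value_power

lemma has_real_derivative_eval_fps_euler:
  assumes "ereal \<bar>t - c\<bar> < fps_conv_radius F" "t \<noteq> 0"
  shows "((\<lambda>t. eval_fps F (t - c)) has_real_derivative eval_fps (fps_euler c F) (t - c) / t) (at t)"
proof -
  have 1: "ereal (norm (t - c)) < fps_conv_radius (fps_const c + fps_X)"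
    "ereal (norm (t - c)) < fps_conv_radius (fps_deriv F)"
    using assms fps_conv_radius_deriv[of F]
      fps_conv_radius_add_ge[of \<infinity> "fps_const c" fps_X] by (auto intro: less_le_trans)
  have "eval_fps (fps_euler c F) (t - c) / t = eval_fps (fps_deriv F) (t - c)"
    using assms(2) unfolding fps_euler_def
    by (subst eval_fps_mult[OF 1], subst eval_fps_add) auto
  moreover have "((\<lambda>t. eval_fps F (t - c)) has_real_derivative eval_fps (fps_deriv F) (t - c) * 1) (at t)"
    using assms(1)
    by (intro DERIV_chain'[where f = "\<lambda>t. t - c" and g = "eval_fps F"] has_field_derivative_eval_fps
          derivative_eq_intros) (auto simp: in_eball_iff dist_norm)
  ultimately show ?thesis by simp
qed

text \<open>The coefficients of the series at 0 are to be compared with smoothness at 1: where the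
  expansions at 0 and at 1 represent the same function, so do their images under \<open>t d/dt\<close>.\<close>

lemma eval_fps_euler_transfer:
  assumes eq: "\<And>t. b < t \<Longrightarrow> t < 1 \<Longrightarrow> eval_fps F t = eval_fps S (t - 1)"
    and F: "1 \<le> fps_conv_radius F" and S: "ereal (1 - b) \<le> fps_conv_radius S"
    and b: "0 \<le> b" and t: "b < t" "t < 1"
  shows "eval_fps ((fps_euler 0 ^^ i) F) t = eval_fps ((fps_euler 1 ^^ i) S) (t - 1)"
  using t
proof (induction i arbitrary: t)
  case 0 then show ?case using eq by simp
next
  case (Suc i)
  let ?F = "(fps_euler 0 ^^ i) F" and ?S = "(fps_euler 1 ^^ i) S"
  have F': "1 \<le> fps_conv_radius ?F" and S': "ereal (1 - b) \<le> fps_conv_radius ?S"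
    using F S by (auto intro: fps_conv_radius_euler_pow_ge)
  have "((\<lambda>t. eval_fps ?F (t - 0)) has_real_derivative eval_fps (fps_euler 0 ?F) (t - 0) / t) (at t)"
    using Suc.prems b by (intro has_real_derivative_eval_fps_euler less_le_trans[OF _ F']) auto
  then have "((\<lambda>t. eval_fps ?S (t - 1)) has_real_derivative eval_fps (fps_euler 0 ?F) (t - 0) / t) (at t)"
    using Suc by (elim has_field_derivative_transform_within_open[of _ _ _ "{b<..<1}"]) auto
  moreover have "((\<lambda>t. eval_fps ?S (t - 1)) has_real_derivative eval_fps (fps_euler 1 ?S) (t - 1) / t) (at t)"
    using Suc.prems b by (intro has_real_derivative_eval_fps_euler less_le_trans[OF _ S']) auto
  ultimately have "eval_fps (fps_euler 0 ?F) (t - 0) / t = eval_fps (fps_euler 1 ?S) (t - 1) / t"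
    by (rule DERIV_unique)
  then show ?case using Suc.prems b by simp
qed

lemma fps_euler_0_nth [simp]: "fps_nth (fps_euler 0 F) n = real n * fps_nth F n"
  by (cases n) (auto simp: fps_euler_def)

lemma fps_euler_0_pow_nth: "fps_nth ((fps_euler 0 ^^ i) F) n = real n ^ i * fps_nth F n"
  by (induction i) auto

text \<open>This supplies the boundedness required by
  \<open>coefficient_limit_zero_if_bounded_near_1\<close>: multiplying the coefficients by \<open>m\<^sup>i\<close> applies
  the \<open>i\<close>-th power of \<open>t d/dt\<close>, which preserves the property of continuing analytically
  across 1.\<close>

lemma bounded_eval_fps_euler:
  assumes eq: "\<And>t. b < t \<Longrightarrow> t < 1 \<Longrightarrow> eval_fps F t = eval_fps S (t - 1)"
    and F: "1 \<le> fps_conv_radius F" and S: "ereal (1 - b) < fps_conv_radius S"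
    and b: "0 \<le> b" "b < 1"
  shows "\<exists>R C b. 0 \<le> b \<and> b < 1 \<and>
      (\<forall>t. b < t \<longrightarrow> t < 1 \<longrightarrow> (\<lambda>m. real m ^ i * fps_nth F m * t ^ m) sums R t \<and> \<bar>R t\<bar> \<le> (C::real))"
proof -
  let ?F = "(fps_euler 0 ^^ i) F" and ?S = "(fps_euler 1 ^^ i) S"
  have F': "1 \<le> fps_conv_radius ?F" and S': "ereal (1 - b) < fps_conv_radius ?S"
    using F fps_conv_radius_euler_pow_ge[OF order_refl, of S 1 i] S
    by (auto intro: fps_conv_radius_euler_pow_ge less_le_trans)
  have sub: "{b - 1..0} \<subseteq> eball 0 (fps_conv_radius ?S)"
  proof
    fix x assume "x \<in> {b - 1..0}"
    then have "ereal (norm x) \<le> ereal (1 - b)" by auto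
    from order.strict_trans1[OF this S'] show "x \<in> eball 0 (fps_conv_radius ?S)"
      by (simp add: in_eball_iff)
  qed
  have "compact (eval_fps ?S ` {b - 1..0})"
    by (intro compact_continuous_image continuous_on_subset[OF continuous_on_eval_fps sub]) auto
  then obtain C where C: "\<And>x. x \<in> {b - 1..0} \<Longrightarrow> \<bar>eval_fps ?S x\<bar> \<le> C"
    by (metis bounded_iff compact_imp_bounded image_eqI real_norm_def)
  show ?thesis
  proof (intro exI conjI allI impI)
    fix t assume t: "b < t" "t < 1"
    have "(\<lambda>m. fps_nth ?F m * t ^ m) sums eval_fps ?F t"
      using t b by (intro sums_eval_fps less_le_trans[OF _ F']) auto
    then show "(\<lambda>m. real m ^ i * fps_nth F m * t ^ m) sums eval_fps ?F t"
      by (simp add: fps_euler_0_pow_nth)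
    show "\<bar>eval_fps ?F t\<bar> \<le> C"
      using eval_fps_euler_transfer[OF eq F less_imp_le[OF S] b(1) t] C[of "t - 1"] t by simp
  qed (use b in auto)
qed

section \<open>Asymptotic expansion of moments\<close>

text \<open>Only the part of the integral near 1 matters for the asymptotics, and there the
  integrand is given by an expansion \<open>H\<close> in powers of \<open>t - 1\<close>. The measure \<open>dt/t\<close> makes
  \<open>t d/dt\<close> antisymmetric up to boundary terms.\<close>

definition moment :: "real \<Rightarrow> real fps \<Rightarrow> nat \<Rightarrow> real" where
  "moment b H m = integral {b..1} (\<lambda>t. t ^ m * (eval_fps H (t - 1) / t))"

lemma continuous_on_moment_integrand:
  assumes b: "0 < b" "b < 1" and H: "ereal (1 - b) < fps_conv_radius H"
  shows "continuous_on {b..1} (\<lambda>t. t ^ m * (eval_fps H (t - 1) / t))"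
proof -
  have "continuous_on {b..1} (\<lambda>t. eval_fps H (t - 1))"
proof (rule continuous_on_compose2[OF continuous_on_eval_fps])
  show "(\<lambda>t. t - 1) ` {b..1} \<subseteq> eball 0 (fps_conv_radius H)"
  proof (intro image_subsetI)
    fix t assume "t \<in> {b..1}"
    then have "ereal (norm (t - 1)) \<le> ereal (1 - b)" by auto
    from order.strict_trans1[OF this H] show "t - 1 \<in> eball 0 (fps_conv_radius H)"
      by (simp add: in_eball_iff)
  qed
qed (intro continuous_intros)
  then show ?thesis
    using b by (intro continuous_on_mult continuous_on_divide continuous_on_power continuous_on_id) auto
qed

lemma moment_by_parts:
  assumes b: "0 < b" "b < 1" and H: "ereal (1 - b) < fps_conv_radius H"
  shows "real m * moment b H m = fps_nth H 0 - b ^ m * eval_fps H (b - 1) - moment b (fps_euler 1 H) m"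
proof -
  have H': "ereal (1 - b) < fps_conv_radius (fps_euler 1 H)"
    using H fps_conv_radius_euler_ge[OF order_refl, of H 1] by (rule less_le_trans)
  let ?g = "\<lambda>t. t ^ m * eval_fps H (t - 1)"
  let ?g' = "\<lambda>t. real m * (t ^ m * (eval_fps H (t - 1) / t)) + t ^ m * (eval_fps (fps_euler 1 H) (t - 1) / t)"
  have "(?g' has_integral (?g 1 - ?g b)) {b..1}"
  proof (rule fundamental_theorem_of_calculus)
    fix t assume t: "t \<in> {b..1}"
    have "((\<lambda>t. eval_fps H (t - 1)) has_real_derivative eval_fps (fps_euler 1 H) (t - 1) / t) (at t)"
      using t b by (intro has_real_derivative_eval_fps_euler le_less_trans[OF _ H]) auto
    from DERIV_mult[OF DERIV_pow[of m t UNIV] this]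
    have "(?g has_real_derivative (real m * t ^ (m - 1)) * eval_fps H (t - 1)
        + t ^ m * (eval_fps (fps_euler 1 H) (t - 1) / t)) (at t)"
      by (simp add: mult.commute add.commute)
    moreover have "(real m * t ^ (m - 1)) * eval_fps H (t - 1)
        + t ^ m * (eval_fps (fps_euler 1 H) (t - 1) / t) = ?g' t"
      using t b by (cases m) auto
    ultimately have "(?g has_real_derivative ?g' t) (at t)" by metis
    then show "(?g has_vector_derivative ?g' t) (at t within {b..1})"
      by (simp add: has_real_derivative_iff_has_vector_derivative has_vector_derivative_at_within)
  qed (use b in auto)
  then have "integral {b..1} ?g' = ?g 1 - ?g b" by (rule integral_unique)
  moreover have "integral {b..1} ?g' = real m * moment b H m + moment b (fps_euler 1 H) m"
    unfolding moment_def integral_mult_right[symmetric]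
    by (intro integral_add integrable_continuous_interval continuous_on_mult continuous_on_const
        continuous_on_moment_integrand[OF b] H H')
  ultimately show ?thesis by (simp add: eval_fps_at_0)
qed

lemma moment_tendsto_0:
  assumes b: "0 < b" "b < 1" and H: "ereal (1 - b) < fps_conv_radius H"
  shows "moment b H \<longlonglongrightarrow> 0"
proof -
  have "compact ((\<lambda>t. eval_fps H (t - 1) / t) ` {b..1})"
    using continuous_on_moment_integrand[OF b H, of 0] by (intro compact_continuous_image) auto
  then obtain C where C: "\<And>t. t \<in> {b..1} \<Longrightarrow> \<bar>eval_fps H (t - 1) / t\<bar> \<le> C"
    by (metis (no_types, lifting) bounded_iff compact_imp_bounded image_eqI real_norm_def)
  have C0: "0 \<le> C" using C[of 1] b by auto
  have "\<bar>moment b H m\<bar> \<le> C * (1 / real (Suc m))" for m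
  proof -
    have p: "((\<lambda>t. t ^ m) has_integral (1 ^ Suc m / real (Suc m) - b ^ Suc m / real (Suc m))) {b..1}"
    proof (rule fundamental_theorem_of_calculus)
      fix t assume "t \<in> {b..1}"
      show "((\<lambda>t. t ^ Suc m / real (Suc m)) has_vector_derivative t ^ m) (at t within {b..1})"
        unfolding has_real_derivative_iff_has_vector_derivative[symmetric]
        by (rule derivative_eq_intros refl | simp)+
    qed (use b in auto)
    have "norm (moment b H m) \<le> integral {b..1} (\<lambda>t. C * t ^ m)"
      unfolding moment_def
    proof (rule integral_norm_bound_integral)
      show "(\<lambda>t. t ^ m * (eval_fps H (t - 1) / t)) integrable_on {b..1}"
        by (intro integrable_continuous_interval continuous_on_moment_integrand b H)
      show "(\<lambda>t. C * t ^ m) integrable_on {b..1}"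
        using b by (intro integrable_continuous_interval continuous_intros)
      fix t assume t: "t \<in> {b..1}"
      have "\<bar>t ^ m * (eval_fps H (t - 1) / t)\<bar> = t ^ m * \<bar>eval_fps H (t - 1) / t\<bar>"
        using t b by (simp add: abs_mult)
      also have "\<dots> \<le> t ^ m * C" using t b by (intro mult_left_mono C) auto
      finally show "norm (t ^ m * (eval_fps H (t - 1) / t)) \<le> C * t ^ m" by (simp add: mult.commute)
    qed
    also have "\<dots> = C * (1 ^ Suc m / real (Suc m) - b ^ Suc m / real (Suc m))"
      using integral_unique[OF p] by simp
    also have "\<dots> \<le> C * (1 / real (Suc m))"
      using C0 b by (intro mult_left_mono) auto
    finally show ?thesis by simp
  qed
  moreover have "(\<lambda>m. C * (1 / real (Suc m))) \<longlonglongrightarrow> 0" by real_asymp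
  ultimately show ?thesis
    by (rule_tac Lim_null_comparison[where g="\<lambda>m. C * (1 / real (Suc m))"]) auto
qed

lemma power_times_geometric_tendsto_0:
  assumes "0 < b" "b < (1::real)"
  shows "(\<lambda>m. real m ^ i * b ^ m) \<longlonglongrightarrow> 0"
  using assms by real_asymp

text \<open>Each integration by parts gains a factor \<open>1/m\<close>, as long as the boundary term at 1
  vanishes; the boundary term at \<open>b\<close> is exponentially small.\<close>

lemma moment_asymptotics:
  assumes b: "0 < b" "b < 1" and H: "ereal (1 - b) < fps_conv_radius H"
    and "\<And>i. i < j \<Longrightarrow> fps_nth ((fps_euler 1 ^^ i) H) 0 = 0"
  shows "(\<lambda>m. real m ^ Suc j * moment b H m) \<longlonglongrightarrow> (-1) ^ j * fps_nth ((fps_euler 1 ^^ j) H) 0"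
  using H assms(4)
proof (induction j arbitrary: H)
  case 0
  have H': "ereal (1 - b) < fps_conv_radius (fps_euler 1 H)"
    using 0(1) fps_conv_radius_euler_ge[OF order_refl, of H 1] by (rule less_le_trans)
  have "(\<lambda>m. fps_nth H 0 - (real m ^ 0 * b ^ m) * eval_fps H (b - 1) - moment b (fps_euler 1 H) m)
      \<longlonglongrightarrow> fps_nth H 0 - 0 * eval_fps H (b - 1) - 0"
    by (intro tendsto_intros moment_tendsto_0 b H' power_times_geometric_tendsto_0)
  then show ?case using moment_by_parts[OF b 0(1)] by simp
next
  case (Suc j)
  have H': "ereal (1 - b) < fps_conv_radius (fps_euler 1 H)"
    using Suc.prems(1) fps_conv_radius_euler_ge[OF order_refl, of H 1] by (rule less_le_trans)
  have "fps_nth ((fps_euler 1 ^^ i) (fps_euler 1 H)) 0 = 0" if "i < j" for i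
    using Suc.prems(2)[of "Suc i"] that by (simp add: funpow_Suc_right del: funpow.simps)
  then have IH: "(\<lambda>m. real m ^ Suc j * moment b (fps_euler 1 H) m)
      \<longlonglongrightarrow> (-1) ^ j * fps_nth ((fps_euler 1 ^^ j) (fps_euler 1 H)) 0"
    using Suc.IH[OF H'] by blast
  have "(\<lambda>m. - ((real m ^ Suc j * b ^ m) * eval_fps H (b - 1)) - real m ^ Suc j * moment b (fps_euler 1 H) m)
      \<longlonglongrightarrow> - (0 * eval_fps H (b - 1)) - (-1) ^ j * fps_nth ((fps_euler 1 ^^ j) (fps_euler 1 H)) 0"
    by (intro tendsto_diff tendsto_minus tendsto_mult_right power_times_geometric_tendsto_0 b IH)
  moreover have "real m ^ Suc (Suc j) * moment b H m =
     - ((real m ^ Suc j * b ^ m) * eval_fps H (b - 1)) - real m ^ Suc j * moment b (fps_euler 1 H) m" for m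
  proof -
    have "real m ^ Suc (Suc j) * moment b H m = real m ^ Suc j * (real m * moment b H m)" by simp
    then show ?thesis using moment_by_parts[OF b Suc.prems(1), of m] Suc.prems(2)[of 0]
      by (simp add: algebra_simps)
  qed
  ultimately show ?case by (simp add: funpow_Suc_right del: funpow.simps)
qed

text \<open>At the centre 1 the operator \<open>t d/dt\<close> lowers the order of a zero by one, so a series of
  order \<open>n\<close> is detected by its \<open>n\<close>-th power.\<close>

lemma fps_eq_0_if_euler_vanish:
  assumes "\<And>j. fps_nth ((fps_euler 1 ^^ j) H) 0 = 0"
  shows "H = 0"
proof (rule ccontr)
  assume "H \<noteq> 0"
  then show False using assms
  proof (induction "subdegree H" arbitrary: H)
    case 0
    then have "fps_nth H 0 \<noteq> 0" using nth_subdegree_nonzero[of H] by simp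
    then show ?case using 0(3)[of 0] by simp
  next
    case (Suc n)
    have *: "fps_nth (fps_euler 1 H) m = real (m + 1) * fps_nth H (m + 1) + real m * fps_nth H m" for m
      by (cases m) (auto simp: fps_euler_def algebra_simps)
    have z: "fps_nth H m = 0" if "m \<le> n" for m
      using that Suc(2) by (intro nth_less_subdegree_zero) linarith
    have "fps_nth H (n + 1) \<noteq> 0"
      using nth_subdegree_nonzero[OF Suc(3)] unfolding Suc(2)[symmetric] by simp
    then have nz: "fps_nth (fps_euler 1 H) n \<noteq> 0"
      unfolding * z[OF order_refl] by simp
    moreover have "fps_nth (fps_euler 1 H) m = 0" if "m < n" for m
      using that unfolding * by (simp add: z)
    ultimately have sub: "subdegree (fps_euler 1 H) = n" "fps_euler 1 H \<noteq> 0"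
      by (rule subdegreeI) (use nz in auto)
    have "fps_nth ((fps_euler 1 ^^ j) (fps_euler 1 H)) 0 = 0" for j
      using Suc(4)[of "Suc j"] by (simp add: funpow_Suc_right del: funpow.simps)
    then show ?case by (rule Suc(1)[OF sub(1)[symmetric] sub(2)])
  qed
qed

lemma tendsto_poly_times_negligible:
  assumes "0 < b" "b < (1::real)"
  shows "(\<lambda>m. real m ^ i * (real m ^ k * (b ^ m * c))) \<longlonglongrightarrow> 0"
proof -
  have "(\<lambda>m. (real m ^ (i + k) * b ^ m) * c) \<longlonglongrightarrow> 0 * c"
    by (intro tendsto_mult power_times_geometric_tendsto_0 assms tendsto_const)
  then show ?thesis by (simp add: power_add mult_ac)
qed

text \<open>If the quotient \<open>(2m+1) / J\<^sub>m\<close> differs from a quadratic polynomial \<open>P\<close> by a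
  sequence with generating function smooth at 1, then \<open>J\<^sub>m\<close> and \<open>(2m+1) / P(m)\<close> agree to all
  orders in \<open>1/m\<close>. A density with the moments \<open>(2m+1) / P(m)\<close> solves an Euler equation with
  certain initial values at 1; the asymptotics transfers both to the density \<open>H\<close>. The terms \<open>D\<close> stand for the contribution to \<open>J\<close> of the
  part away from 1.\<close>

lemma moment_reciprocal_polynomial:
  fixes J r D :: "nat \<Rightarrow> real" and H :: "real fps"
  assumes b: "0 < b" "b < 1" and H: "ereal (1 - b) < fps_conv_radius H" and H0: "fps_nth H 0 \<noteq> 0"
    and J: "\<And>m. m \<ge> M \<Longrightarrow> J m = D m + moment b H m"
    and D: "\<And>m. m \<ge> M \<Longrightarrow> \<bar>D m\<bar> \<le> K * b ^ m"
    and r: "\<And>m. m \<ge> M \<Longrightarrow> r m = (2 * real m + 1) / J m - (p2 * real m ^ 2 + p1 * real m + p0)"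
    and J0: "\<And>m. m \<ge> M \<Longrightarrow> J m \<noteq> 0"
    and bdd: "\<And>i. \<exists>R C b. 0 \<le> b \<and> b < 1 \<and>
      (\<forall>t. b < t \<longrightarrow> t < 1 \<longrightarrow> (\<lambda>m. real m ^ i * r m * t ^ m) sums R t \<and> \<bar>R t\<bar> \<le> (C::real))"
  shows "p2 * fps_nth H 0 = 2"
    and "p1 * fps_nth H 0 = 1 + p2 * fps_nth (fps_euler 1 H) 0"
    and "fps_const p2 * fps_euler 1 (fps_euler 1 H) - fps_const p1 * fps_euler 1 H + fps_const p0 * H = 0"
proof -
  let ?\<theta> = "fps_euler 1"
  define L where "L = fps_const p2 * ?\<theta> (?\<theta> H) - fps_const p1 * ?\<theta> H + fps_const p0 * H"
  let ?P = "\<lambda>m. p2 * real m ^ 2 + p1 * real m + p0"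
  define q where "q m = (2 * real m + 1) - ?P m * J m" for m
  define \<alpha> where "\<alpha> = 2 - p2 * fps_nth H 0"
  define \<beta> where "\<beta> = 1 + p2 * fps_nth (?\<theta> H) 0 - p1 * fps_nth H 0"
  define E where "E m = - ?P m * D m + real m ^ 1 * (b ^ m * (p2 * eval_fps H (b - 1)))
      + real m ^ 0 * (b ^ m * (p1 * eval_fps H (b - 1) - p2 * eval_fps (?\<theta> H) (b - 1)))" for m
  have H': "ereal (1 - b) < fps_conv_radius (?\<theta> H)"
    using H fps_conv_radius_euler_ge[OF order_refl, of H 1] by (rule less_le_trans)
  have H'': "ereal (1 - b) < fps_conv_radius (?\<theta> (?\<theta> H))"
    using H' fps_conv_radius_euler_ge[OF order_refl, of "?\<theta> H" 1] by (rule less_le_trans)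
  let ?s = "min (fps_conv_radius H) (min (fps_conv_radius (?\<theta> H)) (fps_conv_radius (?\<theta> (?\<theta> H))))"
  have "?s \<le> fps_conv_radius L"
    unfolding L_def by (intro fps_conv_radius_add_ge fps_conv_radius_diff_ge fps_conv_radius_mult_ge)
       (auto simp: min_le_iff_disj)
  moreover have "ereal (1 - b) < ?s" using H H' H'' by simp
  ultimately have HL: "ereal (1 - b) < fps_conv_radius L" by (rule less_le_trans[rotated])
  have momL: "moment b L m = p2 * moment b (?\<theta> (?\<theta> H)) m - p1 * moment b (?\<theta> H) m + p0 * moment b H m" for m
  proof -
    have ev: "eval_fps L (t - 1) = p2 * eval_fps (?\<theta> (?\<theta> H)) (t - 1) - p1 * eval_fps (?\<theta> H) (t - 1) + p0 * eval_fps H (t - 1)"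
      if t: "t \<in> {b..1}" for t
    proof -
      have n: "ereal \<bar>t - 1\<bar> \<le> ereal (1 - b)" using t by auto
      have "fps_value L (t - 1) (p2 * eval_fps (?\<theta> (?\<theta> H)) (t - 1) - p1 * eval_fps (?\<theta> H) (t - 1) + p0 * eval_fps H (t - 1))"
        unfolding L_def by (intro fps_value_intros fps_value_eval order.strict_trans1[OF n] H H' H'')
      then show ?thesis by (simp add: fps_value_def)
    qed
    have "moment b L m = integral {b..1} (\<lambda>t. p2 * (t ^ m * (eval_fps (?\<theta> (?\<theta> H)) (t - 1) / t))
       - p1 * (t ^ m * (eval_fps (?\<theta> H) (t - 1) / t)) + p0 * (t ^ m * (eval_fps H (t - 1) / t)))"
      unfolding moment_def using b
      by (intro Henstock_Kurzweil_Integration.integral_cong) (simp add: ev field_simps)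
    also have "\<dots> = p2 * moment b (?\<theta> (?\<theta> H)) m - p1 * moment b (?\<theta> H) m + p0 * moment b H m"
    proof -
      have I: "((\<lambda>t. t ^ m * (eval_fps F (t - 1) / t)) has_integral moment b F m) {b..1}"
        if "ereal (1 - b) < fps_conv_radius F" for F
        unfolding moment_def
        by (intro integrable_integral integrable_continuous_interval continuous_on_moment_integrand b that)
      show ?thesis
        by (intro integral_unique has_integral_add has_integral_diff has_integral_mult_right I H H' H'')
    qed
    finally show ?thesis .
  qed
  have qE: "q m = \<alpha> * real m + \<beta> - moment b L m + E m" if m: "m \<ge> M" for m
  proof -
    have 1: "real m * moment b H m = fps_nth H 0 - b ^ m * eval_fps H (b - 1) - moment b (?\<theta> H) m"
      by (rule moment_by_parts[OF b H])
    have 2: "real m * moment b (?\<theta> H) m = fps_nth (?\<theta> H) 0 - b ^ m * eval_fps (?\<theta> H) (b - 1) - moment b (?\<theta> (?\<theta> H)) m"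
      by (rule moment_by_parts[OF b H'])
    have "real m ^ 2 * moment b H m = real m * (real m * moment b H m)" by (simp add: power2_eq_square)
    also have "\<dots> = real m * fps_nth H 0 - real m * (b ^ m * eval_fps H (b - 1)) - real m * moment b (?\<theta> H) m"
      unfolding 1 by (simp add: algebra_simps)
    finally have 3: "real m ^ 2 * moment b H m = real m * fps_nth H 0 - real m * (b ^ m * eval_fps H (b - 1)) -
      (fps_nth (?\<theta> H) 0 - b ^ m * eval_fps (?\<theta> H) (b - 1) - moment b (?\<theta> (?\<theta> H)) m)" unfolding 2 .
    have "?P m * moment b H m = p2 * (real m ^ 2 * moment b H m) + p1 * (real m * moment b H m) + p0 * moment b H m"
      by (simp add: algebra_simps)
    then show ?thesis
      unfolding q_def J[OF m] E_def momL \<alpha>_def \<beta>_def 3 1 by (simp add: algebra_simps)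
  qed
  have E0: "(\<lambda>m. real m ^ i * E m) \<longlonglongrightarrow> 0" for i
  proof -
    have "(\<lambda>m. real m ^ i * (?P m * D m)) \<longlonglongrightarrow> 0"
    proof (rule Lim_null_comparison)
      show "\<forall>\<^sub>F m in sequentially. norm (real m ^ i * (?P m * D m)) \<le>
         real m ^ i * (real m ^ 2 * (b ^ m * (\<bar>p2\<bar> * K))) + real m ^ i * (real m ^ 1 * (b ^ m * (\<bar>p1\<bar> * K)))
         + real m ^ i * (real m ^ 0 * (b ^ m * (\<bar>p0\<bar> * K)))"
        using eventually_ge_at_top[of M]
      proof eventually_elim
        case (elim m)
        have "\<bar>?P m\<bar> \<le> \<bar>p2\<bar> * real m ^ 2 + \<bar>p1\<bar> * real m + \<bar>p0\<bar>"
          using abs_mult[of p2 "real m ^ 2"] abs_mult[of p1 "real m"] by simp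
        then have "norm (real m ^ i * (?P m * D m)) \<le> real m ^ i * ((\<bar>p2\<bar> * real m ^ 2 + \<bar>p1\<bar> * real m + \<bar>p0\<bar>) * (K * b ^ m))"
          unfolding real_norm_def abs_mult using D[OF elim]
          by (intro mult_mono) auto
        then show ?case by (simp add: algebra_simps)
      qed
      have "(\<lambda>m. real m ^ i * (real m ^ 2 * (b ^ m * (\<bar>p2\<bar> * K))) + real m ^ i * (real m ^ 1 * (b ^ m * (\<bar>p1\<bar> * K)))
         + real m ^ i * (real m ^ 0 * (b ^ m * (\<bar>p0\<bar> * K)))) \<longlonglongrightarrow> 0 + 0 + 0"
        by (intro tendsto_add tendsto_poly_times_negligible b)
      then show "(\<lambda>m. real m ^ i * (real m ^ 2 * (b ^ m * (\<bar>p2\<bar> * K))) + real m ^ i * (real m ^ 1 * (b ^ m * (\<bar>p1\<bar> * K)))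
         + real m ^ i * (real m ^ 0 * (b ^ m * (\<bar>p0\<bar> * K)))) \<longlonglongrightarrow> 0" by simp
    qed
    then have "(\<lambda>m. - (real m ^ i * (?P m * D m)) + real m ^ i * (real m ^ 1 * (b ^ m * (p2 * eval_fps H (b - 1))))
      + real m ^ i * (real m ^ 0 * (b ^ m * (p1 * eval_fps H (b - 1) - p2 * eval_fps (?\<theta> H) (b - 1))))) \<longlonglongrightarrow> - 0 + 0 + 0"
      by (intro tendsto_add tendsto_minus tendsto_poly_times_negligible b)
    then show ?thesis by (simp add: E_def algebra_simps)
  qed
  have mJ: "(\<lambda>m. real m * J m) \<longlonglongrightarrow> fps_nth H 0"
  proof -
    have "(\<lambda>m. real m * D m) \<longlonglongrightarrow> 0"
    proof (rule Lim_null_comparison)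
      show "\<forall>\<^sub>F m in sequentially. norm (real m * D m) \<le> real m ^ 1 * (real m ^ 0 * (b ^ m * K))"
        using eventually_ge_at_top[of M]
        by eventually_elim (use D in \<open>auto simp: abs_mult mult.commute intro: mult_left_mono\<close>)
    qed (rule tendsto_poly_times_negligible[OF b])
    then have "(\<lambda>m. real m * D m + real m ^ Suc 0 * moment b H m) \<longlonglongrightarrow> 0 + (-1) ^ 0 * fps_nth ((?\<theta> ^^ 0) H) 0"
      by (intro tendsto_add moment_asymptotics[OF b H]) auto
    then have *: "(\<lambda>m. real m * D m + real m * moment b H m) \<longlonglongrightarrow> fps_nth H 0" by simp
    show ?thesis
      by (rule Lim_transform_eventually[OF *], rule eventually_mono[OF eventually_ge_at_top[of M]])
         (simp add: J distrib_left)
  qed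
  \<comment> \<open>A leading coefficient of \<open>q\<close> is one of \<open>r\<close> up to a nonzero factor, so it vanishes.\<close>
  have key: "\<rho> = 0" if lim: "(\<lambda>m. real m ^ i * q m / real m) \<longlonglongrightarrow> \<rho>" for i \<rho>
  proof -
    have "(\<lambda>m. (real m ^ i * q m / real m) / (real m * J m)) \<longlonglongrightarrow> \<rho> / fps_nth H 0"
      by (intro tendsto_divide lim mJ H0)
    then have "(\<lambda>m. real m ^ i * r m / real m ^ 2) \<longlonglongrightarrow> \<rho> / fps_nth H 0"
    proof (rule Lim_transform_eventually)
      show "\<forall>\<^sub>F m in sequentially. (real m ^ i * q m / real m) / (real m * J m) = real m ^ i * r m / real m ^ 2"
        using eventually_ge_at_top[of M]
      proof eventually_elim
        case (elim m)
        have "r m = q m / J m" using J0[OF elim] by (simp add: r[OF elim] q_def diff_divide_distrib)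
        then show ?case by (simp add: power2_eq_square)
      qed
    qed
    then have "\<rho> / fps_nth H 0 = 0"
      by (rule coefficient_limit_zero_if_bounded_near_1[OF bdd])
    then show ?thesis using H0 by simp
  qed
  have mL0: "moment b L \<longlonglongrightarrow> 0" by (rule moment_tendsto_0[OF b HL])
  have \<alpha>0: "\<alpha> = 0"
  proof (rule key[of 0])
    have "(\<lambda>m. \<alpha> + (\<beta> - moment b L m + real m ^ 0 * E m) * (1 / real m)) \<longlonglongrightarrow> \<alpha> + (\<beta> - 0 + 0) * 0"
      by (intro tendsto_add tendsto_diff tendsto_mult tendsto_const mL0 E0 lim_1_over_n)
    then have "(\<lambda>m. \<alpha> + (\<beta> - moment b L m + real m ^ 0 * E m) * (1 / real m)) \<longlonglongrightarrow> \<alpha>" by simp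
    then show "(\<lambda>m. real m ^ 0 * q m / real m) \<longlonglongrightarrow> \<alpha>"
      by (rule Lim_transform_eventually, intro eventually_mono[OF eventually_ge_at_top[of "max M 1"]])
         (auto simp: qE field_simps)
  qed
  have \<beta>0: "\<beta> = 0"
  proof (rule key[of 1])
    have "(\<lambda>m. \<beta> - moment b L m + real m ^ 0 * E m) \<longlonglongrightarrow> \<beta> - 0 + 0"
      by (intro tendsto_add tendsto_diff tendsto_const mL0 E0)
    then have "(\<lambda>m. \<beta> - moment b L m + real m ^ 0 * E m) \<longlonglongrightarrow> \<beta>" by simp
    then show "(\<lambda>m. real m ^ 1 * q m / real m) \<longlonglongrightarrow> \<beta>"
      by (rule Lim_transform_eventually, intro eventually_mono[OF eventually_ge_at_top[of "max M 1"]])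
         (auto simp: qE \<alpha>0)
  qed
  have "fps_nth ((?\<theta> ^^ j) L) 0 = 0" for j
  proof (induction j rule: less_induct)
    case (less j)
    have "- ((-1) ^ j * fps_nth ((?\<theta> ^^ j) L) 0) = 0"
    proof (rule key[of "j + 2"])
      have "(\<lambda>m. - (real m ^ Suc j * moment b L m) + real m ^ Suc j * E m)
         \<longlonglongrightarrow> - ((-1) ^ j * fps_nth ((?\<theta> ^^ j) L) 0) + 0"
        by (intro tendsto_add tendsto_minus moment_asymptotics b HL E0 less)
      then have "(\<lambda>m. - (real m ^ Suc j * moment b L m) + real m ^ Suc j * E m)
         \<longlonglongrightarrow> - ((-1) ^ j * fps_nth ((?\<theta> ^^ j) L) 0)" by simp
      then show "(\<lambda>m. real m ^ (j + 2) * q m / real m) \<longlonglongrightarrow> - ((-1) ^ j * fps_nth ((?\<theta> ^^ j) L) 0)"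
        by (rule Lim_transform_eventually, intro eventually_mono[OF eventually_ge_at_top[of "max M 1"]])
           (auto simp: qE \<alpha>0 \<beta>0 field_simps)
    qed
    then show ?case by simp
  qed
  then have "L = 0" by (rule fps_eq_0_if_euler_vanish)
  then show "fps_const p2 * ?\<theta> (?\<theta> H) - fps_const p1 * ?\<theta> H + fps_const p0 * H = 0"
    by (simp add: L_def)
  show "p2 * fps_nth H 0 = 2" "p1 * fps_nth H 0 = 1 + p2 * fps_nth (?\<theta> H) 0"
    using \<alpha>0 \<beta>0 by (simp_all add: \<alpha>_def \<beta>_def)
qed

section \<open>Solutions of the Euler equation at 0\<close>

lemma fps_conv_radius_complex: "fps_conv_radius (Abs_fps (\<lambda>n. complex_of_real (fps_nth Z n))) = fps_conv_radius Z"
  by (simp add: fps_conv_radius_def conv_radius_def)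

text \<open>The identity theorem, applied to the complexified series on the unit disc.\<close>

lemma fps_eq_0_if_vanishes_on_interval:
  fixes Z :: "real fps"
  assumes Z: "1 \<le> fps_conv_radius Z" and b: "0 \<le> b" "b < 1"
    and 0: "\<And>t. b < t \<Longrightarrow> t < 1 \<Longrightarrow> eval_fps Z t = 0"
  shows "Z = 0"
proof -
  define C where "C = Abs_fps (\<lambda>n. complex_of_real (fps_nth Z n))"
  have C: "1 \<le> fps_conv_radius C" using Z by (simp add: C_def fps_conv_radius_complex)
  have sub: "ball 0 1 \<subseteq> eball 0 (fps_conv_radius C)"
    using ball_eball_mono[of 1 "fps_conv_radius C" 0] C by (simp add: one_ereal_def)
  have ev: "eval_fps C (complex_of_real t) = complex_of_real (eval_fps Z t)" if "\<bar>t\<bar> < 1" for t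
  proof -
    have "summable (\<lambda>n. fps_nth Z n * t ^ n)"
      using that Z by (intro summable_fps less_le_trans[OF _ Z]) auto
    then show ?thesis by (simp add: eval_fps_def C_def suminf_of_real)
  qed
  define U where "U = complex_of_real ` {b<..<1}"
  define x where "x = complex_of_real ((b + 1) / 2)"
  have "x islimpt U"
    unfolding islimpt_approachable
  proof (intro allI impI)
    fix e :: real assume "e > 0"
    define t where "t = (b + 1) / 2 + min (e / 2) ((1 - b) / 4)"
    have t: "b < t" "t < 1" "t \<noteq> (b + 1) / 2" "\<bar>t - (b + 1) / 2\<bar> < e"
      using \<open>e > 0\<close> b by (auto simp: t_def min_def field_simps)
    then have "dist (complex_of_real t) x < e"
      unfolding x_def dist_norm by (metis norm_of_real of_real_diff)
    then show "\<exists>x'\<in>U. x' \<noteq> x \<and> dist x' x < e"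
      using t unfolding U_def x_def by (intro bexI[of _ "complex_of_real t"]) (auto simp del: of_real_add of_real_divide)
  qed
  have "eval_fps C w = 0" if "w \<in> ball 0 1" for w
  proof (rule analytic_continuation[of "eval_fps C" "ball 0 1" U x])
    show "eval_fps C holomorphic_on ball 0 1"
      by (rule holomorphic_on_eval_fps[OF sub])
    show "U \<subseteq> ball 0 1" "x \<in> ball 0 1" unfolding U_def x_def using b
      by (auto simp del: of_real_add of_real_divide)
    show "\<And>z. z \<in> U \<Longrightarrow> eval_fps C z = 0"
      unfolding U_def using b by (auto simp: ev 0)
  qed (use \<open>x islimpt U\<close> that in auto)
  then have "\<forall>\<^sub>F z in nhds 0. eval_fps C z = eval_fps 0 z"
    by (intro eventually_nhds_in_open[of "ball 0 1", THEN eventually_mono]) auto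
  moreover have "0 < fps_conv_radius C" using C by (simp add: less_le_trans[of 0 1])
  ultimately have "C = 0" by (intro eval_fps_eqD) auto
  show ?thesis
  proof (rule fps_ext)
    fix n
    have "fps_nth C n = 0" using \<open>C = 0\<close> by simp
    then show "fps_nth Z n = fps_nth 0 n" by (simp add: C_def)
  qed
qed

lemma fls_euler_of_fps: "fls_X * fls_deriv (fps_to_fls F) = fps_to_fls (fps_euler 0 F)"
  by (simp add: fls_deriv_fps_to_fls fps_euler_def fls_times_fps_to_fls)

text \<open>The hypothesis is the Euler equation \<open>\<theta>\<^sup>2v - (3/2) \<theta>v + p\<^sub>0 v = 0\<close> for
  \<open>v = N / A\<^sup>4\<close>, cleared of denominators: \<open>M1 = \<theta>v A\<^sup>5\<close> and \<open>M2 = \<theta>\<^sup>2v A\<^sup>6\<close>. In the field of formal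
  Laurent series \<open>\<theta>\<close> multiplies the \<open>i\<close>-th coefficient by \<open>i\<close>, so every exponent in
  \<open>v\<close> is a root of \<open>i\<^sup>2 - 3i/2 + p\<^sub>0\<close>. Two different roots would add up to \<open>3/2\<close>. The
  conclusion states \<open>N = c X\<^sup>k A\<^sup>4\<close> with the negative powers moved to the left.\<close>

lemma quotient_is_monomial:
  fixes A N :: "real fps" and p0 :: real
  defines "M1 \<equiv> A * fps_euler 0 N - 4 * N * fps_euler 0 A"
  defines "M2 \<equiv> A * fps_euler 0 M1 - 5 * M1 * fps_euler 0 A"
  assumes A: "A \<noteq> 0" and N: "N \<noteq> 0"
    and ode: "M2 - fps_const (3 / 2) * A * M1 + fps_const p0 * A ^ 2 * N = 0"
  obtains c :: real and k :: int where "fps_X ^ nat (- k) * N = fps_const c * fps_X ^ nat k * A ^ 4"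
proof -
  define a where "a = fps_to_fls A"
  define n where "n = fps_to_fls N"
  define \<theta> :: "real fls \<Rightarrow> real fls" where "\<theta> = (\<lambda>F. fls_X * fls_deriv F)"
  have \<theta>_mult: "\<theta> (F * G) = F * \<theta> G + \<theta> F * G" for F G
    by (simp add: \<theta>_def algebra_simps)
  have \<theta>_pow: "\<theta> (a ^ Suc i) = of_nat (Suc i) * a ^ i * \<theta> a" for i
    unfolding \<theta>_def by (subst fls_deriv_power) (simp add: algebra_simps)
  define v where "v = n / a ^ 4"
  have a0: "a \<noteq> 0" and n0: "n \<noteq> 0" using A N by (auto simp: a_def n_def)
  have va: "v * a ^ 4 = n" using a0 by (simp add: v_def)
  have \<theta>A: "fps_to_fls (fps_euler 0 F) = \<theta> (fps_to_fls F)" for F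
    by (simp add: \<theta>_def fls_euler_of_fps)
  have m1: "fps_to_fls M1 = \<theta> v * a ^ 5"
  proof -
    have "fps_to_fls M1 = a * \<theta> n - 4 * n * \<theta> a"
      by (simp add: M1_def fls_times_fps_to_fls \<theta>A a_def n_def)
    also have "\<theta> n = v * (4 * a ^ 3 * \<theta> a) + \<theta> v * a ^ 4"
      unfolding va[symmetric] \<theta>_mult using \<theta>_pow[of 3] by (simp add: eval_nat_numeral)
    finally show ?thesis unfolding va[symmetric] by (simp add: algebra_simps power_numeral_reduce)
  qed
  have m2: "fps_to_fls M2 = \<theta> (\<theta> v) * a ^ 6"
  proof -
    have "fps_to_fls M2 = a * \<theta> (fps_to_fls M1) - 5 * fps_to_fls M1 * \<theta> a"
      by (simp add: M2_def fls_times_fps_to_fls \<theta>A a_def)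
    also have "\<theta> (fps_to_fls M1) = \<theta> v * (5 * a ^ 4 * \<theta> a) + \<theta> (\<theta> v) * a ^ 5"
      unfolding m1 \<theta>_mult using \<theta>_pow[of 4] by (simp add: eval_nat_numeral)
    finally show ?thesis unfolding m1 by (simp add: algebra_simps power_numeral_reduce)
  qed
  have "fps_to_fls (M2 - fps_const (3 / 2) * A * M1 + fps_const p0 * A ^ 2 * N) = 0"
    unfolding ode by simp
  then have "(\<theta> (\<theta> v) - fls_const (3 / 2) * \<theta> v + fls_const p0 * v) * a ^ 6 = 0"
    unfolding fps_to_fls_plus fps_to_fls_minus fls_times_fps_to_fls m1 m2 fps_to_fls_power
      a_def[symmetric] n_def[symmetric] va[symmetric]
    by (simp add: algebra_simps power_numeral_reduce fls_const_nonzero)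
  then have L: "\<theta> (\<theta> v) - fls_const (3 / 2) * \<theta> v + fls_const p0 * v = 0" using a0 by simp
  have \<theta>_nth: "fls_nth (\<theta> F) i = of_int i * fls_nth F i" for F i
    by (simp add: \<theta>_def fls_X_times_conv_shift)
  have root: "(of_int i ^ 2 - 3 / 2 * of_int i + p0) * fls_nth v i = 0" for i
  proof -
    have "fls_nth (\<theta> (\<theta> v) - fls_const (3 / 2) * \<theta> v + fls_const p0 * v) i = 0" using L by simp
    then show ?thesis by (simp add: \<theta>_nth algebra_simps power2_eq_square)
  qed
  have v0: "v \<noteq> 0" using n0 a0 by (simp add: v_def)
  define k where "k = fls_subdegree v"
  have kn: "fls_nth v k \<noteq> 0" using v0 by (simp add: k_def)
  have only: "fls_nth v i = 0" if "i \<noteq> k" for i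
  proof (rule ccontr)
    assume "fls_nth v i \<noteq> 0"
    then have "real_of_int i ^ 2 - 3 / 2 * of_int i + p0 = 0" "real_of_int k ^ 2 - 3 / 2 * of_int k + p0 = 0"
      using root[of i] root[of k] kn by auto
    moreover have "(real_of_int i - of_int k) * (of_int i + of_int k - 3 / 2) =
       (real_of_int i ^ 2 - 3 / 2 * of_int i + p0) - (real_of_int k ^ 2 - 3 / 2 * of_int k + p0)"
      by (simp add: field_simps power2_eq_square)
    ultimately have "(real_of_int i - of_int k) * (of_int i + of_int k - 3 / 2) = 0" by simp
    with that have "real_of_int (2 * (i + k)) = real_of_int 3" by simp
    then have "2 * (i + k) = 3" by (simp only: of_int_eq_iff)
    then show False by presburger
  qed
  define c where "c = fls_nth v k"
  have "v = fls_const c * fls_X_intpow k"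
    by (rule fls_eqI) (auto simp: c_def only)
  then have nk: "n = fls_const c * fls_X_intpow k * a ^ 4" using va by simp
  have "fls_X ^ nat (- k) * fls_X_intpow k = (fls_X ^ nat k :: real fls)"
    by (cases "0 \<le> k") (simp_all add: fls_X_power_conv_shift_1 fls_X_intpow_times_fls_X_intpow
        fls_X_intpow_times_fls_X_intpow[of "- k" k, simplified])
  then have "fls_X ^ nat (- k) * n = fls_const c * fls_X ^ nat k * a ^ 4"
    unfolding nk by (simp add: mult_ac)
  then have "fps_to_fls (fps_X ^ nat (- k) * N) = fps_to_fls (fps_const c * fps_X ^ nat k * A ^ 4)"
    by (simp add: fls_times_fps_to_fls fps_to_fls_power n_def a_def fls_X_def[symmetric])
  then show thesis by (intro that[of k c]) (simp only: fps_to_fls_eq_iff)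
qed

section \<open>The profile function\<close>

lemma sums_triangular:
  fixes t :: real assumes "\<bar>t\<bar> < 1"
  shows "(\<lambda>n. (real n + 1) * (real n + 2) / 2 * t ^ n) sums (1 / (1 - t) ^ 3)"
proof -
  define G where "G = Abs_fps (\<lambda>n. of_nat (Suc n) :: real)"
  have G1: "1 \<le> fps_conv_radius G"
    unfolding fps_conv_radius_def G_def
  proof (rule conv_radius_geI_ex')
    fix r :: real assume "0 < r" "ereal r < 1"
    then show "summable (\<lambda>n. fps_nth (Abs_fps (\<lambda>n. of_nat (Suc n) :: real)) n * of_real r ^ n)"
      using geometric_deriv_sums[of r] by (simp add: sums_iff)
  qed
  have ev: "eval_fps G s = 1 / (1 - s) ^ 2" if "\<bar>s\<bar> < 1" for s
    using geometric_deriv_sums[of s] that by (simp add: eval_fps_def G_def sums_iff)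
  have n: "ereal (norm t) < fps_conv_radius G" using assms by (intro less_le_trans[OF _ G1]) auto
  have "(eval_fps G has_field_derivative eval_fps (fps_deriv G) t) (at t)"
    using n by (intro has_field_derivative_eval_fps) (auto simp: in_eball_iff)
  moreover have "(eval_fps G has_field_derivative 2 / (1 - t) ^ 3) (at t)"
  proof -
    have "((\<lambda>s. 1 / (1 - s) ^ 2) has_field_derivative 2 / (1 - t) ^ 3) (at t)"
    proof -
      have nz: "1 - t \<noteq> 0" using assms by auto
      have "((\<lambda>s. inverse (1 - s) ^ 2) has_field_derivative
          2 * inverse (1 - t) * (inverse (1 - t) * inverse (1 - t))) (at t)"
        using nz by (auto intro!: derivative_eq_intros simp: algebra_simps)
      then show ?thesis
        by (simp add: divide_inverse power_inverse power3_eq_cube mult_ac)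
    qed
    then show ?thesis
      using assms ev by (elim has_field_derivative_transform_within_open[of _ _ _ "{-1<..<1}"]) auto
  qed
  ultimately have "eval_fps (fps_deriv G) t = 2 / (1 - t) ^ 3" by (rule DERIV_unique)
  moreover have "(\<lambda>n. fps_nth (fps_deriv G) n * t ^ n) sums eval_fps (fps_deriv G) t"
    using fps_conv_radius_deriv[of G] n by (intro sums_eval_fps) (auto intro: less_le_trans)
  ultimately have "(\<lambda>n. fps_nth (fps_deriv G) n * t ^ n / 2) sums (2 / (1 - t) ^ 3 / 2)"
    by (intro sums_divide) simp
  then show ?thesis by (simp add: G_def algebra_simps)
qed

text \<open>Away from 1 the factor \<open>t\<^sup>m\<^sup>-\<^sup>M\<close> is at most \<open>b\<^sup>m\<^sup>-\<^sup>M\<close>, so finiteness of one moment makes the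
  remainder \<open>D\<close> exponentially small. Finiteness has to be assumed for some \<open>M\<close>, since \<open>V\<close>
  is arbitrary near 0.\<close>

lemma radial_moments_split:
  fixes V :: "real \<Rightarrow> real" and J :: "nat \<Rightarrow> ennreal"
  assumes J: "\<And>m. J m = (\<integral>\<^sup>+t\<in>{0<..<1}. ennreal (t ^ m * (V t / t)) \<partial>lborel)"
    and b: "0 < b" "b < 1" and H: "ereal (1 - b) < fps_conv_radius H"
    and pos: "\<And>t. 0 < t \<Longrightarrow> t < 1 \<Longrightarrow> 0 < V t" and cont: "continuous_on {0<..<1} V"
    and eq: "\<And>t. b < t \<Longrightarrow> t < 1 \<Longrightarrow> V t = eval_fps H (t - 1)"
    and fin: "J M \<noteq> \<infinity>"
  obtains D K where "\<And>m. m \<ge> M \<Longrightarrow> enn2real (J m) = D m + moment b H m"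
    and "\<And>m. m \<ge> M \<Longrightarrow> \<bar>D m\<bar> \<le> K * b ^ m"
    and "\<And>m. m \<ge> M \<Longrightarrow> J m \<noteq> \<infinity>" and "\<And>m. m \<ge> M \<Longrightarrow> 0 < enn2real (J m)"
proof -
  define w where "w m t = ennreal (t ^ m * (V t / t))" for m t
  have [measurable]: "(\<lambda>t. w m t * indicator {0<..<1} t) \<in> borel_measurable borel" for m
  proof -
    have "continuous_on {0<..<1} (\<lambda>t. t ^ m * (V t / t))"
      by (intro continuous_intros cont) auto
    then have [measurable]: "(\<lambda>t. indicator {0<..<1} t *\<^sub>R (t ^ m * (V t / t))) \<in> borel_measurable borel"
      by (intro borel_measurable_continuous_on_indicator) auto
    have "(\<lambda>t. w m t * indicator {0<..<1} t) = (\<lambda>t. ennreal (indicator {0<..<1} t *\<^sub>R (t ^ m * (V t / t))))"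
      by (auto simp: w_def fun_eq_iff split: split_indicator)
    then show ?thesis by (simp only:) measurable
  qed
  have Jw: "J m = (\<integral>\<^sup>+t. w m t * indicator {0<..<1} t \<partial>lborel)" for m
    by (simp add: J w_def)
  define P where "P m = (\<integral>\<^sup>+t. w m t * indicator {0<..<1} t * indicator {..b} t \<partial>lborel)" for m
  have Q: "(\<integral>\<^sup>+t. w m t * indicator {0<..<1} t * indicator {b<..} t \<partial>lborel) = ennreal (moment b H m)"
    and Q0: "0 \<le> moment b H m" for m
  proof -
    let ?g = "\<lambda>t. t ^ m * (eval_fps H (t - 1) / t)"
    have "(?g has_integral moment b H m) {b..1}"
      unfolding moment_def
      by (intro integrable_integral integrable_continuous_interval continuous_on_moment_integrand b H)
    then have hi: "(?g has_integral moment b H m) {b<..<1}" by (simp add: has_integral_Icc_iff_Ioo)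
    have nn: "0 \<le> ?g t" if "t \<in> {b<..<1}" for t
      using that pos[of t] eq[of t] b by simp
    have "(\<integral>\<^sup>+t. w m t * indicator {0<..<1} t * indicator {b<..} t \<partial>lborel)
       = (\<integral>\<^sup>+t. ennreal (?g t) * indicator {b<..<1} t \<partial>lborel)"
      using b by (intro nn_integral_cong) (auto simp: w_def eq split: split_indicator)
    also have "\<dots> = ennreal (moment b H m)"
      by (rule nn_integral_has_integral_lebesgue'[OF nn hi])
    finally show "(\<integral>\<^sup>+t. w m t * indicator {0<..<1} t * indicator {b<..} t \<partial>lborel) = ennreal (moment b H m)" .
    show "0 \<le> moment b H m" by (rule has_integral_nonneg[OF hi nn])
  qed
  have JPQ: "J m = P m + ennreal (moment b H m)" for m
    unfolding Jw P_def Q[symmetric]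
    by (subst nn_integral_add[symmetric]) (auto intro!: nn_integral_cong split: split_indicator)
  have PM: "P M \<noteq> \<infinity>" using fin unfolding JPQ by auto
  have Ple: "P m \<le> ennreal (b ^ (m - M)) * P M" if m: "m \<ge> M" for m
  proof -
    have "P m \<le> (\<integral>\<^sup>+t. ennreal (b ^ (m - M)) * (w M t * indicator {0<..<1} t * indicator {..b} t) \<partial>lborel)"
      unfolding P_def
    proof (rule nn_integral_mono)
      fix t :: real
      have "w m t \<le> ennreal (b ^ (m - M)) * w M t" if t: "0 < t" "t < 1" "t \<le> b"
      proof -
        have "t ^ m * (V t / t) = t ^ (m - M) * (t ^ M * (V t / t))"
          using m by (simp add: power_add[symmetric] mult.assoc[symmetric])
        also have "\<dots> \<le> b ^ (m - M) * (t ^ M * (V t / t))"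
          using t pos[of t] by (intro mult_right_mono power_mono) auto
        finally show ?thesis using b t pos[of t] by (simp add: w_def ennreal_mult[symmetric] ennreal_leI)
      qed
      then show "w m t * indicator {0<..<1} t * indicator {..b} t \<le>
        ennreal (b ^ (m - M)) * (w M t * indicator {0<..<1} t * indicator {..b} t)"
        by (auto split: split_indicator)
    qed
    also have "\<dots> = ennreal (b ^ (m - M)) * P M"
      unfolding P_def by (intro nn_integral_cmult) auto
    finally show ?thesis .
  qed
  have Pfin: "P m < \<infinity>" if "m \<ge> M" for m
    by (rule le_less_trans[OF Ple[OF that]]) (use PM in \<open>simp add: ennreal_mult_less_top less_top\<close>)
  have Jfin: "J m \<noteq> \<infinity>" if "m \<ge> M" for m
    using Pfin[OF that] by (simp add: JPQ less_top)
  show thesis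
  proof (rule that)
    fix m assume m: "m \<ge> M"
    show "J m \<noteq> \<infinity>" using Jfin[OF m] .
    show "enn2real (J m) = enn2real (P m) + moment b H m"
      using Pfin[OF m] Q0 by (simp add: JPQ enn2real_plus)
    have "enn2real (P m) \<le> enn2real (ennreal (b ^ (m - M)) * P M)"
      using Ple[OF m] PM by (intro enn2real_mono) (auto simp: ennreal_mult_less_top less_top)
    also have "\<dots> = (enn2real (P M) / b ^ M) * b ^ m"
      using b m by (simp add: enn2real_mult power_diff)
    finally show "\<bar>enn2real (P m)\<bar> \<le> (enn2real (P M) / b ^ M) * b ^ m" by simp
    have "J m \<noteq> 0"
    proof
      assume "J m = 0"
      then have "AE t in lborel. w m t * indicator {0<..<1} t = 0"
        unfolding Jw by (subst (asm) nn_integral_0_iff_AE) auto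
      then have "AE t in lborel. t \<notin> {0<..<1::real}"
      proof eventually_elim
        case (elim t)
        have "0 < t ^ m * (V t / t)" if "t \<in> {0<..<1}" using that pos[of t] by simp
        then show ?case using elim unfolding w_def
          by (metis ennreal_eq_0_iff indicator_simps(1) leD mult.right_neutral)
      qed
      then have "emeasure lborel {0<..<1::real} = 0"
        by (subst (asm) AE_iff_measurable[of "{0<..<1}"]) auto
      then show False by simp
    qed
    then show "0 < enn2real (J m)" using Jfin[OF m] by (simp add: enn2real_positive_iff less_top zero_less_iff_neq_zero)
  qed
qed

lemma fps_euler_1_nth: "fps_nth (fps_euler 1 H) m = real (m + 1) * fps_nth H (m + 1) + real m * fps_nth H m"
  by (cases m) (auto simp: fps_euler_def algebra_simps)

text \<open>With \<open>F = - X G\<close>, the singular part comes from the first three coefficients of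
  \<open>1 / G\<^sup>3\<close>, and the rest of that series gives \<open>S\<close>.\<close>

lemma inverse_cube_expansion:
  fixes F :: "real fps"
  assumes F: "0 < fps_conv_radius F" and F0: "fps_nth F 0 = 0" and F1: "fps_nth F 1 = -1"
  obtains S :: "real fps" and q2 \<epsilon> :: real where "0 < \<epsilon>" "ereal \<epsilon> \<le> fps_conv_radius S"
    and "\<And>t. 1 - \<epsilon> < t \<Longrightarrow> t < 1 \<Longrightarrow> eval_fps F (t - 1) \<noteq> 0 \<and> 1 / eval_fps F (t - 1) ^ 3 =
      1 / (1 - t) ^ 3 - 3 * fps_nth F 2 / (1 - t) ^ 2 + q2 / (1 - t) - eval_fps S (t - 1)"
proof -
  define G where "G = fps_shift 1 (- F)"
  define Q where "Q = inverse (G ^ 3)"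
  define S where "S = fps_shift 3 (Q - fps_const 1 - fps_const (3 * fps_nth F 2) * fps_X - fps_const (fps_nth Q 2) * fps_X ^ 2)"
  have G0: "fps_nth G 0 = 1" and G1: "fps_nth G 1 = - fps_nth F 2"
    using F1 by (simp_all add: G_def numeral_2_eq_2)
  have Grad: "0 < fps_conv_radius G" using F by (simp add: G_def)
  have G3: "0 < fps_conv_radius (G ^ 3)"
    using Grad fps_conv_radius_power[of G 3] by (rule less_le_trans)
  have G30: "fps_nth (G ^ 3) 0 = 1" by (simp add: G0 fps_nth_power_0)
  have G31: "fps_nth (G ^ 3) 1 = - 3 * fps_nth F 2"
    using G0 G1 by (simp add: power3_eq_cube fps_mult_nth)
  have Qrad: "0 < fps_conv_radius Q"
    unfolding Q_def using G30 G3 by (intro fps_conv_radius_inverse_pos) auto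
  have QG: "Q * G ^ 3 = 1" unfolding Q_def using G30 by (intro inverse_mult_eq_1) auto
  have Q0: "fps_nth Q 0 = 1" using arg_cong[OF QG, of "\<lambda>f. fps_nth f 0"] G30 by simp
  have Q1: "fps_nth Q 1 = 3 * fps_nth F 2"
    using arg_cong[OF QG, of "\<lambda>f. fps_nth f 1"] G30 G31 Q0 by (simp add: fps_mult_nth)
  let ?R = "Q - fps_const 1 - fps_const (3 * fps_nth F 2) * fps_X - fps_const (fps_nth Q 2) * fps_X ^ 2"
  have Rrad: "fps_conv_radius Q \<le> fps_conv_radius ?R"
    by (intro fps_conv_radius_diff_ge fps_conv_radius_mult_ge) auto
  have Rsub: "3 \<le> subdegree ?R \<or> ?R = 0"
  proof (cases "?R = 0")
    case False
    have "fps_nth ?R i = 0" if "i < 3" for i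
      using that Q0 Q1 by (auto simp: less_Suc_eq numeral_3_eq_3 numeral_2_eq_2 fps_X_power_nth)
    then show ?thesis using False by (metis leI nth_subdegree_nonzero)
  qed simp
  obtain \<epsilon> where \<epsilon>: "0 < \<epsilon>" "ereal \<epsilon> < fps_conv_radius F" "ereal \<epsilon> < fps_conv_radius Q"
  proof -
    have "0 < min (fps_conv_radius F) (fps_conv_radius Q)" using F Qrad by simp
    then obtain e where "0 < e" "e < min (fps_conv_radius F) (fps_conv_radius Q)" using dense by blast
    then show ?thesis by (intro that[of "real_of_ereal e"]; cases e) auto
  qed
  show thesis
  proof (rule that[of \<epsilon> S "fps_nth Q 2"])
    show "ereal \<epsilon> \<le> fps_conv_radius S"
      using \<epsilon>(3) Rrad unfolding S_def fps_conv_radius_shift by (meson less_imp_le less_le_trans order_trans)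
    fix t assume t: "1 - \<epsilon> < t" "t < 1"
    define x where "x = t - 1"
    have x: "x \<noteq> 0" "ereal (norm x) < ereal \<epsilon>" using t by (auto simp: x_def)
    have xF: "ereal (norm x) < fps_conv_radius F" and xQ: "ereal (norm x) < fps_conv_radius Q"
      using x(2) \<epsilon> by (meson less_trans)+
    have xG: "ereal (norm x) < fps_conv_radius G" using xF by (simp add: G_def)
    have "F = - (G * fps_X)"
      unfolding G_def using F0
      by (intro fps_ext) (simp add: fps_X_mult_right_nth)
    then have "eval_fps F x = - eval_fps (G * fps_X) x" using xG
      by (simp add: eval_fps_minus[OF less_le_trans[OF xG fps_conv_radius_mult_ge]])
    then have Fx: "eval_fps F x = - (eval_fps G x * x)" using xG by (simp add: eval_fps_mult)
    have QGx: "eval_fps Q x * eval_fps G x ^ 3 = 1"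
    proof -
      have "eval_fps (Q * G ^ 3) x = eval_fps Q x * eval_fps G x ^ 3"
        using xQ xG less_le_trans[OF xG fps_conv_radius_power] by (simp add: eval_fps_mult eval_fps_power)
      then show ?thesis by (simp add: QG)
    qed
    have Rx: "eval_fps S x * x ^ 3 = eval_fps ?R x"
    proof (cases "?R = 0")
      case True then show ?thesis by (simp add: S_def)
    next
      case False
      then show ?thesis using Rsub x less_le_trans[OF xQ Rrad] unfolding S_def
        by (subst eval_fps_shift) auto
    qed
    have "fps_value ?R x (eval_fps Q x - 1 - 3 * fps_nth F 2 * x - fps_nth Q 2 * x ^ 2)"
      using xQ by (intro fps_value_intros fps_value_eval) simp
    then have "eval_fps ?R x = eval_fps Q x - 1 - 3 * fps_nth F 2 * x - fps_nth Q 2 * x ^ 2"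
      by (simp add: fps_value_def)
    with Rx have Qx: "eval_fps Q x = 1 + 3 * fps_nth F 2 * x + fps_nth Q 2 * x ^ 2 + eval_fps S x * x ^ 3" by simp
    have g0: "eval_fps G x \<noteq> 0" using QGx by auto
    have "1 / eval_fps F x ^ 3 = - (eval_fps Q x / x ^ 3)"
      using x g0 QGx unfolding Fx by (simp add: field_simps power_mult_distrib)
    also have "\<dots> = - (1 / x ^ 3) - 3 * fps_nth F 2 / x ^ 2 - fps_nth Q 2 / x - eval_fps S x"
      unfolding Qx using x(1) by (simp add: field_simps power2_eq_square power3_eq_cube)
    also have "\<dots> = 1 / (1 - t) ^ 3 - 3 * fps_nth F 2 / (1 - t) ^ 2 + fps_nth Q 2 / (1 - t) - eval_fps S x"
    proof -
      have y: "1 - t = - x" by (simp add: x_def)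
      show ?thesis unfolding y by simp
    qed
    finally show "eval_fps F (t - 1) \<noteq> 0 \<and> 1 / eval_fps F (t - 1) ^ 3 =
      1 / (1 - t) ^ 3 - 3 * fps_nth F 2 / (1 - t) ^ 2 + fps_nth Q 2 / (1 - t) - eval_fps S (t - 1)"
      using g0 x(1) Fx by (simp add: x_def)
  qed (use \<epsilon> in auto)
qed

text \<open>Uniqueness of derivatives turns an explicit derivative of the represented function into
  a value of the formal Euler derivative.\<close>

lemma eval_euler_eqI:
  assumes S: "open S" "t \<in> S" and F: "ereal \<bar>t - c\<bar> < fps_conv_radius F" and t: "t \<noteq> 0"
    and eq: "\<And>s. s \<in> S \<Longrightarrow> eval_fps F (s - c) = g s"
    and d: "(g has_real_derivative g' / t) (at t)"
  shows "fps_value (fps_euler c F) (t - c) g'"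
proof -
  have "(g has_real_derivative eval_fps (fps_euler c F) (t - c) / t) (at t)"
    by (rule has_field_derivative_transform_within_open[OF has_real_derivative_eval_fps_euler[OF F t] S eq])
  from DERIV_unique[OF this d] have "eval_fps (fps_euler c F) (t - c) = g'" using t by simp
  moreover have "ereal \<bar>t - c\<bar> < fps_conv_radius (fps_euler c F)"
    using F fps_conv_radius_euler_ge[OF order_refl, of F c] by (rule less_le_trans)
  ultimately show ?thesis by (simp add: fps_value_def)
qed

text \<open>The analytic heart of the matter. Here \<open>f1\<close> and \<open>f2\<close> are \<open>\<theta>f\<close> and \<open>\<theta>\<^sup>2f\<close>,
  and \<open>V(t) / t\<close> is the density of the radial volume with the weight \<open>f\<^sup>3\<close>, up to a constant
  factor. The proof compares the expansions at 1 and at 0 of the same function \<open>V\<close>.\<close>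

lemma no_balanced_profile:
  fixes f f1 f2 V :: "real \<Rightarrow> real" and F :: "real fps" and J :: "nat \<Rightarrow> ennreal"
  assumes J: "\<And>m. J m = (\<integral>\<^sup>+t\<in>{0<..<1}. ennreal (t ^ m * (V t / t)) \<partial>lborel)"
    and fpos: "\<And>t. 0 < t \<Longrightarrow> t < 1 \<Longrightarrow> 0 < f t"
    and d0: "\<And>t. 0 < t \<Longrightarrow> t < 1 \<Longrightarrow> (f has_real_derivative f1 t / t) (at t)"
    and d1: "\<And>t. 0 < t \<Longrightarrow> t < 1 \<Longrightarrow> (f1 has_real_derivative f2 t / t) (at t)"
    and F: "0 < fps_conv_radius F" "0 < \<epsilon>" "\<And>t. 1 - \<epsilon> < t \<Longrightarrow> t < 1 \<Longrightarrow> f t = eval_fps F (t - 1)"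
    and F0: "fps_nth F 0 = 0" and F1: "fps_nth F 1 = -1"
    and V: "\<And>t. 0 < t \<Longrightarrow> t < 1 \<Longrightarrow> V t = - 2 * f1 t * (f1 t ^ 2 - f t * f2 t)"
    and Vpos: "\<And>t. 0 < t \<Longrightarrow> t < 1 \<Longrightarrow> 0 < V t" and Vcont: "continuous_on {0<..<1} V"
    and c: "0 < c"
    and sums: "\<And>t. 0 < t \<Longrightarrow> t < 1 \<Longrightarrow>
       (\<lambda>m. (if J m = \<infinity> then 0 else (2 * real m + 1) / enn2real (J m)) * t ^ m) sums (c / f t ^ 3)"
  shows False
proof -
  define a where "a m = (if J m = \<infinity> then 0 else (2 * real m + 1) / enn2real (J m))" for m
  define A where "A = Abs_fps a"
  have sums_a: "(\<lambda>m. a m * t ^ m) sums (c / f t ^ 3)" if "0 < t" "t < 1" for t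
    using sums[OF that] by (simp add: a_def)
  have Arad: "1 \<le> fps_conv_radius A"
    unfolding fps_conv_radius_def A_def
  proof (rule conv_radius_geI_ex')
    fix r :: real assume "0 < r" "ereal r < 1"
    then show "summable (\<lambda>n. fps_nth (Abs_fps a) n * of_real r ^ n)"
      using sums_a[of r] by (simp add: sums_iff)
  qed
  have evA: "eval_fps A t = c / f t ^ 3" if "0 < t" "t < 1" for t
    using sums_a[OF that] by (simp add: eval_fps_def A_def sums_iff)
  \<comment> \<open>If all moments were infinite, the series and hence \<open>c / f\<^sup>3\<close> would vanish.\<close>
  obtain M where M: "J M \<noteq> \<infinity>"
  proof (rule ccontr)
    assume "\<not> thesis"
    then have "J m = \<infinity>" for m using that by blast
    then have "a = (\<lambda>_. 0)" by (auto simp: a_def)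
    then have "c / f (1/2) ^ 3 = 0" using sums_a[of "1/2"] by (simp add: sums_iff)
    then show False using c fpos[of "1/2"] by simp
  qed
  obtain S q2 \<epsilon>' where S: "0 < \<epsilon>'" "ereal \<epsilon>' \<le> fps_conv_radius S"
    and inv3: "\<And>t. 1 - \<epsilon>' < t \<Longrightarrow> t < 1 \<Longrightarrow> eval_fps F (t - 1) \<noteq> 0 \<and> 1 / eval_fps F (t - 1) ^ 3 =
      1 / (1 - t) ^ 3 - 3 * fps_nth F 2 / (1 - t) ^ 2 + q2 / (1 - t) - eval_fps S (t - 1)"
    using inverse_cube_expansion[OF F(1) F0 F1] by metis
  obtain e where e: "0 < e" "ereal e < fps_conv_radius F"
  proof -
    obtain e where "0 < e" "e < fps_conv_radius F" using F(1) dense by blast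
    then show ?thesis by (intro that[of "real_of_ereal e"]; cases e) auto
  qed
  define b where "b = 1 - min (min \<epsilon> \<epsilon>') (min e 1) / 2"
  have b: "0 < b" "b < 1" "1 - b < \<epsilon>" "1 - b < \<epsilon>'" "1 - b < e"
    using F(2) S(1) e by (auto simp: b_def min_def field_simps)
  have bF: "ereal (1 - b) < fps_conv_radius F" using b e(2) by (meson less_ereal.simps(1) less_trans)
  have bS: "ereal (1 - b) < fps_conv_radius S" using b S(2) by (meson less_ereal.simps(1) less_le_trans)
  have fF: "f t = eval_fps F (t - 1)" if "b < t" "t < 1" for t
    using F(3)[of t] b that by simp
  let ?\<theta> = "fps_euler 1"
  have vF: "fps_value F (t - 1) (f t)" if "b < t" "t < 1" for t
    unfolding fF[OF that] using that by (intro fps_value_eval less_trans[OF _ bF]) simp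
  have vF1: "fps_value (?\<theta> F) (t - 1) (f1 t)" if "b < t" "t < 1" for t
    using that b vF[OF that] by (intro eval_euler_eqI[of "{b<..<1}", OF _ _ _ _ _ d0]) (auto simp: fps_value_def fF)
  have vF2: "fps_value (?\<theta> (?\<theta> F)) (t - 1) (f2 t)" if "b < t" "t < 1" for t
    using that b vF1 by (intro eval_euler_eqI[of "{b<..<1}", OF _ _ _ _ _ d1]) (auto simp: fps_value_def)
  define H where "H = fps_const (- 2) * ?\<theta> F * ((?\<theta> F) ^ 2 - F * ?\<theta> (?\<theta> F))"
  have vH: "fps_value H (t - 1) (V t)" if "b < t" "t < 1" for t
    unfolding H_def V[OF less_trans[OF b(1) that(1)] that(2)]
    by (intro fps_value_intros vF vF1 vF2 that)
  have bH: "ereal (1 - b) < fps_conv_radius H"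
    unfolding H_def
    by (rule less_le_trans[OF bF]) (intro fps_radius_intros order_refl, simp)
  have evH: "V t = eval_fps H (t - 1)" if "b < t" "t < 1" for t
    using vH[OF that] by (simp add: fps_value_def)
  obtain D K where JD: "\<And>m. m \<ge> M \<Longrightarrow> enn2real (J m) = D m + moment b H m"
    and DK: "\<And>m. m \<ge> M \<Longrightarrow> \<bar>D m\<bar> \<le> K * b ^ m"
    and Jfin: "\<And>m. m \<ge> M \<Longrightarrow> J m \<noteq> \<infinity>" and Jpos: "\<And>m. m \<ge> M \<Longrightarrow> 0 < enn2real (J m)"
    using radial_moments_split[OF J b(1,2) bH Vpos Vcont evH M] by blast
  \<comment> \<open>\<open>p2 m\<^sup>2 + p1 m + p0\<close> is the polynomial whose generating function is the polar part
    \<open>c (1-t)\<^sup>-\<^sup>3 - 3\<phi>c (1-t)\<^sup>-\<^sup>2 + q2 c (1-t)\<^sup>-\<^sup>1\<close> of \<open>c / f\<^sup>3\<close> at 1.\<close>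
  define \<phi> where "\<phi> = fps_nth F 2"
  define p2 where "p2 = c / 2"
  define p1 where "p1 = c * (3 / 2 - 3 * \<phi>)"
  define p0 where "p0 = c * (1 - 3 * \<phi> + q2)"
  define r where "r m = a m - (p2 * real m ^ 2 + p1 * real m + p0)" for m
  have sums_r: "(\<lambda>m. r m * t ^ m) sums
      (c / f t ^ 3 - (c * (1 / (1 - t) ^ 3) - 3 * \<phi> * c * (1 / (1 - t) ^ 2) + q2 * c * (1 / (1 - t))))"
    if t: "0 < t" "t < 1" for t
  proof -
    have "(\<lambda>m. a m * t ^ m - (c * ((real m + 1) * (real m + 2) / 2 * t ^ m) -
        3 * \<phi> * c * (of_nat (Suc m) * t ^ m) + q2 * c * t ^ m)) sums
      (c / f t ^ 3 - (c * (1 / (1 - t) ^ 3) - 3 * \<phi> * c * (1 / (1 - t) ^ 2) + q2 * c * (1 / (1 - t))))"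
      using t by (intro sums_diff sums_add sums_mult sums_a sums_triangular geometric_deriv_sums geometric_sums) auto
    moreover have "a m * t ^ m - (c * ((real m + 1) * (real m + 2) / 2 * t ^ m) -
        3 * \<phi> * c * (of_nat (Suc m) * t ^ m) + q2 * c * t ^ m) = r m * t ^ m" for m
    proof -
      have "a m * t ^ m - (c * ((real m + 1) * (real m + 2) / 2 * t ^ m) -
        3 * \<phi> * c * (of_nat (Suc m) * t ^ m) + q2 * c * t ^ m) =
        (a m - (c * ((real m + 1) * (real m + 2) / 2) - 3 * \<phi> * c * (real m + 1) + q2 * c)) * t ^ m"
        by (simp add: algebra_simps)
      also have "a m - (c * ((real m + 1) * (real m + 2) / 2) - 3 * \<phi> * c * (real m + 1) + q2 * c) = r m"
        by (simp add: r_def p2_def p1_def p0_def field_simps power2_eq_square)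
      finally show ?thesis .
    qed
    ultimately show ?thesis by simp
  qed
  define R where "R = Abs_fps r"
  have Rrad: "1 \<le> fps_conv_radius R"
    unfolding fps_conv_radius_def R_def
  proof (rule conv_radius_geI_ex')
    fix r' :: real assume "0 < r'" "ereal r' < 1"
    then show "summable (\<lambda>n. fps_nth (Abs_fps r) n * of_real r' ^ n)"
      using sums_r[of r'] by (simp add: sums_iff)
  qed
  have RS: "eval_fps R t = eval_fps (fps_const (- c) * S) (t - 1)" if t: "b < t" "t < 1" for t
  proof -
    have "eval_fps R t = c / f t ^ 3 - (c * (1 / (1 - t) ^ 3) - 3 * \<phi> * c * (1 / (1 - t) ^ 2) + q2 * c * (1 / (1 - t)))"
      using sums_r[of t] t b by (simp add: eval_fps_def R_def sums_iff)
    also have "c / f t ^ 3 = c * (1 / eval_fps F (t - 1) ^ 3)" using fF[OF t] by simp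
    also have "1 / eval_fps F (t - 1) ^ 3 = 1 / (1 - t) ^ 3 - 3 * \<phi> / (1 - t) ^ 2 + q2 / (1 - t) - eval_fps S (t - 1)"
      using inv3[of t] t b by (simp add: \<phi>_def)
    finally have "eval_fps R t = - c * eval_fps S (t - 1)" by (simp add: algebra_simps)
    moreover have "fps_value (fps_const (- c) * S) (t - 1) (- c * eval_fps S (t - 1))"
      using t by (intro fps_value_intros fps_value_eval less_trans[OF _ bS]) simp
    ultimately show ?thesis by (simp add: fps_value_def)
  qed
  have bS': "ereal (1 - b) < fps_conv_radius (fps_const (- c) * S)"
    by (rule less_le_trans[OF bS]) (intro fps_conv_radius_mult_ge, auto)
  have bdd: "\<exists>R C b. 0 \<le> b \<and> b < 1 \<and>
      (\<forall>t. b < t \<longrightarrow> t < 1 \<longrightarrow> (\<lambda>m. real m ^ i * r m * t ^ m) sums R t \<and> \<bar>R t\<bar> \<le> (C::real))" for i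
    using bounded_eval_fps_euler[OF RS Rrad bS' less_imp_le[OF b(1)] b(2), of i] by (simp add: R_def)
  \<comment> \<open>The two relations at 1 involve only the first two Taylor coefficients of \<open>V\<close>, and these
    depend on \<open>f\<close> only through \<open>\<phi>\<close>; so both \<open>c\<close> and \<open>\<phi>\<close> are determined.\<close>
  have G0: "fps_nth (?\<theta> F) 0 = - 1" and G1: "fps_nth (?\<theta> F) 1 = 2 * \<phi> - 1"
    and GG0: "fps_nth (?\<theta> (?\<theta> F)) 0 = 2 * \<phi> - 1"
    using F1 by (simp_all add: fps_euler_1_nth \<phi>_def numeral_2_eq_2)
  have H0: "fps_nth H 0 = 2"
    by (simp add: H_def G0 F0 power2_eq_square)
  have H1: "fps_nth (?\<theta> H) 0 = 4 * (1 - 2 * \<phi>)"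
  proof -
    have "fps_nth (?\<theta> H) 0 = fps_nth H 1" by (simp add: fps_euler_1_nth)
    also have "fps_nth H 1 = - 2 * ((2 * \<phi> - 1) + (- 1) * (- 2 * (2 * \<phi> - 1) + (2 * \<phi> - 1)))"
      unfolding H_def fps_mult_nth_1 power2_eq_square fps_sub_nth fps_mult_nth_0 F0 F1 G0 G1 GG0 by simp
    finally show ?thesis by (simp add: algebra_simps)
  qed
  have rr: "r m = (2 * real m + 1) / enn2real (J m) - (p2 * real m ^ 2 + p1 * real m + p0)"
    and Jne: "enn2real (J m) \<noteq> 0" if "m \<ge> M" for m
    using Jfin[OF that] Jpos[OF that] by (simp_all add: r_def a_def)
  have H0ne: "fps_nth H 0 \<noteq> 0" by (simp add: H0)
  note mrp = moment_reciprocal_polynomial[where M = M, OF b(1,2) bH H0ne JD DK rr Jne bdd]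
  have c2: "c = 2" using mrp(1) H0 by (simp add: p2_def)
  have \<phi>4: "\<phi> = 1 / 4" using mrp(2) by (simp add: H0 H1 p1_def p2_def c2)
  have p2: "p2 = 1" and p1: "p1 = 3 / 2" by (simp_all add: p2_def p1_def c2 \<phi>4)
  have H1: "fps_nth (?\<theta> H) 0 = 2" by (simp add: H1 \<phi>4)
  note L = mrp(3)[unfolded p2 p1]
  \<comment> \<open>To continue the Euler equation to 0, \<open>V\<close> is expressed by \<open>A\<close> and its Euler
    derivatives \<open>y\<close>, \<open>y1\<close>, \<open>y2\<close>, since \<open>A\<close>, unlike \<open>f\<close>, is a power series at 0.\<close>
  let ?E = "fps_euler 0"
  define y where "y = eval_fps A"
  define y1 where "y1 = eval_fps (?E A)"
  define y2 where "y2 = eval_fps (?E (?E A))"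
  have rad0: "ereal \<bar>t - 0\<bar> < fps_conv_radius G" if "0 < t" "t < 1" "1 \<le> fps_conv_radius G" for G :: "real fps" and t
    using that by (intro less_le_trans[OF _ that(3)]) auto
  have A1rad: "1 \<le> fps_conv_radius (?E A)" "1 \<le> fps_conv_radius (?E (?E A))"
    by (intro fps_radius_intros Arad)+
  have yf: "y t * f t ^ 3 = c" and y0: "0 < y t" if "0 < t" "t < 1" for t
    using evA[OF that] fpos[OF that] c by (auto simp: y_def)
  have dy: "(y has_real_derivative y1 t / t) (at t)" and dy1: "(y1 has_real_derivative y2 t / t) (at t)"
    if "0 < t" "t < 1" for t
    using has_real_derivative_eval_fps_euler[OF rad0[OF that Arad]] that
      has_real_derivative_eval_fps_euler[OF rad0[OF that A1rad(1)]]
    by (auto simp: y_def y1_def y2_def)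
  have fy1: "f t * y1 t = - 3 * y t * f1 t" if t: "0 < t" "t < 1" for t
  proof -
    have "((\<lambda>t. y t * f t ^ 3) has_real_derivative y t * (3 * f t ^ 2 * (f1 t / t)) + y1 t / t * f t ^ 3) (at t)"
      by (auto intro!: derivative_eq_intros dy d0 t)
    moreover have "((\<lambda>t. y t * f t ^ 3) has_real_derivative 0) (at t)"
      using t yf by (intro has_field_derivative_transform_within_open[OF DERIV_const, of "{0<..<1}"]) auto
    ultimately have "y t * (3 * f t ^ 2 * (f1 t / t)) + y1 t / t * f t ^ 3 = 0" by (rule DERIV_unique)
    then have "f t ^ 2 * (f t * y1 t + 3 * y t * f1 t) = 0"
      using t by (simp add: field_simps power2_eq_square power3_eq_cube)
    then show ?thesis using fpos[OF t] by simp
  qed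
  have fy2: "f t * y2 t = - 4 * y1 t * f1 t - 3 * y t * f2 t" if t: "0 < t" "t < 1" for t
  proof -
    have "((\<lambda>t. f t * y1 t) has_real_derivative f t * (y2 t / t) + f1 t / t * y1 t) (at t)"
      by (auto intro!: derivative_eq_intros dy1 d0 t)
    moreover have "((\<lambda>t. f t * y1 t) has_real_derivative - 3 * (y t * (f2 t / t) + y1 t / t * f1 t)) (at t)"
    proof -
      have "((\<lambda>t. - 3 * y t * f1 t) has_real_derivative - 3 * (y t * (f2 t / t) + y1 t / t * f1 t)) (at t)"
        by (auto intro!: derivative_eq_intros dy d1 t simp: algebra_simps)
      then show ?thesis
        using t fy1 by (elim has_field_derivative_transform_within_open[of _ _ _ "{0<..<1}"]) auto
    qed
    ultimately have "f t * (y2 t / t) + f1 t / t * y1 t = - 3 * (y t * (f2 t / t) + y1 t / t * f1 t)"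
      by (rule DERIV_unique)
    then show ?thesis using t by (simp add: field_simps)
  qed
  define N where "N = ?E A * (A * ?E (?E A) - (?E A) ^ 2)"
  have Nrad: "1 \<le> fps_conv_radius N"
    unfolding N_def by (intro fps_radius_intros Arad)
  have vA: "fps_value A t (y t)" "fps_value (?E A) t (y1 t)" "fps_value (?E (?E A)) t (y2 t)"
    if "0 < t" "t < 1" for t
    using rad0[OF that Arad] rad0[OF that A1rad(1)] rad0[OF that A1rad(2)]
    by (simp_all add: fps_value_def y_def y1_def y2_def)
  define n where "n t = y1 t * (y t * y2 t - y1 t ^ 2)" for t
  have vN: "fps_value N t (n t)" if "0 < t" "t < 1" for t
    unfolding N_def n_def by (intro fps_value_intros vA that)
  have Vn: "9 * V t * y t ^ 4 = 4 * n t" if t: "0 < t" "t < 1" for t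
  proof -
    have f0: "f t \<noteq> 0" using fpos[OF t] by simp
    have e1: "y1 t = - 3 * y t * f1 t / f t" using fy1[OF t] f0 by (simp add: field_simps)
    have e2: "y2 t = (- 4 * y1 t * f1 t - 3 * y t * f2 t) / f t" using fy2[OF t] f0 by (simp add: field_simps)
    have fn: "f t ^ 3 * n t = - 9 * y t ^ 3 * f1 t * (f1 t ^ 2 - f t * f2 t)"
      unfolding n_def e2 e1 using f0 by (simp add: field_simps power2_eq_square power3_eq_cube)
    have "y t * (f t ^ 3 * n t) = 9 / 2 * y t ^ 4 * V t"
      unfolding V[OF t] fn by (simp add: algebra_simps power_numeral_reduce)
    then show ?thesis using yf[OF t] c2 by (simp add: mult.assoc[symmetric])
  qed
  have N0: "N \<noteq> 0"
  proof
    assume "N = 0"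
    then have "n (1/2) = 0" using vN[of "1/2"] by (simp add: fps_value_def)
    then show False using Vn[of "1/2"] Vpos[of "1/2"] y0[of "1/2"] by simp
  qed
  define M1 where "M1 = A * ?E N - 4 * N * ?E A"
  define M2 where "M2 = A * ?E M1 - 5 * M1 * ?E A"
  have M1rad: "1 \<le> fps_conv_radius M1" and M2rad: "1 \<le> fps_conv_radius M2"
    unfolding M1_def M2_def by ((intro fps_radius_intros Arad Nrad; simp)+)
  have ode: "M2 - fps_const (3 / 2) * A * M1 + fps_const p0 * A ^ 2 * N = 0"
  proof (rule fps_eq_0_if_vanishes_on_interval[OF _ less_imp_le[OF b(1)] b(2)])
    show "1 \<le> fps_conv_radius (M2 - fps_const (3 / 2) * A * M1 + fps_const p0 * A ^ 2 * N)"
      by (intro fps_radius_intros Arad Nrad M1rad M2rad) auto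
    define v where "v t = eval_fps H (t - 1)" for t
    define v1 where "v1 t = eval_fps (?\<theta> H) (t - 1)" for t
    define v2 where "v2 t = eval_fps (?\<theta> (?\<theta> H)) (t - 1)" for t
    have radH: "ereal \<bar>t - 1\<bar> < fps_conv_radius H" "ereal \<bar>t - 1\<bar> < fps_conv_radius (?\<theta> H)"
       "ereal \<bar>t - 1\<bar> < fps_conv_radius (?\<theta> (?\<theta> H))" if "b < t" "t < 1" for t
    proof -
      have r: "ereal \<bar>t - 1\<bar> < fps_conv_radius H" using vH[OF that] by (simp add: fps_value_def)
      show "ereal \<bar>t - 1\<bar> < fps_conv_radius H" by (fact r)
      show "ereal \<bar>t - 1\<bar> < fps_conv_radius (?\<theta> H)" "ereal \<bar>t - 1\<bar> < fps_conv_radius (?\<theta> (?\<theta> H))"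
        by (rule less_le_trans[OF r], intro fps_radius_intros order_refl)+
    qed
    have dv: "(v has_real_derivative v1 t / t) (at t)" and dv1: "(v1 has_real_derivative v2 t / t) (at t)"
      if "b < t" "t < 1" for t
      using has_real_derivative_eval_fps_euler[OF radH(1)[OF that]] that b
        has_real_derivative_eval_fps_euler[OF radH(2)[OF that]]
      by (auto simp: v_def[abs_def] v1_def[abs_def] v2_def)
    have vLv: "v2 t - 3 / 2 * v1 t + p0 * v t = 0" if "b < t" "t < 1" for t
    proof -
      have "fps_value (fps_const 1 * ?\<theta> (?\<theta> H) - fps_const (3 / 2) * ?\<theta> H + fps_const p0 * H) (t - 1)
          (1 * v2 t - 3 / 2 * v1 t + p0 * v t)"
        unfolding v_def v1_def v2_def
        by (intro fps_value_intros fps_value_eval radH that)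
      moreover have "fps_const 1 * ?\<theta> (?\<theta> H) - fps_const (3 / 2) * ?\<theta> H + fps_const p0 * H = 0"
        using L by simp
      ultimately show ?thesis by (simp only: fps_value_def eval_fps_0) simp
    qed
    have vn: "9 * v t * y t ^ 4 = 4 * n t" if "b < t" "t < 1" for t
      using vH[OF that] Vn[of t] that b by (simp add: fps_value_def v_def)
    have vM1: "fps_value M1 t (9 / 4 * v1 t * y t ^ 5)" if t: "b < t" "t < 1" for t
    proof -
      have t0: "0 < t" using t b by simp
      have "fps_value (?E N) (t - 0) (9 / 4 * (v t * (4 * y t ^ 3 * y1 t) + v1 t * y t ^ 4))"
      proof (rule eval_euler_eqI[of "{b<..<1}"])
        show "eval_fps N (s - 0) = 9 / 4 * (v s * y s ^ 4)" if "s \<in> {b<..<1}" for s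
          using vN[of s] vn[of s] that b by (simp add: fps_value_def)
        show "((\<lambda>s. 9 / 4 * (v s * y s ^ 4)) has_real_derivative
           (9 / 4 * (v t * (4 * y t ^ 3 * y1 t) + v1 t * y t ^ 4)) / t) (at t)"
          using t t0 by (auto intro!: derivative_eq_intros dy dv simp: field_simps)
      qed (use t t0 Nrad rad0 in auto)
      then have "fps_value M1 t (y t * (9 / 4 * (v t * (4 * y t ^ 3 * y1 t) + v1 t * y t ^ 4)) - 4 * n t * y1 t)"
        unfolding M1_def using t t0 by (intro fps_value_intros vA vN) auto
      also have "y t * (9 / 4 * (v t * (4 * y t ^ 3 * y1 t) + v1 t * y t ^ 4)) - 4 * n t * y1 t = 9 / 4 * v1 t * y t ^ 5"
        unfolding vn[OF t, symmetric] by (simp add: algebra_simps power_numeral_reduce)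
      finally show ?thesis .
    qed
    have vM2: "fps_value M2 t (9 / 4 * v2 t * y t ^ 6)" if t: "b < t" "t < 1" for t
    proof -
      have t0: "0 < t" using t b by simp
      have "fps_value (?E M1) (t - 0) (9 / 4 * (v1 t * (5 * y t ^ 4 * y1 t) + v2 t * y t ^ 5))"
      proof (rule eval_euler_eqI[of "{b<..<1}"])
        show "eval_fps M1 (s - 0) = 9 / 4 * (v1 s * y s ^ 5)" if "s \<in> {b<..<1}" for s
          using vM1[of s] that b by (simp add: fps_value_def)
        show "((\<lambda>s. 9 / 4 * (v1 s * y s ^ 5)) has_real_derivative
           (9 / 4 * (v1 t * (5 * y t ^ 4 * y1 t) + v2 t * y t ^ 5)) / t) (at t)"
          using t t0 by (auto intro!: derivative_eq_intros dy dv1 simp: field_simps)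
      qed (use t t0 M1rad rad0 in auto)
      then have "fps_value M2 t (y t * (9 / 4 * (v1 t * (5 * y t ^ 4 * y1 t) + v2 t * y t ^ 5)) - 5 * (9 / 4 * v1 t * y t ^ 5) * y1 t)"
        unfolding M2_def using t t0 by (intro fps_value_intros vA vM1) auto
      also have "y t * (9 / 4 * (v1 t * (5 * y t ^ 4 * y1 t) + v2 t * y t ^ 5)) - 5 * (9 / 4 * v1 t * y t ^ 5) * y1 t
         = 9 / 4 * v2 t * y t ^ 6"
        by (simp add: algebra_simps power_numeral_reduce)
      finally show ?thesis .
    qed
    fix t assume t: "b < t" "t < 1"
    then have t0: "0 < t" using b by simp
    have "fps_value (M2 - fps_const (3 / 2) * A * M1 + fps_const p0 * A ^ 2 * N) t
      (9 / 4 * v2 t * y t ^ 6 - 3 / 2 * y t * (9 / 4 * v1 t * y t ^ 5) + p0 * y t ^ 2 * n t)"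
      by (intro fps_value_intros vM1 vM2 vA vN t t0)
    also have "n t = 9 / 4 * v t * y t ^ 4" using vn[OF t] by simp
    also have "9 / 4 * v2 t * y t ^ 6 - 3 / 2 * y t * (9 / 4 * v1 t * y t ^ 5) + p0 * y t ^ 2 * (9 / 4 * v t * y t ^ 4)
       = 9 / 4 * y t ^ 6 * (v2 t - 3 / 2 * v1 t + p0 * v t)"
      by (simp add: field_simps power_numeral_reduce)
    finally show "eval_fps (M2 - fps_const (3 / 2) * A * M1 + fps_const p0 * A ^ 2 * N) t = 0"
      unfolding vLv[OF t] by (simp add: fps_value_def)
  qed
  have A0: "A \<noteq> 0" using y0[of "1/2"] by (auto simp: y_def)
  obtain c' k where mono: "fps_X ^ nat (- k) * N = fps_const c' * fps_X ^ nat k * A ^ 4"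
    using quotient_is_monomial[OF A0 N0 ode[unfolded M2_def M1_def]] .
  define C where "C = 4 / 9 * c'"
  have Vk: "V t = C * t powi k" if t: "0 < t" "t < 1" for t
  proof -
    have "fps_value (fps_X ^ nat (- k) * N) t (t ^ nat (- k) * n t)"
      by (intro fps_value_intros vN t)
    moreover have "fps_value (fps_const c' * fps_X ^ nat k * A ^ 4) t (c' * t ^ nat k * y t ^ 4)"
      by (intro fps_value_intros vA t)
    ultimately have "t ^ nat (- k) * n t = c' * t ^ nat k * y t ^ 4"
      unfolding mono by (simp add: fps_value_def)
    moreover have "n t = 9 / 4 * (V t * y t ^ 4)" using Vn[OF t] by simp
    ultimately have "t ^ nat (- k) * (9 / 4 * (V t * y t ^ 4)) = c' * t ^ nat k * y t ^ 4" by metis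
    then have "(t ^ nat (- k) * V t) * y t ^ 4 = (C * t ^ nat k) * y t ^ 4"
      unfolding C_def by linarith
    then have "t ^ nat (- k) * V t = C * t ^ nat k" using y0[OF t] by simp
    then show ?thesis using t by (cases "0 \<le> k") (auto simp: power_int_def field_simps)
  qed
  \<comment> \<open>The monomial \<open>V = C t\<^sup>k\<close> satisfies \<open>\<theta>V = k V\<close>, while \<open>\<theta>V(1) = V(1) = 2\<close>.\<close>
  have k1: "k = 1"
  proof -
    have ev: "eval_fps (?\<theta> H) (t - 1) = of_int k * eval_fps H (t - 1)" if t: "b < t" "t < 1" for t
    proof -
      have t0: "0 < t" using t b by simp
      have "fps_value (?\<theta> H) (t - 1) (of_int k * (C * t powi k))"
      proof (rule eval_euler_eqI[of "{b<..<1}"])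
        show "eval_fps H (s - 1) = C * s powi k" if "s \<in> {b<..<1}" for s
          using vH[of s] Vk[of s] that b by (simp add: fps_value_def)
        have "t powi (k - 1) = t powi k / t"
          using t0 by (simp add: power_int_diff)
        then show "((\<lambda>s. C * s powi k) has_real_derivative of_int k * (C * t powi k) / t) (at t)"
          using t0 by (auto intro!: derivative_eq_intros)
        show "ereal \<bar>t - 1\<bar> < fps_conv_radius H" using vH[OF t] by (simp add: fps_value_def)
      qed (use t t0 in auto)
      then show ?thesis using vH[OF t] Vk[OF t0 t(2)] by (simp add: fps_value_def)
    qed
    have cont: "((\<lambda>t. eval_fps G (t - 1)) \<longlongrightarrow> fps_nth G 0) (at_left 1)" if G: "ereal (1 - b) < fps_conv_radius G" for G :: "real fps"
    proof -
      have "isCont (eval_fps G) 0"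
        using b by (intro continuous_eval_fps order.strict_trans1[OF _ G]) simp
      moreover have "((\<lambda>t. t - 1) \<longlongrightarrow> 0) (at_left (1::real))"
        by (rule tendsto_eq_intros refl | simp)+
      ultimately have "((\<lambda>t. eval_fps G (t - 1)) \<longlongrightarrow> eval_fps G 0) (at_left 1)"
        by (rule isCont_tendsto_compose)
      then show ?thesis by (simp add: eval_fps_at_0)
    qed
    have bH1: "ereal (1 - b) < fps_conv_radius (?\<theta> H)"
      by (rule less_le_trans[OF bH]) (intro fps_radius_intros order_refl)
    have "((\<lambda>t. of_int k * eval_fps H (t - 1)) \<longlongrightarrow> of_int k * fps_nth H 0) (at_left 1)"
      by (intro tendsto_intros cont bH)
    moreover have "((\<lambda>t. of_int k * eval_fps H (t - 1)) \<longlongrightarrow> fps_nth (?\<theta> H) 0) (at_left 1)"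
    proof (rule Lim_transform_eventually[OF cont[OF bH1]])
      show "\<forall>\<^sub>F t in at_left 1. eval_fps (?\<theta> H) (t - 1) = of_int k * eval_fps H (t - 1)"
        unfolding eventually_at_left_field using b ev by blast
    qed
    ultimately have "of_int k * fps_nth H 0 = fps_nth (?\<theta> H) 0"
      by (rule tendsto_unique[rotated 1]) simp
    then show ?thesis by (simp add: H0 H1)
  qed
  have J0: "J 0 \<noteq> \<infinity>"
  proof -
    have "J 0 = (\<integral>\<^sup>+t. ennreal C * indicator {0<..<1::real} t \<partial>lborel)"
      unfolding J by (intro nn_integral_cong) (auto simp: Vk k1 split: split_indicator)
    also have "\<dots> = ennreal C" by (subst nn_integral_cmult_indicator) auto
    finally show ?thesis by simp
  qed
  have a0: "a 0 \<noteq> 0"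
  proof -
    have "\<exists>D K. \<forall>m\<ge>0. 0 < enn2real (J m)"
      using radial_moments_split[OF J b(1,2) bH Vpos Vcont evH J0] by blast
    then show ?thesis using J0 by (auto simp: a_def less_imp_neq[symmetric])
  qed
  have "N = fps_const c' * fps_X * A ^ 4" using mono by (simp add: k1)
  then have "fps_nth N 1 = c' * a 0 ^ 4"
    by (simp add: fps_mult_nth_1 fps_nth_power_0 A_def)
  moreover have "fps_nth N 1 = 0"
    unfolding N_def by (simp add: fps_mult_nth_1 power2_eq_square)
  ultimately have "c' = 0" using a0 by simp
  then show False using Vk[of "1/2"] Vpos[of "1/2"] by (simp add: C_def)
qed

section \<open>Lebesgue measure in the plane: rotations and the squared modulus\<close>

lemma lborel_complex: "(lborel :: complex measure) = distr (lborel \<Otimes>\<^sub>M lborel) borel (\<lambda>(x, y). Complex x y)"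
proof (rule lborel_eqI)
  have [measurable]: "(\<lambda>(x, y). Complex x y) \<in> borel_measurable (borel \<Otimes>\<^sub>M borel)"
    unfolding borel_prod
    by (intro borel_measurable_continuous_onI) (auto simp: case_prod_unfold Complex_eq intro!: continuous_intros)
  have [measurable]: "(\<lambda>(x, y). Complex x y) \<in> borel_measurable (lborel \<Otimes>\<^sub>M lborel)"
    by simp
  fix l u :: complex
  assume lu: "\<And>b. b \<in> Basis \<Longrightarrow> l \<bullet> b \<le> u \<bullet> b"
  have le: "Re l \<le> Re u" "Im l \<le> Im u"
    using lu[of 1] lu[of \<i>] by (auto simp: Basis_complex_def)
  have "(\<lambda>(x, y). Complex x y) -` box l u \<inter> space (lborel \<Otimes>\<^sub>M lborel) = {Re l<..<Re u} \<times> {Im l<..<Im u}"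
    by (auto simp: box_def Basis_complex_def space_pair_measure)
  then have "emeasure (distr (lborel \<Otimes>\<^sub>M lborel) borel (\<lambda>(x, y). Complex x y)) (box l u) =
      ennreal (Re u - Re l) * ennreal (Im u - Im l)"
    using le by (simp add: emeasure_distr lborel.emeasure_pair_measure_Times)
  then show "emeasure (distr (lborel \<Otimes>\<^sub>M lborel) borel (\<lambda>(x, y). Complex x y)) (box l u) = (\<Prod>b\<in>Basis. (u - l) \<bullet> b)"
    using le by (simp add: Basis_complex_def ennreal_mult)
qed simp

lemma borel_measurable_Complex [measurable (raw)]:
  assumes "f \<in> borel_measurable M" "g \<in> borel_measurable M"
  shows "(\<lambda>x. Complex (f x) (g x)) \<in> borel_measurable M"
  unfolding Complex_eq using assms by measurable

lemma nn_integral_complex: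
  assumes [measurable]: "g \<in> borel_measurable borel"
  shows "(\<integral>\<^sup>+z. g z \<partial>lborel) = (\<integral>\<^sup>+y. \<integral>\<^sup>+x. g (Complex x y) \<partial>lborel \<partial>lborel)"
    and "(\<integral>\<^sup>+z. g z \<partial>lborel) = (\<integral>\<^sup>+x. \<integral>\<^sup>+y. g (Complex x y) \<partial>lborel \<partial>lborel)"
proof -
  have "(\<integral>\<^sup>+z. g z \<partial>lborel) = (\<integral>\<^sup>+p. g (case p of (x, y) \<Rightarrow> Complex x y) \<partial>(lborel \<Otimes>\<^sub>M lborel))"
    by (subst lborel_complex, subst nn_integral_distr) auto
  then have *: "(\<integral>\<^sup>+z. g z \<partial>lborel) = (\<integral>\<^sup>+p. (\<lambda>(x, y). g (Complex x y)) p \<partial>(lborel \<Otimes>\<^sub>M lborel))"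
    by (simp add: case_prod_unfold)
  show "(\<integral>\<^sup>+z. g z \<partial>lborel) = (\<integral>\<^sup>+y. \<integral>\<^sup>+x. g (Complex x y) \<partial>lborel \<partial>lborel)"
    unfolding * by (subst lborel_pair.nn_integral_snd[symmetric]) auto
  show "(\<integral>\<^sup>+z. g z \<partial>lborel) = (\<integral>\<^sup>+x. \<integral>\<^sup>+y. g (Complex x y) \<partial>lborel \<partial>lborel)"
    unfolding * by (subst lborel.nn_integral_fst[symmetric]) auto
qed

lemma nn_integral_complex_shear:
  assumes [measurable]: "g \<in> borel_measurable borel"
  shows "(\<integral>\<^sup>+z. g (Complex (Re z + s * Im z) (Im z)) \<partial>lborel) = (\<integral>\<^sup>+z. g z \<partial>lborel)"
    and "(\<integral>\<^sup>+z. g (Complex (Re z) (Im z + s * Re z)) \<partial>lborel) = (\<integral>\<^sup>+z. g z \<partial>lborel)"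
proof -
  have shift: "(\<integral>\<^sup>+x. k (x + c) \<partial>lborel) = (\<integral>\<^sup>+x. k x \<partial>lborel)" if [measurable]: "k \<in> borel_measurable borel"
    for k :: "real \<Rightarrow> ennreal" and c
    using nn_integral_real_affine[of k 1 c] by (simp add: add.commute)
  have "(\<integral>\<^sup>+z. g (Complex (Re z + s * Im z) (Im z)) \<partial>lborel) =
      (\<integral>\<^sup>+y. \<integral>\<^sup>+x. g (Complex (x + s * y) y) \<partial>lborel \<partial>lborel)"
    by (subst nn_integral_complex(1)) auto
  also have "\<dots> = (\<integral>\<^sup>+z. g z \<partial>lborel)"
    by (subst shift[where k = "\<lambda>x. g (Complex x _)"]) (auto simp: nn_integral_complex(1))
  finally show "(\<integral>\<^sup>+z. g (Complex (Re z + s * Im z) (Im z)) \<partial>lborel) = (\<integral>\<^sup>+z. g z \<partial>lborel)" .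
  have "(\<integral>\<^sup>+z. g (Complex (Re z) (Im z + s * Re z)) \<partial>lborel) =
      (\<integral>\<^sup>+x. \<integral>\<^sup>+y. g (Complex x (y + s * x)) \<partial>lborel \<partial>lborel)"
    by (subst nn_integral_complex(2)) auto
  also have "\<dots> = (\<integral>\<^sup>+z. g z \<partial>lborel)"
    by (subst shift[where k = "\<lambda>y. g (Complex _ y)"]) (auto simp: nn_integral_complex(2))
  finally show "(\<integral>\<^sup>+z. g (Complex (Re z) (Im z + s * Re z)) \<partial>lborel) = (\<integral>\<^sup>+z. g z \<partial>lborel)" .
qed

text \<open>A rotation by an angle that is not a multiple of \<open>\<pi>\<close> is a product of three shears
  \<open>(x, y) \<mapsto> (x + p y, y)\<close>, \<open>(x, y) \<mapsto> (x, y + q x)\<close>, \<open>(x, y) \<mapsto> (x + p y, y)\<close>, and shears preserve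
  Lebesgue measure by Tonelli and translation invariance.\<close>

lemma nn_integral_complex_rotate:
  assumes [measurable]: "g \<in> borel_measurable borel" and c: "cmod c = 1"
  shows "(\<integral>\<^sup>+z. g (c * z) \<partial>lborel) = (\<integral>\<^sup>+z. g z \<partial>lborel)"
proof -
  have gen: "(\<integral>\<^sup>+z. k (d * z) \<partial>lborel) = (\<integral>\<^sup>+z. k z \<partial>lborel)"
    if [measurable]: "k \<in> borel_measurable borel" and d: "cmod d = 1" "Im d \<noteq> 0" for k :: "complex \<Rightarrow> ennreal" and d
  proof -
    define p where "p = (Re d - 1) / Im d"
    define q where "q = Im d"
    have q0: "q \<noteq> 0" using d by (simp add: q_def)
    have pq: "1 + p * q = Re d" using q0 by (simp add: p_def q_def)
    have sq: "Re d ^ 2 + Im d ^ 2 = 1" using d(1) by (simp add: cmod_def)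
    have pq2: "2 * p + p ^ 2 * q = - Im d"
    proof -
      have "q * (2 * p + p ^ 2 * q) = (p * q) * (p * q + 2)" by (simp add: algebra_simps power2_eq_square)
      also have "p * q = Re d - 1" using pq by simp
      also have "(Re d - 1) * (Re d - 1 + 2) = q * (- Im d)"
        using sq by (simp add: q_def algebra_simps power2_eq_square)
      finally show ?thesis using q0 mult_left_cancel by blast
    qed
    define X where "X z = Complex (Re z + p * Im z) (Im z)" for z
    define Y where "Y z = Complex (Re z) (Im z + q * Re z)" for z
    have [measurable]: "X \<in> borel_measurable borel" "Y \<in> borel_measurable borel"
      unfolding X_def[abs_def] Y_def[abs_def] by measurable
    have "d * z = X (Y (X z))" for z
    proof (rule complex_eqI)
      have "Re (X (Y (X z))) = (1 + p * q) * Re z + (2 * p + p ^ 2 * q) * Im z"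
        by (simp add: X_def Y_def algebra_simps power2_eq_square)
      then show "Re (d * z) = Re (X (Y (X z)))" unfolding pq pq2 by simp
      have "Im (X (Y (X z))) = q * Re z + (1 + p * q) * Im z"
        by (simp add: X_def Y_def algebra_simps)
      then show "Im (d * z) = Im (X (Y (X z)))" unfolding pq by (simp add: q_def)
    qed
    then have "(\<integral>\<^sup>+z. k (d * z) \<partial>lborel) = (\<integral>\<^sup>+z. k (X (Y (X z))) \<partial>lborel)" by simp
    also have "\<dots> = (\<integral>\<^sup>+z. k (X (Y z)) \<partial>lborel)"
      using nn_integral_complex_shear(1)[of "\<lambda>z. k (X (Y z))" p] by (simp add: X_def[symmetric])
    also have "\<dots> = (\<integral>\<^sup>+z. k (X z) \<partial>lborel)"
      using nn_integral_complex_shear(2)[of "\<lambda>z. k (X z)" q] by (simp add: Y_def[symmetric])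
    also have "\<dots> = (\<integral>\<^sup>+z. k z \<partial>lborel)"
      using nn_integral_complex_shear(1)[of k p] by (simp add: X_def[symmetric])
    finally show ?thesis .
  qed
  show ?thesis
  proof (cases "Im c = 0")
    case False then show ?thesis using gen[OF _ c] by simp
  next
    case True
    \<comment> \<open>Here \<open>c\<close> is 1 or -1, where the shears degenerate; it is a product of two quarter turns.\<close>
    have "Im (c * - \<i>) \<noteq> 0" using True c by (auto simp: cmod_def)
    moreover have "cmod (c * - \<i>) = 1" using c by (simp add: norm_mult)
    ultimately have "(\<integral>\<^sup>+z. g ((c * - \<i>) * (\<i> * z)) \<partial>lborel) = (\<integral>\<^sup>+z. g z \<partial>lborel)"
      using gen[of "\<lambda>w. g ((c * - \<i>) * w)" \<i>] gen[of g "c * - \<i>"] by simp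
    then show ?thesis by (simp add: mult.assoc)
  qed
qed

lemma nn_integral_rotate_pair:
  fixes g :: "complex \<times> complex \<Rightarrow> ennreal"
  assumes [measurable]: "g \<in> borel_measurable borel" and c: "cmod c = 1" "cmod d = 1"
  shows "(\<integral>\<^sup>+p. g (c * fst p, d * snd p) \<partial>lborel) = (\<integral>\<^sup>+p. g p \<partial>lborel)"
proof -
  have [measurable]: "g \<in> borel_measurable (borel \<Otimes>\<^sub>M borel)" by (simp add: borel_prod)
  have "(\<integral>\<^sup>+p. g (c * fst p, d * snd p) \<partial>lborel) = (\<integral>\<^sup>+a. \<integral>\<^sup>+b. g (c * a, d * b) \<partial>lborel \<partial>lborel)"
    unfolding lborel_prod[symmetric] by (subst lborel.nn_integral_fst[symmetric]) auto
  also have "\<dots> = (\<integral>\<^sup>+a. \<integral>\<^sup>+b. g (c * a, b) \<partial>lborel \<partial>lborel)"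
    by (subst nn_integral_complex_rotate[where g = "\<lambda>b. g (c * _, b)"]) (auto simp: c)
  also have "\<dots> = (\<integral>\<^sup>+a. \<integral>\<^sup>+b. g (a, b) \<partial>lborel \<partial>lborel)"
    by (subst nn_integral_complex_rotate[where g = "\<lambda>a. \<integral>\<^sup>+b. g (a, b) \<partial>lborel"]) (auto simp: c)
  also have "\<dots> = (\<integral>\<^sup>+p. g p \<partial>lborel)"
    unfolding lborel_prod[symmetric] by (subst lborel.nn_integral_fst[symmetric]) auto
  finally show ?thesis .
qed

lemma distr_rotate_pair:
  assumes c: "cmod c = 1" "cmod d = 1"
  shows "distr lborel borel (\<lambda>p. (c * fst p, d * snd p)) = (lborel :: (complex \<times> complex) measure)"
proof (rule measure_eqI)
  have m: "(\<lambda>p. (c * fst p, d * snd p)) \<in> borel \<rightarrow>\<^sub>M (borel :: (complex \<times> complex) measure)"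
    by (intro borel_measurable_continuous_onI continuous_intros)
  fix A :: "(complex \<times> complex) set" assume "A \<in> sets (distr lborel borel (\<lambda>p. (c * fst p, d * snd p)))"
  then have [measurable]: "A \<in> sets borel" by simp
  have "emeasure (distr lborel borel (\<lambda>p. (c * fst p, d * snd p))) A =
     (\<integral>\<^sup>+p. indicator A (c * fst p, d * snd p) \<partial>lborel)"
    using m by (subst nn_integral_indicator[symmetric], simp, subst nn_integral_distr) auto
  also have "\<dots> = emeasure lborel A"
    using nn_integral_rotate_pair[OF _ c, of "indicator A"] by simp
  finally show "emeasure (distr lborel borel (\<lambda>p. (c * fst p, d * snd p))) A = emeasure lborel A" .
qed simp

text \<open>The disc of squared radius \<open>s\<close> has area \<open>\<pi> s\<close>.\<close>

lemma distr_norm_square_complex: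
  "distr lborel borel (\<lambda>z :: complex. (cmod z)\<^sup>2) = density lborel (\<lambda>s. ennreal pi * indicator {0<..} s)"
  (is "?L = ?R")
proof (rule measure_eqI_generator_eq[where E = "range lessThan" and A = "\<lambda>n. {..<real n}" and \<Omega> = UNIV])
  show "Int_stable (range lessThan :: real set set)"
  proof (rule Int_stableI, clarify)
    fix x y :: real
    have "{..<x} \<inter> {..<y} = {..<min x y}" by auto
    then show "{..<x} \<inter> {..<y} \<in> range lessThan" by blast
  qed
  have L: "emeasure ?L {..<x} = ennreal (pi * max 0 x)" for x :: real
  proof -
    have "(\<lambda>z :: complex. (cmod z)\<^sup>2) -` {..<x} = ball 0 (sqrt (max 0 x))"
    proof -
      have "(cmod z)\<^sup>2 < x \<longleftrightarrow> cmod z < sqrt (max 0 x)" for z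
      proof -
        have "cmod z < sqrt (max 0 x) \<longleftrightarrow> sqrt ((cmod z)\<^sup>2) < sqrt (max 0 x)" by simp
        also have "\<dots> \<longleftrightarrow> (cmod z)\<^sup>2 < max 0 x" by (rule real_sqrt_less_iff)
        also have "\<dots> \<longleftrightarrow> (cmod z)\<^sup>2 < x"
          by (smt (verit) zero_le_power2)
        finally show ?thesis by simp
      qed
      then show ?thesis by auto
    qed
    then show ?thesis
      by (subst emeasure_distr) (auto simp: emeasure_ball unit_ball_vol_2)
  qed
  have R: "emeasure ?R {..<x} = ennreal (pi * max 0 x)" for x :: real
  proof -
    have "emeasure ?R {..<x} = (\<integral>\<^sup>+s. ennreal pi * indicator {0<..<x} s \<partial>lborel)"
      by (subst emeasure_density) (auto intro!: nn_integral_cong split: split_indicator)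
    also have "\<dots> = ennreal pi * emeasure lborel {0<..<x}" by (subst nn_integral_cmult_indicator) auto
    also have "\<dots> = ennreal (pi * max 0 x)"
      by (cases "0 \<le> x") (auto simp: ennreal_mult)
    finally show ?thesis .
  qed
  show "\<And>X. X \<in> range lessThan \<Longrightarrow> emeasure ?L X = emeasure ?R X" by (auto simp: L R)
  show "sets ?L = sigma_sets UNIV (range lessThan)" "sets ?R = sigma_sets UNIV (range lessThan)"
    by (simp_all add: borel_Iio)
  show "(\<Union>n. {..<real n}) = UNIV" using reals_Archimedean2 by auto
  show "\<And>n. emeasure ?L {..<real n} \<noteq> \<infinity>" by (simp add: L)
qed auto

section \<open>Averages over rotations\<close>

abbreviation unit_lebesgue :: "real measure" where
  "unit_lebesgue \<equiv> restrict_space lborel {0..1}"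

definition turn :: "real \<Rightarrow> complex" where
  "turn x = cis (2 * pi * x)"

lemma norm_turn [simp]: "cmod (turn x) = 1"
  by (simp add: turn_def)

lemma continuous_on_turn [continuous_intros]: "continuous_on A f \<Longrightarrow> continuous_on A (\<lambda>x. turn (f x))"
  unfolding turn_def by (intro continuous_intros)

lemma borel_measurable_turn [measurable]: "turn \<in> borel_measurable borel"
  by (intro borel_measurable_continuous_onI continuous_intros)

lemma emeasure_unit_lebesgue: "emeasure unit_lebesgue (space unit_lebesgue) = 1"
  by (simp add: space_restrict_space emeasure_restrict_space)

lemma sigma_finite_unit_lebesgue: "sigma_finite_measure unit_lebesgue"
  by (rule sigma_finite_measure_restrict_space[OF sigma_finite_lborel]) simp

lemma nn_integral_const_unit_lebesgue: "(\<integral>\<^sup>+x. c \<partial>unit_lebesgue) = c"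
  by (simp add: nn_integral_const emeasure_unit_lebesgue[unfolded space_restrict_space] space_restrict_space
      emeasure_restrict_space)

lemma integrable_unit_lebesgue:
  fixes g :: "real \<Rightarrow> 'a::{banach, second_countable_topology}"
  shows "continuous_on {0..1} g \<Longrightarrow> integrable unit_lebesgue g"
  using borel_integrable_compact[of "{0..1::real}" g] by (simp add: integrable_restrict_space)

lemma measure_unit_lebesgue [simp]: "Sigma_Algebra.measure unit_lebesgue {0..1} = 1"
  by (simp add: measure_restrict_space)

lemma integral_const_unit_lebesgue:
  "(\<integral>x. c \<partial>unit_lebesgue) = (c :: 'a::{banach, second_countable_topology})"
  by (simp add: space_restrict_space)

context
  fixes c d :: "real \<Rightarrow> complex"
  assumes cont [measurable]: "c \<in> borel_measurable borel" "d \<in> borel_measurable borel"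
    and norm1: "\<And>x. cmod (c x) = 1" "\<And>x. cmod (d x) = 1"
begin

interpretation P: pair_sigma_finite unit_lebesgue "lborel :: (complex \<times> complex) measure"
  by (intro pair_sigma_finite.intro sigma_finite_unit_lebesgue sigma_finite_lborel)

lemma measurable_rotation [measurable]:
  "(\<lambda>q. (c (fst q) * fst (snd q), d (fst q) * snd (snd q))) \<in> unit_lebesgue \<Otimes>\<^sub>M lborel \<rightarrow>\<^sub>M (borel :: (complex \<times> complex) measure)"
proof -
  have [measurable]: "fst \<in> unit_lebesgue \<Otimes>\<^sub>M (lborel :: (complex \<times> complex) measure) \<rightarrow>\<^sub>M borel"
    by (rule measurable_compose[OF measurable_fst]) (simp add: measurable_restrict_space1 measurable_ident_sets)
  have [measurable]: "snd \<in> unit_lebesgue \<Otimes>\<^sub>M (lborel :: (complex \<times> complex) measure) \<rightarrow>\<^sub>M (borel \<Otimes>\<^sub>M borel)"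
    by (rule measurable_compose[OF measurable_snd]) (simp add: borel_prod measurable_ident_sets)
  show ?thesis unfolding borel_prod[symmetric] by measurable
qed

lemma nn_integral_average:
  assumes [measurable]: "G \<in> borel_measurable borel"
  shows "(\<integral>\<^sup>+p. (\<integral>\<^sup>+x. G (c x * fst p, d x * snd p) \<partial>unit_lebesgue) \<partial>lborel) = (\<integral>\<^sup>+p. G p \<partial>lborel)"
proof -
  have "(\<integral>\<^sup>+p. (\<integral>\<^sup>+x. G (c x * fst p, d x * snd p) \<partial>unit_lebesgue) \<partial>lborel) =
      (\<integral>\<^sup>+x. (\<integral>\<^sup>+p. G (c x * fst p, d x * snd p) \<partial>lborel) \<partial>unit_lebesgue)"
    using P.Fubini[of "\<lambda>q. G (c (fst q) * fst (snd q), d (fst q) * snd (snd q))"] by simp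
  also have "\<dots> = (\<integral>\<^sup>+x. (\<integral>\<^sup>+p. G p \<partial>lborel) \<partial>unit_lebesgue)"
    by (subst nn_integral_rotate_pair) (auto simp: norm1)
  also have "\<dots> = (\<integral>\<^sup>+p. G p \<partial>lborel)"
    by (rule nn_integral_const_unit_lebesgue)
  finally show ?thesis .
qed

lemma
  fixes G :: "complex \<times> complex \<Rightarrow> complex"
  assumes G: "integrable lborel G"
  shows integrable_average: "integrable lborel (\<lambda>p. \<integral>x. G (c x * fst p, d x * snd p) \<partial>unit_lebesgue)"
    and integral_average: "(\<integral>p. (\<integral>x. G (c x * fst p, d x * snd p) \<partial>unit_lebesgue) \<partial>lborel) = (\<integral>p. G p \<partial>lborel)"
proof -
  have [measurable]: "G \<in> borel_measurable borel" using G by simp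
  let ?G = "\<lambda>x p. G (c x * fst p, d x * snd p)"
  have m: "(\<lambda>p. (c x * fst p, d x * snd p)) \<in> lborel \<rightarrow>\<^sub>M borel" for x
    by (simp, intro borel_measurable_continuous_onI continuous_intros)
  have prod: "integrable (unit_lebesgue \<Otimes>\<^sub>M lborel) (case_prod ?G)"
  proof (rule integrableI_bounded)
    show "case_prod ?G \<in> borel_measurable (unit_lebesgue \<Otimes>\<^sub>M lborel)"
      unfolding case_prod_unfold by measurable
    have "(\<integral>\<^sup>+q. ennreal (norm (case_prod ?G q)) \<partial>(unit_lebesgue \<Otimes>\<^sub>M lborel)) =
       (\<integral>\<^sup>+p. (\<integral>\<^sup>+x. ennreal (norm (?G x p)) \<partial>unit_lebesgue) \<partial>lborel)"
      unfolding case_prod_unfold by (subst P.nn_integral_snd[symmetric]) auto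
    also have "\<dots> = (\<integral>\<^sup>+p. ennreal (norm (G p)) \<partial>lborel)"
      by (rule nn_integral_average[where G = "\<lambda>p. ennreal (norm (G p))"]) simp
    also have "\<dots> < \<infinity>" using G by (simp add: integrable_iff_bounded)
    finally show "(\<integral>\<^sup>+q. ennreal (norm (case_prod ?G q)) \<partial>(unit_lebesgue \<Otimes>\<^sub>M lborel)) < \<infinity>" .
  qed
  from P.integrable_snd[OF prod]
  show "integrable lborel (\<lambda>p. \<integral>x. ?G x p \<partial>unit_lebesgue)" by simp
  from P.Fubini_integral[OF prod]
  have "(\<integral>p. (\<integral>x. ?G x p \<partial>unit_lebesgue) \<partial>lborel) = (\<integral>x. (\<integral>p. ?G x p \<partial>lborel) \<partial>unit_lebesgue)" by simp
  also have "(\<integral>p. ?G x p \<partial>lborel) = (\<integral>p. G p \<partial>lborel)" for x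
  proof -
    have "(\<integral>p. G p \<partial>lborel) = (\<integral>p. G p \<partial>distr lborel borel (\<lambda>p. (c x * fst p, d x * snd p)))"
      by (simp only: distr_rotate_pair[OF norm1(1)[of x] norm1(2)[of x]])
    also have "\<dots> = (\<integral>p. ?G x p \<partial>lborel)"
      by (rule integral_distr[OF m]) simp
    finally show ?thesis by simp
  qed
  then have "(\<integral>x. (\<integral>p. ?G x p \<partial>lborel) \<partial>unit_lebesgue) = (\<integral>p. G p \<partial>lborel)"
    by (simp only: integral_const_unit_lebesgue)
  finally show "(\<integral>p. (\<integral>x. ?G x p \<partial>unit_lebesgue) \<partial>lborel) = (\<integral>p. G p \<partial>lborel)" .
qed

end

text \<open>The variance of \<open>g\<close> is nonnegative. The right-hand side is an extended real, so that it
  can be integrated again without an integrability condition.\<close>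

lemma norm_average_square_le:
  fixes g :: "real \<Rightarrow> complex"
  assumes g: "continuous_on {0..1} g"
  shows "ennreal ((cmod (\<integral>x. g x \<partial>unit_lebesgue))\<^sup>2) \<le> (\<integral>\<^sup>+x. ennreal ((cmod (g x))\<^sup>2) \<partial>unit_lebesgue)"
proof -
  define m where "m = (\<integral>x. g x \<partial>unit_lebesgue)"
  have g2: "integrable unit_lebesgue (\<lambda>x. (cmod (g x))\<^sup>2)"
    by (intro integrable_unit_lebesgue continuous_intros g)
  have gi: "integrable unit_lebesgue g" by (rule integrable_unit_lebesgue[OF g])
  have "2 * (cmod m)\<^sup>2 - (cmod m)\<^sup>2 = (\<integral>x. 2 * Re (cnj m * g x) - (cmod m)\<^sup>2 \<partial>unit_lebesgue)"
  proof -
    have "(\<integral>x. 2 * Re (cnj m * g x) - (cmod m)\<^sup>2 \<partial>unit_lebesgue) =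
       2 * (\<integral>x. Re (cnj m * g x) \<partial>unit_lebesgue) - (\<integral>x. (cmod m)\<^sup>2 \<partial>unit_lebesgue)"
      by (subst Bochner_Integration.integral_diff)
         (intro integrable_unit_lebesgue continuous_intros g, intro integrable_unit_lebesgue continuous_intros,
          simp only: integral_mult_right_zero)
    also have "(\<integral>x. Re (cnj m * g x) \<partial>unit_lebesgue) = Re (\<integral>x. cnj m * g x \<partial>unit_lebesgue)"
      by (rule integral_Re) (intro integrable_unit_lebesgue continuous_intros g)
    also have "(\<integral>x. cnj m * g x \<partial>unit_lebesgue) = cnj m * m" by (simp add: m_def)
    also have "Re (cnj m * m) = (cmod m)\<^sup>2"
      by (simp add: cmod_power2 power2_eq_square[of "Re m"] power2_eq_square[of "Im m"])
    also have "(\<integral>x. (cmod m)\<^sup>2 \<partial>unit_lebesgue) = (cmod m)\<^sup>2" by (rule integral_const_unit_lebesgue)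
    finally show ?thesis by simp
  qed
  also have "\<dots> \<le> (\<integral>x. (cmod (g x))\<^sup>2 \<partial>unit_lebesgue)"
  proof (rule integral_mono[OF _ g2])
    show "integrable unit_lebesgue (\<lambda>x. 2 * Re (cnj m * g x) - (cmod m)\<^sup>2)"
      by (intro integrable_unit_lebesgue continuous_intros g)
    fix x
    have "0 \<le> (cmod (g x - m))\<^sup>2" by simp
    also have "\<dots> = (cmod (g x))\<^sup>2 - (2 * Re (cnj m * g x) - (cmod m)\<^sup>2)"
      unfolding cmod_power2 by (simp add: power2_eq_square algebra_simps)
    finally show "2 * Re (cnj m * g x) - (cmod m)\<^sup>2 \<le> (cmod (g x))\<^sup>2" by simp
  qed
  finally have "(cmod m)\<^sup>2 \<le> (\<integral>x. (cmod (g x))\<^sup>2 \<partial>unit_lebesgue)" by simp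
  then show ?thesis
    using nn_integral_eq_integral[OF g2] by (simp add: m_def ennreal_leI)
qed

lemma average_turn_power:
  "(\<integral>x. turn x ^ k * cnj (turn x) ^ n \<partial>unit_lebesgue) = (if k = n then 1 else 0)"
proof (cases "k = n")
  case True
  have "turn x * cnj (turn x) = 1" for x
    using complex_norm_square[of "turn x"] by simp
  then have "turn x ^ k * cnj (turn x) ^ n = 1" for x
    using True by (simp add: power_mult_distrib[symmetric])
  then show ?thesis using True integral_const_unit_lebesgue[of 1] by simp
next
  case False
  define j where "j = real k - real n"
  have j0: "j \<noteq> 0" and jint: "j \<in> \<int>" using False by (auto simp: j_def)
  have eq: "turn x ^ k * cnj (turn x) ^ n = cis (2 * pi * j * x)" for x
    by (simp add: turn_def Complex.DeMoivre cis_cnj cis_mult j_def algebra_simps)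
  have c: "cis (2 * pi * j) = 1"
    using jint by (auto simp: complex_eq_iff elim!: Ints_cases)
  let ?h = "\<lambda>x. cis (2 * pi * j * x) / (\<i> * of_real (2 * pi * j))"
  have "((\<lambda>x. cis (2 * pi * j * x)) has_integral ?h 1 - ?h 0) {0..1}"
  proof (rule fundamental_theorem_of_calculus)
    fix x :: real
    have "((\<lambda>x. cis (2 * pi * j * x)) has_vector_derivative (2 * pi * j) *\<^sub>R (\<i> * cis (2 * pi * j * x))) (at x within {0..1})"
      unfolding cis_conv_exp
      by (rule derivative_eq_intros refl has_vector_derivative_real_field | simp add: scaleR_conv_of_real)+
    then have "(?h has_vector_derivative (2 * pi * j) *\<^sub>R (\<i> * cis (2 * pi * j * x)) / (\<i> * of_real (2 * pi * j))) (at x within {0..1})"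
      by (rule has_vector_derivative_divide)
    then show "(?h has_vector_derivative cis (2 * pi * j * x)) (at x within {0..1})"
      using j0 by (simp add: scaleR_conv_of_real)
  qed simp
  then have "integral {0..1} (\<lambda>x. cis (2 * pi * j * x)) = 0"
    by (simp add: integral_unique c)
  moreover have "(\<integral>x. cis (2 * pi * j * x) \<partial>unit_lebesgue) = integral {0..1} (\<lambda>x. cis (2 * pi * j * x))"
    using set_borel_integral_eq_integral(2)[OF borel_integrable_atLeastAtMost'[of 0 1 "\<lambda>x. cis (2 * pi * j * x)"]]
    by (simp add: integral_restrict_space set_lebesgue_integral_def continuous_intros)
  ultimately show ?thesis using False by (simp add: eq)
qed

lemma average_power_series:
  fixes b :: "nat \<Rightarrow> complex"
  assumes s: "summable (\<lambda>k. cmod (b k))" and g: "\<And>x. (\<lambda>k. b k * turn x ^ k) sums g x"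
  shows "(\<integral>x. g x * cnj (turn x) ^ n \<partial>unit_lebesgue) = b n"
proof -
  have gx: "g x * cnj (turn x) ^ n = (\<Sum>k. b k * (turn x ^ k * cnj (turn x) ^ n))" for x
    using sums_mult2[OF g[of x], of "cnj (turn x) ^ n"] by (simp add: sums_iff mult.assoc)
  have nrm: "norm (b k * (turn x ^ k * cnj (turn x) ^ n)) = cmod (b k)" for k x
    by (simp add: norm_mult norm_power)
  have one: "(\<integral>x. cmod (b k) \<partial>unit_lebesgue) = cmod (b k)" for k
    by (rule integral_const_unit_lebesgue)
  have "(\<lambda>k. \<integral>x. b k * (turn x ^ k * cnj (turn x) ^ n) \<partial>unit_lebesgue) sums
      (\<integral>x. (\<Sum>k. b k * (turn x ^ k * cnj (turn x) ^ n)) \<partial>unit_lebesgue)"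
    by (rule sums_integral)
       (use s in \<open>auto intro!: integrable_unit_lebesgue continuous_intros simp: norm_mult norm_power one\<close>)
  moreover have "(\<integral>x. b k * (turn x ^ k * cnj (turn x) ^ n) \<partial>unit_lebesgue) = (if k = n then b n else 0)" for k
    using average_turn_power[of k n] by simp
  ultimately have "(\<lambda>k. if k = n then b n else 0) sums (\<integral>x. g x * cnj (turn x) ^ n \<partial>unit_lebesgue)"
    by (simp only: gx)
  then show ?thesis using sums_unique2 sums_single[of n "\<lambda>_. b n"] by blast
qed

text \<open>For \<open>n = 0\<close> this is the mean value property, in general Cauchy's formula for the
  Taylor coefficients.\<close>

lemma average_holomorphic:
  assumes g: "g holomorphic_on ball 0 R" and z: "cmod z < R"
  shows "(\<integral>x. g (turn x * z) * cnj (turn x) ^ n \<partial>unit_lebesgue) = (deriv ^^ n) g 0 / fact n * z ^ n"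
proof (rule average_power_series)
  let ?b = "\<lambda>k. (deriv ^^ k) g 0 / fact k"
  define z' where "z' = (cmod z + R) / 2"
  have z': "cmod z < z'" "z' < R" "0 \<le> z'" using z norm_ge_zero[of z] by (auto simp: z'_def simp del: norm_ge_zero)
  have "summable (\<lambda>k. ?b k * complex_of_real z' ^ k)"
    using holomorphic_power_series[OF g, of "complex_of_real z'"] z' by (auto simp: sums_iff)
  then have "summable (\<lambda>k. norm (?b k * z ^ k))"
    by (rule powser_insidea) (use z' in simp)
  then show "summable (\<lambda>k. cmod (?b k * z ^ k))" .
  fix x
  have "(\<lambda>k. ?b k * (turn x * z) ^ k) sums g (turn x * z)"
    using holomorphic_power_series[OF g, of "turn x * z"] z by (simp add: norm_mult)
  then show "(\<lambda>k. ?b k * z ^ k * turn x ^ k) sums g (turn x * z)"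
    by (simp add: power_mult_distrib mult_ac)
qed

section \<open>Radial integrals and radial potentials\<close>

lemma nn_integral_norm_square:
  assumes [measurable]: "k \<in> borel_measurable borel"
  shows "(\<integral>\<^sup>+z. k ((cmod z)\<^sup>2) \<partial>lborel) = ennreal pi * (\<integral>\<^sup>+s. indicator {0<..} s * k s \<partial>lborel)"
proof -
  have "(\<integral>\<^sup>+z. k ((cmod z)\<^sup>2) \<partial>lborel) = (\<integral>\<^sup>+s. k s \<partial>distr lborel borel (\<lambda>z :: complex. (cmod z)\<^sup>2))"
    by (subst nn_integral_distr) auto
  also have "\<dots> = (\<integral>\<^sup>+s. (ennreal pi * indicator {0<..} s) * k s \<partial>lborel)"
    unfolding distr_norm_square_complex by (subst nn_integral_density) auto
  also have "\<dots> = ennreal pi * (\<integral>\<^sup>+s. indicator {0<..} s * k s \<partial>lborel)"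
    by (simp only: mult.assoc, rule nn_integral_cmult) simp
  finally show ?thesis .
qed

text \<open>In the coordinates \<open>q = \<bar>a\<bar>\<^sup>2\<close> and \<open>s = \<bar>b\<bar>\<^sup>2\<close> the measure is \<open>\<pi>\<^sup>2 dq ds\<close>; with \<open>r = q + s\<close> as
  the new variable, the integral over \<open>0 < q < r\<close> of \<open>q\<^sup>n\<close> is elementary.\<close>

lemma nn_integral_monomial_radial:
  assumes [measurable]: "w \<in> borel_measurable borel"
  shows "(\<integral>\<^sup>+p. ennreal (((cmod (fst p))\<^sup>2) ^ n) * w ((cmod (fst p))\<^sup>2 + (cmod (snd p))\<^sup>2) \<partial>(lborel :: (complex \<times> complex) measure)) =
    ennreal (pi\<^sup>2 / (real n + 1)) * (\<integral>\<^sup>+r. w r * ennreal (r ^ (n + 1)) * indicator {0<..} r \<partial>lborel)"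
proof -
  have "(\<integral>\<^sup>+p. ennreal (((cmod (fst p))\<^sup>2) ^ n) * w ((cmod (fst p))\<^sup>2 + (cmod (snd p))\<^sup>2) \<partial>(lborel :: (complex \<times> complex) measure)) =
     (\<integral>\<^sup>+a. \<integral>\<^sup>+b. ennreal (((cmod a)\<^sup>2) ^ n) * w ((cmod a)\<^sup>2 + (cmod b)\<^sup>2) \<partial>(lborel :: complex measure) \<partial>(lborel :: complex measure))"
    unfolding lborel_prod[symmetric] by (subst lborel.nn_integral_fst[symmetric]) auto
  also have "\<dots> = (\<integral>\<^sup>+a. ennreal pi * (\<integral>\<^sup>+s. indicator {0<..} s * (ennreal (((cmod a)\<^sup>2) ^ n) * w ((cmod a)\<^sup>2 + s)) \<partial>lborel) \<partial>(lborel :: complex measure))"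
    by (subst nn_integral_norm_square[symmetric]) auto
  also have "\<dots> = ennreal pi * (\<integral>\<^sup>+q. indicator {0<..} q * (ennreal pi * (\<integral>\<^sup>+s. indicator {0<..} s * (ennreal (q ^ n) * w (q + s)) \<partial>lborel)) \<partial>lborel)"
    by (subst nn_integral_norm_square[where k = "\<lambda>q. ennreal pi * (\<integral>\<^sup>+s. indicator {0<..} s * (ennreal (q ^ n) * w (q + s)) \<partial>lborel)"]) auto
  also have "\<dots> = ennreal pi * (\<integral>\<^sup>+q. ennreal pi * (\<integral>\<^sup>+r. indicator {0<..} q * indicator {0<..} (r - q) * (ennreal (q ^ n) * w r) \<partial>lborel) \<partial>lborel)"
  proof -
    have "(\<integral>\<^sup>+s. indicator {0<..} s * (ennreal (q ^ n) * w (q + s)) \<partial>lborel) =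
        (\<integral>\<^sup>+r. indicator {0<..} (r - q) * (ennreal (q ^ n) * w r) \<partial>lborel)" for q :: real
      using nn_integral_real_affine[of "\<lambda>r. indicator {0<..} (r - q) * (ennreal (q ^ n) * w r)" 1 q] by simp
    moreover have "indicator {0<..} q * (ennreal pi * (\<integral>\<^sup>+r. indicator {0<..} (r - q) * (ennreal (q ^ n) * w r) \<partial>lborel)) =
       ennreal pi * (\<integral>\<^sup>+r. indicator {0<..} q * indicator {0<..} (r - q) * (ennreal (q ^ n) * w r) \<partial>lborel)" for q :: real
      by (auto split: split_indicator)
    ultimately show ?thesis by simp
  qed
  also have "\<dots> = ennreal (pi\<^sup>2) * (\<integral>\<^sup>+q. \<integral>\<^sup>+r. indicator {0<..} q * indicator {0<..} (r - q) * (ennreal (q ^ n) * w r) \<partial>lborel \<partial>lborel)"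
    by (simp add: nn_integral_cmult power2_eq_square ennreal_mult mult.assoc)
  also have "(\<integral>\<^sup>+q. \<integral>\<^sup>+r. indicator {0<..} q * indicator {0<..} (r - q) * (ennreal (q ^ n) * w r) \<partial>lborel \<partial>lborel) =
      (\<integral>\<^sup>+r. \<integral>\<^sup>+q. indicator {0<..} q * indicator {0<..} (r - q) * (ennreal (q ^ n) * w r) \<partial>lborel \<partial>lborel)"
    by (subst lborel_pair.Fubini') auto
  also have "\<dots> = (\<integral>\<^sup>+r. w r * ennreal (r ^ (n + 1)) * indicator {0<..} r * ennreal (1 / (real n + 1)) \<partial>lborel)"
  proof (rule nn_integral_cong)
    fix r :: real
    have "(\<integral>\<^sup>+q. indicator {0<..} q * indicator {0<..} (r - q) * (ennreal (q ^ n) * w r) \<partial>lborel) =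
       (\<integral>\<^sup>+q. w r * (ennreal (q ^ n) * indicator {0<..<r} q) \<partial>lborel)"
      by (intro nn_integral_cong) (auto simp: mult_ac split: split_indicator)
    also have "\<dots> = w r * (\<integral>\<^sup>+q. ennreal (q ^ n) * indicator {0<..<r} q \<partial>lborel)"
      by (rule nn_integral_cmult) auto
    also have "(\<integral>\<^sup>+q. ennreal (q ^ n) * indicator {0<..<r} q \<partial>lborel) = ennreal (r ^ (n + 1)) * indicator {0<..} r * ennreal (1 / (real n + 1))"
    proof (cases "0 < r")
      case True
      have "((\<lambda>q. q ^ n) has_integral (r ^ Suc n / real (Suc n) - 0 ^ Suc n / real (Suc n))) {0..r}"
      proof (rule fundamental_theorem_of_calculus)
        fix t assume "t \<in> {0..r}"
        show "((\<lambda>t. t ^ Suc n / real (Suc n)) has_vector_derivative t ^ n) (at t within {0..r})"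
          unfolding has_real_derivative_iff_has_vector_derivative[symmetric]
          by (rule derivative_eq_intros refl | simp)+
      qed (use True in auto)
      then have "((\<lambda>q. q ^ n) has_integral (r ^ (n + 1) / (real n + 1))) {0<..<r}"
        by (simp add: has_integral_Icc_iff_Ioo add.commute)
      from nn_integral_has_integral_lebesgue'[OF _ this]
      show ?thesis using True by (simp add: ennreal_mult[symmetric])
    qed auto
    finally show "(\<integral>\<^sup>+q. indicator {0<..} q * indicator {0<..} (r - q) * (ennreal (q ^ n) * w r) \<partial>lborel) =
      w r * ennreal (r ^ (n + 1)) * indicator {0<..} r * ennreal (1 / (real n + 1))" by (simp add: mult_ac)
  qed
  also have "\<dots> = (\<integral>\<^sup>+r. w r * ennreal (r ^ (n + 1)) * indicator {0<..} r \<partial>lborel) * ennreal (1 / (real n + 1))"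
    by (rule nn_integral_multc) auto
  also have "ennreal (pi\<^sup>2) * ((\<integral>\<^sup>+r. w r * ennreal (r ^ (n + 1)) * indicator {0<..} r \<partial>lborel) * ennreal (1 / (real n + 1))) =
    ennreal (pi\<^sup>2) * ennreal (1 / (real n + 1)) * (\<integral>\<^sup>+r. w r * ennreal (r ^ (n + 1)) * indicator {0<..} r \<partial>lborel)"
    by (simp add: mult_ac)
  also have "ennreal (pi\<^sup>2) * ennreal (1 / (real n + 1)) = ennreal (pi\<^sup>2 / (real n + 1))"
    by (simp add: ennreal_mult[symmetric])
  finally show ?thesis .
qed

lemma d_z_eq:
  assumes "(F has_derivative D) (at x)"
  shows "d_z j F x = (D (axis j 1) - \<i> * D (axis j \<i>)) / 2"
    and "d_zbar j F x = (D (axis j 1) + \<i> * D (axis j \<i>)) / 2"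
  using frechet_derivative_at[OF assms] by (simp_all add: d_z_def d_zbar_def)

lemma has_derivative_radial:
  fixes x :: "complex ^ 'n"
  assumes "(g has_real_derivative d) (at ((norm x)\<^sup>2))"
  shows "((\<lambda>y. complex_of_real (g ((norm y)\<^sup>2))) has_derivative (\<lambda>v. of_real (2 * d * (x \<bullet> v)))) (at x)"
proof -
  have "((\<lambda>y. y \<bullet> y) has_derivative (\<lambda>v. x \<bullet> v + v \<bullet> x)) (at x)"
    by (rule has_derivative_inner[OF has_derivative_ident has_derivative_ident])
  then have "((\<lambda>y. (norm y)\<^sup>2) has_derivative (\<lambda>v. 2 * (x \<bullet> v))) (at x)"
    by (simp add: power2_norm_eq_inner inner_commute)
  then have "((\<lambda>y. g ((norm y)\<^sup>2)) has_derivative (\<lambda>v. d * (2 * (x \<bullet> v)))) (at x)"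
    using has_derivative_compose assms unfolding has_field_derivative_def by blast
  then have "((\<lambda>y. complex_of_real (g ((norm y)\<^sup>2))) has_derivative (\<lambda>v. of_real (d * (2 * (x \<bullet> v))))) (at x)"
    by (rule has_derivative_of_real)
  then show ?thesis by (simp add: mult_ac)
qed

lemma complex_hessian_radial:
  fixes x :: "complex ^ 'n"
  assumes d1: "\<And>r. 0 < r \<Longrightarrow> r < 1 \<Longrightarrow> (g has_real_derivative g1 r) (at r)"
    and d2: "\<And>r. 0 < r \<Longrightarrow> r < 1 \<Longrightarrow> (g1 has_real_derivative g2 r) (at r)"
    and x: "x \<noteq> 0" "norm x < 1"
  shows "complex_hessian (\<lambda>y. g ((norm y)\<^sup>2)) x $ j $ k =
     of_real (g2 ((norm x)\<^sup>2)) * cnj (x $ j) * (x $ k) + (if j = k then of_real (g1 ((norm x)\<^sup>2)) else 0)"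
proof -
  define S where "S = {y :: complex ^ 'n. y \<noteq> 0 \<and> norm y < 1}"
  have S: "open S"
  proof -
    have "S = ball 0 1 - {0}" by (auto simp: S_def)
    then show ?thesis by (simp add: open_Diff)
  qed
  have nrm: "0 < (norm y)\<^sup>2" "(norm y)\<^sup>2 < 1" if "y \<in> S" for y
    using that by (auto simp: S_def power_less_one_iff)
  have ax: "y \<bullet> axis k 1 = Re (y $ k)" "y \<bullet> axis k \<i> = Im (y $ k)" for y :: "complex ^ 'n" and k
    by (simp_all add: inner_axis inner_complex_def)
  have zb: "d_zbar k (\<lambda>y. complex_of_real (g ((norm y)\<^sup>2))) y = of_real (g1 ((norm y)\<^sup>2)) * y $ k" if "y \<in> S" for y
    unfolding d_z_eq(2)[OF has_derivative_radial[OF d1[OF nrm[OF that]]]] ax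
    by (simp add: complex_eq_iff)
  have xS: "x \<in> S" using x by (simp add: S_def)
  have "((\<lambda>y. of_real (g1 ((norm y)\<^sup>2)) * y $ k) has_derivative
      (\<lambda>v. of_real (g1 ((norm x)\<^sup>2)) * v $ k + of_real (2 * g2 ((norm x)\<^sup>2) * (x \<bullet> v)) * x $ k)) (at x)"
    by (rule has_derivative_mult[OF has_derivative_radial[OF d2[OF nrm[OF xS]]]])
       (rule bounded_linear_imp_has_derivative, rule bounded_linear_vec_nth)
  then have "((\<lambda>y. d_zbar k (\<lambda>y. complex_of_real (g ((norm y)\<^sup>2))) y) has_derivative
      (\<lambda>v. of_real (g1 ((norm x)\<^sup>2)) * v $ k + of_real (2 * g2 ((norm x)\<^sup>2) * (x \<bullet> v)) * x $ k)) (at x)"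
    by (rule has_derivative_transform_within_open[OF _ S xS]) (simp add: zb)
  from d_z_eq(1)[OF this, of j]
  show ?thesis
    unfolding complex_hessian_def ax
    by (auto simp: axis_def complex_eq_iff algebra_simps)
qed

section \<open>The quadratic parametrization of the Kepler ball\<close>

text \<open>The factor \<open>1 / \<surd>2\<close> makes \<open>\<bar>z\<bar> = \<bar>x\<bar>\<^sup>2\<close>. The image is the cone \<open>z \<cdot> z = 0\<close>.\<close>

definition quadric_map :: "complex ^ 2 \<Rightarrow> complex ^ 3" where
  "quadric_map x = vector [((x $ 1)\<^sup>2 - (x $ 2)\<^sup>2) / of_real (sqrt 2),
     \<i> * ((x $ 1)\<^sup>2 + (x $ 2)\<^sup>2) / of_real (sqrt 2), 2 * (x $ 1) * (x $ 2) / of_real (sqrt 2)]"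

definition punctured_ball :: "(complex ^ 2) set" where
  "punctured_ball = {x. x \<noteq> 0 \<and> norm x < 1}"

lemma open_punctured_ball: "open punctured_ball"
proof -
  have "punctured_ball = ball 0 1 - {0}" by (auto simp: punctured_ball_def)
  then show ?thesis using open_Diff[OF open_ball closed_singleton] by metis
qed

lemma sqrt2_complex: "complex_of_real (sqrt 2) * complex_of_real (sqrt 2) = 2"
  by (simp flip: of_real_mult)

lemma norm_square_complex_2: "(norm (x :: complex ^ 2))\<^sup>2 = (cmod (x $ 1))\<^sup>2 + (cmod (x $ 2))\<^sup>2"
  unfolding norm_vec_def L2_set_def by (simp add: sum_2)

lemma norm_square_complex_3:
  "(norm (z :: complex ^ 3))\<^sup>2 = (cmod (z $ 1))\<^sup>2 + (cmod (z $ 2))\<^sup>2 + (cmod (z $ 3))\<^sup>2"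
  unfolding norm_vec_def L2_set_def by (simp add: sum_3)

lemma norm_quadric_map: "norm (quadric_map x) = (norm x)\<^sup>2"
proof -
  define a where "a = x $ 1"
  define b where "b = x $ 2"
  have "(norm (quadric_map x))\<^sup>2 = ((cmod (a\<^sup>2 - b\<^sup>2))\<^sup>2 + (cmod (a\<^sup>2 + b\<^sup>2))\<^sup>2 + 4 * (cmod (a * b))\<^sup>2) / 2"
    unfolding norm_square_complex_3
    by (simp add: quadric_map_def a_def b_def norm_divide norm_mult power_divide power_mult_distrib add_divide_distrib)
  also have "(cmod (a\<^sup>2 - b\<^sup>2))\<^sup>2 + (cmod (a\<^sup>2 + b\<^sup>2))\<^sup>2 = 2 * (cmod (a\<^sup>2))\<^sup>2 + 2 * (cmod (b\<^sup>2))\<^sup>2"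
    unfolding cmod_power2 by (simp add: power2_eq_square algebra_simps)
  also have "(2 * (cmod (a\<^sup>2))\<^sup>2 + 2 * (cmod (b\<^sup>2))\<^sup>2 + 4 * (cmod (a * b))\<^sup>2) / 2 = ((cmod a)\<^sup>2 + (cmod b)\<^sup>2)\<^sup>2"
    by (simp add: norm_mult norm_power power2_eq_square algebra_simps)
  also have "\<dots> = ((norm x)\<^sup>2)\<^sup>2" by (simp add: norm_square_complex_2 a_def b_def)
  finally show ?thesis by (rule power2_eq_imp_eq) auto
qed

text \<open>Although the coordinates are determined on the Kepler manifold only up to a common sign,
  their squares are restrictions of linear functions.\<close>

lemma quadric_map_squares:
  "(quadric_map x $ 1 - \<i> * quadric_map x $ 2) / of_real (sqrt 2) = (x $ 1)\<^sup>2"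
  "- (quadric_map x $ 1 + \<i> * quadric_map x $ 2) / of_real (sqrt 2) = (x $ 2)\<^sup>2"
  by (simp_all add: quadric_map_def field_simps sqrt2_complex)

lemma quadric_map_uminus: "quadric_map (- x) = quadric_map x"
  by (simp add: quadric_map_def)

lemma quadric_map_eq_iff: "quadric_map x = quadric_map y \<longleftrightarrow> x = y \<or> x = - y"
proof
  assume eq: "quadric_map x = quadric_map y"
  have s: "(x $ 1)\<^sup>2 = (y $ 1)\<^sup>2" "(x $ 2)\<^sup>2 = (y $ 2)\<^sup>2"
    using quadric_map_squares[of x] quadric_map_squares[of y] by (simp_all add: eq)
  have p: "x $ 1 * x $ 2 = y $ 1 * y $ 2"
    using arg_cong[OF eq, of "\<lambda>z. z $ 3"] by (simp add: quadric_map_def)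
  have "x $ 1 = y $ 1 \<and> x $ 2 = y $ 2 \<or> x $ 1 = - y $ 1 \<and> x $ 2 = - y $ 2"
    using s p unfolding power2_eq_iff by (cases "y $ 1 = 0"; cases "y $ 2 = 0") auto
  then show "x = y \<or> x = - y" by (auto simp: vec_eq_iff forall_2)
qed (auto simp: quadric_map_uminus)

lemma quadric_map_in_kepler_ball: "x \<in> punctured_ball \<Longrightarrow> quadric_map x \<in> kepler_ball"
proof -
  assume x: "x \<in> punctured_ball"
  have "(\<Sum>j\<in>UNIV. quadric_map x $ j * quadric_map x $ j) = 0"
    by (simp add: sum_3 quadric_map_def field_simps power2_eq_square sqrt2_complex)
  moreover have "0 < norm (quadric_map x)" "norm (quadric_map x) < 1"
    using x by (simp_all add: norm_quadric_map punctured_ball_def power_less_one_iff)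
  ultimately show ?thesis by (auto simp: kepler_ball_def kepler_manifold_def)
qed

text \<open>Square roots give the coordinates up to sign; the equation \<open>z \<cdot> z = 0\<close> says that their
  product is right up to sign, and one of the signs is free.\<close>

lemma quadric_map_surj:
  assumes "z \<in> kepler_ball"
  obtains x where "x \<in> punctured_ball" "quadric_map x = z"
proof -
  have z: "z $ 1 * z $ 1 + z $ 2 * z $ 2 + z $ 3 * z $ 3 = 0" "z \<noteq> 0" "norm z < 1"
    using assms by (auto simp: kepler_ball_def kepler_manifold_def sum_3)
  let ?s = "complex_of_real (sqrt 2)"
  define a where "a = csqrt ((z $ 1 - \<i> * z $ 2) / ?s)"
  define b' where "b' = csqrt (- (z $ 1 + \<i> * z $ 2) / ?s)"
  have a2: "a\<^sup>2 = (z $ 1 - \<i> * z $ 2) / ?s" and b2: "b'\<^sup>2 = - (z $ 1 + \<i> * z $ 2) / ?s"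
    unfolding a_def b'_def by (rule power2_csqrt)+
  have "(2 * a * b' / ?s)\<^sup>2 = 4 * (a\<^sup>2 * b'\<^sup>2) / (?s * ?s)"
    by (simp add: power2_eq_square)
  also have "\<dots> = 2 * (a\<^sup>2 * b'\<^sup>2)" unfolding sqrt2_complex by simp
  also have "a\<^sup>2 * b'\<^sup>2 = - ((z $ 1 - \<i> * z $ 2) * (z $ 1 + \<i> * z $ 2)) / (?s * ?s)"
    unfolding a2 b2 times_divide_times_eq by (simp only: mult_minus_right)
  also have "(z $ 1 - \<i> * z $ 2) * (z $ 1 + \<i> * z $ 2) = z $ 1 * z $ 1 + z $ 2 * z $ 2"
    by (simp add: algebra_simps)
  also have "2 * (- (z $ 1 * z $ 1 + z $ 2 * z $ 2) / (?s * ?s)) = (z $ 3)\<^sup>2"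
  proof -
    have "z $ 3 * z $ 3 = - (z $ 1 * z $ 1 + z $ 2 * z $ 2)"
      using z(1) by (rule add.inverse_unique[symmetric])
    then show ?thesis unfolding sqrt2_complex by (simp add: power2_eq_square)
  qed
  finally have sq: "2 * a * b' / ?s = z $ 3 \<or> 2 * a * b' / ?s = - z $ 3"
    by (simp only: power2_eq_iff)
  obtain b where b: "b\<^sup>2 = b'\<^sup>2" "2 * a * b / ?s = z $ 3"
  proof (cases "2 * a * b' / ?s = z $ 3")
    case True then show ?thesis using that[of b'] by blast
  next
    case False
    then have "2 * a * b' / ?s = - z $ 3" using sq by blast
    then have "2 * a * (- b') / ?s = z $ 3" by simp
    then show ?thesis using that[of "- b'"] by simp
  qed
  define x :: "complex ^ 2" where "x = vector [a, b]"
  have "a\<^sup>2 - b\<^sup>2 = 2 * z $ 1 / ?s" "a\<^sup>2 + b\<^sup>2 = - (2 * \<i> * z $ 2 / ?s)"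
    unfolding b a2 b2 by (simp_all add: diff_divide_distrib add_divide_distrib)
  then have "(a\<^sup>2 - b\<^sup>2) / ?s = 2 * z $ 1 / (?s * ?s)" "\<i> * (a\<^sup>2 + b\<^sup>2) / ?s = 2 * z $ 2 / (?s * ?s)"
    by (simp_all add: algebra_simps)
  then have "(a\<^sup>2 - b\<^sup>2) / ?s = z $ 1" "\<i> * (a\<^sup>2 + b\<^sup>2) / ?s = z $ 2"
    unfolding sqrt2_complex by simp_all
  then have "quadric_map x = z"
    using b(2) unfolding vec_eq_iff forall_3 quadric_map_def x_def vector_3 vector_2 by blast
  moreover have "x \<in> punctured_ball"
  proof -
    have n: "(norm x)\<^sup>2 = norm z" using norm_quadric_map[of x] calculation by simp
    then have "x \<noteq> 0" using z(2) by auto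
    moreover have "norm x < 1" using n z(3) by (metis norm_ge_zero power_less_one_iff zero_neq_numeral)
    ultimately show ?thesis by (simp add: punctured_ball_def)
  qed
  ultimately show thesis using that by blast
qed

lemma has_derivative_vec:
  fixes f :: "'a::real_normed_vector \<Rightarrow> complex ^ 'n"
  assumes "\<And>i. ((\<lambda>x. f x $ i) has_derivative (\<lambda>v. f' v $ i)) (at x)"
  shows "(f has_derivative f') (at x)"
  unfolding has_derivative_componentwise_within[of f f' x UNIV]
  by (auto simp: Basis_vec_def inner_axis intro!: has_derivative_inner_left assms)

definition quadric_map_deriv :: "complex ^ 2 \<Rightarrow> complex ^ 2 \<Rightarrow> complex ^ 3" where
  "quadric_map_deriv x v = vector [2 * (x $ 1 * v $ 1 - x $ 2 * v $ 2) / of_real (sqrt 2),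
     2 * \<i> * (x $ 1 * v $ 1 + x $ 2 * v $ 2) / of_real (sqrt 2), 2 * (x $ 1 * v $ 2 + x $ 2 * v $ 1) / of_real (sqrt 2)]"

lemma has_derivative_vec_nth_complex: "((\<lambda>x :: complex ^ 'n. x $ i) has_derivative (\<lambda>v. v $ i)) F"
  by (rule bounded_linear_imp_has_derivative, rule bounded_linear_vec_nth)

lemma has_derivative_quadric_map: "(quadric_map has_derivative quadric_map_deriv x) (at x)"
proof (rule has_derivative_vec)
  note d = has_derivative_vec_nth_complex
  fix i :: 3
  consider "i = 1" | "i = 2" | "i = 3" using exhaust_3 by blast
  then show "((\<lambda>x. quadric_map x $ i) has_derivative (\<lambda>v. quadric_map_deriv x v $ i)) (at x)"
  proof cases
    case 1
    have "((\<lambda>x. (x $ 1 * x $ 1 - x $ 2 * x $ 2) * (1 / of_real (sqrt 2))) has_derivative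
       (\<lambda>v. ((x $ 1 * v $ 1 + v $ 1 * x $ 1) - (x $ 2 * v $ 2 + v $ 2 * x $ 2)) * (1 / of_real (sqrt 2)))) (at x)"
      by (intro has_derivative_mult_left has_derivative_diff has_derivative_mult d)
    then show ?thesis by (simp add: 1 quadric_map_def quadric_map_deriv_def power2_eq_square mult.commute)
  next
    case 2
    have "((\<lambda>x. (x $ 1 * x $ 1 + x $ 2 * x $ 2) * (\<i> / of_real (sqrt 2))) has_derivative
       (\<lambda>v. ((x $ 1 * v $ 1 + v $ 1 * x $ 1) + (x $ 2 * v $ 2 + v $ 2 * x $ 2)) * (\<i> / of_real (sqrt 2)))) (at x)"
      by (intro has_derivative_mult_left has_derivative_add has_derivative_mult d)
    then show ?thesis by (simp add: 2 quadric_map_def quadric_map_deriv_def power2_eq_square mult.commute mult.left_commute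
          distrib_left add_divide_distrib)
  next
    case 3
    have "((\<lambda>x. (x $ 1 * x $ 2) * (2 / of_real (sqrt 2))) has_derivative
       (\<lambda>v. (x $ 1 * v $ 2 + v $ 1 * x $ 2) * (2 / of_real (sqrt 2)))) (at x)"
      by (intro has_derivative_mult_left has_derivative_mult d)
    then show ?thesis by (simp add: 3 quadric_map_def quadric_map_deriv_def mult.commute mult.left_commute)
  qed
qed

lemma continuous_on_quadric_map: "continuous_on A quadric_map"
  using has_derivative_quadric_map has_derivative_continuous continuous_at_imp_continuous_on by blast

text \<open>The kernel is given by \<open>x\<^sub>1v\<^sub>1 = x\<^sub>2v\<^sub>2 = 0\<close> and \<open>x\<^sub>1v\<^sub>2 + x\<^sub>2v\<^sub>1 = 0\<close>, which is trivial
  outside the origin.\<close>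

lemma inj_quadric_map_deriv:
  assumes "x \<noteq> 0"
  shows "inj (quadric_map_deriv x)"
proof -
  interpret bounded_linear "quadric_map_deriv x" using has_derivative_quadric_map by (rule has_derivative_bounded_linear)
  have "v = 0" if v: "quadric_map_deriv x v = 0" for v
  proof -
    have 1: "x $ 1 * v $ 1 - x $ 2 * v $ 2 = 0" and 2: "x $ 1 * v $ 1 + x $ 2 * v $ 2 = 0"
      and 3: "2 * (x $ 1 * v $ 2) + 2 * (x $ 2 * v $ 1) = 0"
      using arg_cong[OF v, of "\<lambda>z. z $ 1"] arg_cong[OF v, of "\<lambda>z. z $ 2"] arg_cong[OF v, of "\<lambda>z. z $ 3"]
      by (simp_all add: quadric_map_deriv_def)
    have "2 * (x $ 1 * v $ 1) = 0" "2 * (x $ 2 * v $ 2) = 0"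
      using arg_cong2[OF 1 2, of "(+)"] arg_cong2[OF 2 1, of "(-)"] by (simp_all add: algebra_simps)
    then have "v $ 1 = 0 \<and> v $ 2 = 0"
      using 3 assms by (auto simp: vec_eq_iff forall_2)
    then show "v = 0" by (simp add: vec_eq_iff forall_2)
  qed
  then show ?thesis by (simp add: linear_injective_0[OF linear])
qed

lemma holomorphic_chart_quadric_map:
  assumes U: "open U" "U \<subseteq> punctured_ball" and inj: "\<And>x. x \<in> U \<Longrightarrow> - x \<notin> U"
  shows "holomorphic_chart kepler_ball U quadric_map"
  unfolding holomorphic_chart_def
proof (intro conjI allI ballI)
  show "quadric_map ` U \<subseteq> kepler_ball" using U quadric_map_in_kepler_ball by blast
  show "inj_on quadric_map U" using inj by (auto simp: inj_on_def quadric_map_eq_iff)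
  show "cholomorphic_on (\<lambda>x. quadric_map x $ i) U" for i
    unfolding cholomorphic_on_def
  proof (intro ballI exI conjI allI)
    fix x
    show "((\<lambda>x. quadric_map x $ i) has_derivative (\<lambda>v. quadric_map_deriv x v $ i)) (at x)"
      by (rule bounded_linear.has_derivative[OF bounded_linear_vec_nth has_derivative_quadric_map])
    show "quadric_map_deriv x (c *s v) $ i = c * quadric_map_deriv x v $ i" for c v
      using exhaust_3[of i] by (auto simp: quadric_map_deriv_def field_simps)
  qed
  fix x assume "x \<in> U"
  then show "inj (frechet_derivative quadric_map (at x))"
    using inj_quadric_map_deriv[of x] U frechet_derivative_at[OF has_derivative_quadric_map, of x] by (auto simp: punctured_ball_def)
qed (use U in auto)

section \<open>The volume measure on the double cover\<close>

definition vec2 :: "complex \<times> complex \<Rightarrow> complex ^ 2" where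
  "vec2 p = vector [fst p, snd p]"

lemma vec2_nth [simp]: "vec2 p $ 1 = fst p" "vec2 p $ 2 = snd p"
  by (simp_all add: vec2_def)

lemma linear_vec2: "linear vec2"
  by (rule linearI) (auto simp: vec_eq_iff forall_2)

lemma bounded_linear_vec2: "bounded_linear vec2"
  using linear_vec2 by (simp add: linear_conv_bounded_linear)

lemma continuous_on_vec2: "continuous_on A vec2"
  by (rule linear_continuous_on[OF bounded_linear_vec2])

lemma norm_vec2: "norm (vec2 p) = norm p"
  by (simp add: norm_prod_def norm_vec_def L2_set_def sum_2)

lemma vec2_eq_0_iff [simp]: "vec2 p = 0 \<longleftrightarrow> p = 0"
  by (auto simp: vec_eq_iff forall_2 prod_eq_iff)

lemma vec2_surj: obtains p where "vec2 p = x"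
proof
  show "vec2 (x $ 1, x $ 2) = x" by (auto simp: vec_eq_iff forall_2)
qed

lemma borel_measurable_vec2 [measurable]: "vec2 \<in> borel_measurable borel"
  by (intro borel_measurable_continuous_onI continuous_on_vec2)

lemma lborel_complex_2: "(lborel :: (complex ^ 2) measure) = distr lborel borel vec2"
proof (rule lborel_eqI)
  fix l u :: "complex ^ 2"
  assume lu: "\<And>b. b \<in> Basis \<Longrightarrow> l \<bullet> b \<le> u \<bullet> b"
  have le: "l $ i \<bullet> b \<le> u $ i \<bullet> b" if "b \<in> Basis" for i b
    using lu[of "axis i b"] that by (auto simp: inner_axis Basis_vec_def)
  have "vec2 -` box l u = box (l $ 1) (u $ 1) \<times> box (l $ 2) (u $ 2)"
  proof -
    have "vec2 p \<in> box l u \<longleftrightarrow> (\<forall>i. \<forall>b\<in>Basis. l $ i \<bullet> b < vec2 p $ i \<bullet> b \<and> vec2 p $ i \<bullet> b < u $ i \<bullet> b)" for p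
      by (auto simp: mem_box Basis_vec_def inner_axis)
    then show ?thesis by (auto simp: forall_2 mem_box mem_Times_iff)
  qed
  then have "emeasure (distr lborel borel vec2) (box l u) =
      emeasure (lborel \<Otimes>\<^sub>M lborel) (box (l $ 1) (u $ 1) \<times> box (l $ 2) (u $ 2))"
    by (simp add: emeasure_distr lborel_prod)
  also have "\<dots> = emeasure lborel (box (l $ 1) (u $ 1)) * emeasure lborel (box (l $ 2) (u $ 2))"
    by (rule lborel.emeasure_pair_measure_Times) auto
  also have "\<dots> = ennreal ((\<Prod>b\<in>Basis. (u $ 1 - l $ 1) \<bullet> b) * (\<Prod>b\<in>Basis. (u $ 2 - l $ 2) \<bullet> b))"
    using le by (simp add: ennreal_mult prod_nonneg inner_diff_left)
  also have "(\<Prod>b\<in>Basis. (u $ 1 - l $ 1) \<bullet> b) * (\<Prod>b\<in>Basis. (u $ 2 - l $ 2) \<bullet> b) = (\<Prod>b\<in>Basis. (u - l) \<bullet> b)"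
  proof -
    have B: "(Basis :: (complex ^ 2) set) = {axis 1 1, axis 1 \<i>, axis 2 1, axis 2 \<i>}"
      by (auto simp: Basis_vec_def Basis_complex_def UNIV_2)
    show ?thesis unfolding B
      by (simp add: Basis_complex_def axis_eq_axis inner_axis)
  qed
  finally show "emeasure (distr lborel borel vec2) (box l u) = ennreal (\<Prod>b\<in>Basis. (u - l) \<bullet> b)" .
qed simp

lemma nn_integral_complex_2:
  assumes [measurable]: "g \<in> borel_measurable borel"
  shows "(\<integral>\<^sup>+x. g x \<partial>(lborel :: (complex ^ 2) measure)) = (\<integral>\<^sup>+p. g (vec2 p) \<partial>lborel)"
  by (subst lborel_complex_2, subst nn_integral_distr) auto

definition pair_ball :: "(complex \<times> complex) set" where
  "pair_ball = {p. p \<noteq> 0 \<and> norm p < 1}"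

text \<open>The covering map on \<open>\<complex> \<times> \<complex>\<close>, where product measures and rotations of a
  single coordinate are at hand; the charts themselves live on \<open>complex ^ 2\<close>.\<close>

definition cover :: "complex \<times> complex \<Rightarrow> complex ^ 3" where
  "cover p = quadric_map (vec2 p)"

lemma vec2_in_punctured_ball [simp]: "vec2 p \<in> punctured_ball \<longleftrightarrow> p \<in> pair_ball"
  by (simp add: punctured_ball_def pair_ball_def norm_vec2)

lemma open_pair_ball: "open pair_ball"
proof -
  have "pair_ball = ball 0 1 - {0}" by (auto simp: pair_ball_def)
  then show ?thesis using open_Diff[OF open_ball closed_singleton] by metis
qed

lemma continuous_on_cover: "continuous_on A cover"
  unfolding cover_def[abs_def]
  by (rule continuous_on_compose2[OF continuous_on_quadric_map continuous_on_vec2]) auto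

lemma borel_measurable_cover [measurable]: "cover \<in> borel_measurable borel"
  by (intro borel_measurable_continuous_onI continuous_on_cover)

lemma norm_cover: "norm (cover p) = (norm p)\<^sup>2"
  by (simp add: cover_def norm_quadric_map norm_vec2)

lemma cover_in_kepler_ball: "p \<in> pair_ball \<Longrightarrow> cover p \<in> kepler_ball"
  by (simp add: cover_def quadric_map_in_kepler_ball)

lemma cover_surj: "z \<in> kepler_ball \<Longrightarrow> \<exists>p\<in>pair_ball. cover p = z"
  by (metis cover_def quadric_map_surj vec2_in_punctured_ball vec2_surj)

lemma cover_measurable_ball:
  "cover \<in> restrict_space lborel pair_ball \<rightarrow>\<^sub>M restrict_space borel kepler_ball"
proof (rule measurable_restrict_space3)
  show "cover \<in> lborel \<rightarrow>\<^sub>M borel" by simp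
qed (use cover_in_kepler_ball in auto)

text \<open>An open set is a countable union of compact boxes.\<close>

lemma image_open_borel:
  fixes f :: "'a::euclidean_space \<Rightarrow> 'b::euclidean_space"
  assumes "open U" "continuous_on U f"
  shows "f ` U \<in> sets borel"
proof -
  obtain D :: "'a set set" where D: "countable D" "\<And>X. X \<in> D \<Longrightarrow> X \<subseteq> U \<and> (\<exists>a b. X = cbox a b)" "\<Union>D = U"
  proof (rule open_countable_Union_open_cbox[OF assms(1)])
    fix D :: "'a set set"
    assume D: "countable D" "D \<subseteq> Pow U" "\<And>X. X \<in> D \<Longrightarrow> \<exists>a b. X = cbox a b" "\<Union>D = U"
    show thesis by (rule that[of D]) (use D in auto)
  qed
  have "f ` U = (\<Union>X\<in>D. f ` X)" using D(3) by auto
  moreover have "f ` X \<in> sets borel" if "X \<in> D" for X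
  proof -
    have "X \<subseteq> U" "compact X" using D(2)[OF that] compact_cbox by auto
    then have "compact (f ` X)"
      by (intro compact_continuous_image continuous_on_subset[OF assms(2)])
    then show ?thesis by (rule borel_compact)
  qed
  ultimately show ?thesis using sets.countable_UN'[OF D(1), of "\<lambda>X. f ` X" borel] by auto
qed

text \<open>An open half space contains at most one of \<open>x\<close> and \<open>-x\<close>.\<close>

lemma half_space_charts:
  fixes h :: "complex ^ 2 \<Rightarrow> real"
  assumes "linear h"
  defines "U \<equiv> {x \<in> punctured_ball. 0 < h x}"
  shows "holomorphic_chart kepler_ball U quadric_map" "open U" "U \<subseteq> punctured_ball"
    "quadric_map ` U \<in> sets borel"
proof -
  have c: "continuous_on UNIV h" using assms(1) linear_continuous_on linear_conv_bounded_linear by blast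
  have "U = punctured_ball \<inter> {x. 0 < h x}" by (auto simp: U_def)
  then show U: "open U"
    using open_punctured_ball open_Collect_less[OF continuous_on_const c, of 0] by auto
  show sub: "U \<subseteq> punctured_ball" by (auto simp: U_def)
  show "holomorphic_chart kepler_ball U quadric_map"
    by (rule holomorphic_chart_quadric_map[OF U sub]) (auto simp: U_def linear_neg[OF assms(1)])
  show "quadric_map ` U \<in> sets borel" by (rule image_open_borel[OF U continuous_on_quadric_map])
qed

lemma half_spaces_cover:
  "kepler_ball \<subseteq> quadric_map ` {x \<in> punctured_ball. 0 < Re (x $ 1)} \<union> quadric_map ` {x \<in> punctured_ball. 0 < Im (x $ 1)} \<union>
    (quadric_map ` {x \<in> punctured_ball. 0 < Re (x $ 2)} \<union> quadric_map ` {x \<in> punctured_ball. 0 < Im (x $ 2)})"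
proof
  fix z :: "complex ^ 3" assume "z \<in> kepler_ball"
  then obtain x where x: "x \<in> punctured_ball" "quadric_map x = z" by (rule quadric_map_surj)
  have mx: "- x \<in> punctured_ball" "quadric_map (- x) = z" using x by (auto simp: punctured_ball_def quadric_map_uminus)
  have "Re (x $ 1) \<noteq> 0 \<or> Im (x $ 1) \<noteq> 0 \<or> Re (x $ 2) \<noteq> 0 \<or> Im (x $ 2) \<noteq> 0"
    using x by (auto simp: punctured_ball_def vec_eq_iff forall_2 complex_eq_iff)
  then have "\<exists>y. (y = x \<or> y = - x) \<and> (0 < Re (y $ 1) \<or> 0 < Im (y $ 1) \<or> 0 < Re (y $ 2) \<or> 0 < Im (y $ 2))"
    by (cases "0 < Re (x $ 1) \<or> 0 < Im (x $ 1) \<or> 0 < Re (x $ 2) \<or> 0 < Im (x $ 2)")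
       (blast, intro exI[of _ "- x"], auto)
  then obtain y where y: "y = x \<or> y = - x"
    and pos: "0 < Re (y $ 1) \<or> 0 < Im (y $ 1) \<or> 0 < Re (y $ 2) \<or> 0 < Im (y $ 2)" by blast
  have "y \<in> punctured_ball" "z = quadric_map y" using y x mx by auto
  then have im: "z \<in> quadric_map ` {x \<in> punctured_ball. P x}" if "P y" for P using that by blast
  show "z \<in> quadric_map ` {x \<in> punctured_ball. 0 < Re (x $ 1)} \<union> quadric_map ` {x \<in> punctured_ball. 0 < Im (x $ 1)} \<union>
    (quadric_map ` {x \<in> punctured_ball. 0 < Re (x $ 2)} \<union> quadric_map ` {x \<in> punctured_ball. 0 < Im (x $ 2)})"
    using pos im[of "\<lambda>x. 0 < Re (x $ 1)"] im[of "\<lambda>x. 0 < Im (x $ 1)"]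
      im[of "\<lambda>x. 0 < Re (x $ 2)"] im[of "\<lambda>x. 0 < Im (x $ 2)"] by (simp only: Un_iff) argo
qed

lemma agree_on_union:
  assumes s: "sets N = sets M" and S: "S \<in> sets M" "T \<in> sets M"
    and 1: "\<And>A. A \<in> sets M \<Longrightarrow> A \<subseteq> S \<Longrightarrow> emeasure M A = emeasure N A"
    and 2: "\<And>A. A \<in> sets M \<Longrightarrow> A \<subseteq> T \<Longrightarrow> emeasure M A = emeasure N A"
    and A: "A \<in> sets M" "A \<subseteq> S \<union> T"
  shows "emeasure M A = emeasure N A"
proof -
  have A': "A = (A \<inter> S) \<union> (A - S)" by auto
  have m: "A \<inter> S \<in> sets M" "A - S \<in> sets M" using A S by auto
  have "emeasure M A = emeasure M (A \<inter> S) + emeasure M (A - S)"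
    using m by (subst A') (rule plus_emeasure[symmetric], auto)
  also have "\<dots> = emeasure N (A \<inter> S) + emeasure N (A - S)"
    using 1[OF m(1)] 2[OF m(2)] A(2) by auto
  also have "\<dots> = emeasure N A"
    using m s by (subst (3) A') (rule plus_emeasure, auto)
  finally show ?thesis .
qed

text \<open>On a chart \<open>U\<close> in a half space, the preimage of a set \<open>A\<close> consists of two disjoint
  copies \<open>E\<close> and \<open>-E\<close>, exchanged by a rotation that preserves the radial density; so the integral over
  the whole preimage counts \<open>A\<close> twice. The factor 2 in the hypothesis compensates for this.
  Four half spaces cover everything.\<close>

lemma volume_measure_pullback:
  fixes k :: "real \<Rightarrow> ennreal"
  assumes vol: "is_volume_measure kepler_ball \<psi> \<nu>" and [measurable]: "k \<in> borel_measurable borel"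
    and det: "\<And>x. x \<in> punctured_ball \<Longrightarrow>
      ennreal (Re (det (complex_hessian (\<lambda>y. \<psi> (quadric_map y)) x))) = 2 * k ((norm x)\<^sup>2)"
  shows "\<nu> = distr (density (restrict_space lborel pair_ball) (\<lambda>p. k ((norm p)\<^sup>2)))
      (restrict_space borel kepler_ball) cover"
proof -
  define N where "N = distr (density (restrict_space lborel pair_ball) (\<lambda>p. k ((norm p)\<^sup>2)))
      (restrict_space borel kepler_ball) cover"
  have sets\<nu>: "sets \<nu> = sets (restrict_space borel kepler_ball)"
    using vol by (simp add: is_volume_measure_def)
  have pb [measurable]: "pair_ball \<in> sets borel" using open_pair_ball by simp
  have N: "emeasure N A = (\<integral>\<^sup>+p. k ((norm p)\<^sup>2) * indicator (pair_ball \<inter> cover -` A) p \<partial>lborel)"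
    if A: "A \<in> sets \<nu>" for A
  proof -
    have A': "A \<in> sets (restrict_space borel kepler_ball)" using A sets\<nu> by simp
    have "emeasure N A = emeasure (density (restrict_space lborel pair_ball) (\<lambda>p. k ((norm p)\<^sup>2))) (cover -` A \<inter> pair_ball)"
      unfolding N_def using cover_measurable_ball A'
      by (subst emeasure_distr) (auto simp: space_restrict_space)
    also have "\<dots> = (\<integral>\<^sup>+p. k ((norm p)\<^sup>2) * indicator (cover -` A \<inter> pair_ball) p \<partial>restrict_space lborel pair_ball)"
    proof (rule emeasure_density)
      show "(\<lambda>p. k ((norm p)\<^sup>2)) \<in> borel_measurable (restrict_space lborel pair_ball)"
        by (intro measurable_restrict_space1) simp
      show "cover -` A \<inter> pair_ball \<in> sets (restrict_space lborel pair_ball)"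
        using measurable_sets[OF cover_measurable_ball A'] by (simp add: space_restrict_space)
    qed
    also have "\<dots> = (\<integral>\<^sup>+p. k ((norm p)\<^sup>2) * indicator (pair_ball \<inter> cover -` A) p \<partial>lborel)"
      by (subst nn_integral_restrict_space) (auto intro!: nn_integral_cong split: split_indicator)
    finally show ?thesis .
  qed
  have chart: "emeasure \<nu> A = emeasure N A"
    if h: "linear h" and A: "A \<in> sets \<nu>" "A \<subseteq> quadric_map ` {x \<in> punctured_ball. 0 < h x}" for h :: "complex ^ 2 \<Rightarrow> real" and A
  proof -
    let ?U = "{x \<in> punctured_ball. 0 < h x}"
    note U = half_space_charts[OF h]
    have [measurable]: "A \<in> sets borel"
    proof -
      have "A \<in> sets (restrict_space borel kepler_ball)" using A sets\<nu> by simp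
      then obtain B where B: "B \<in> sets borel" "A = kepler_ball \<inter> B"
        by (auto simp: sets_restrict_space)
      have "quadric_map ` ?U \<subseteq> kepler_ball"
        using quadric_map_in_kepler_ball by (intro image_subsetI) auto
      then have "A = B \<inter> quadric_map ` ?U"
        unfolding B(2) using A(2)[unfolded B(2)] by (intro equalityI subsetI) (auto simp del: image_iff)
      then show ?thesis using sets.Int[OF B(1) U(4)] by (simp only:)
    qed
    have [measurable]: "?U \<in> sets borel" using U(2) by simp
    have [measurable]: "quadric_map \<in> borel_measurable borel"
      by (intro borel_measurable_continuous_onI continuous_on_quadric_map)
    define E where "E = {x \<in> ?U. quadric_map x \<in> A}"
    have E: "E \<in> sets borel"
    proof -
      have "E = ?U \<inter> (quadric_map -` A \<inter> space borel)" by (auto simp: E_def)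
      also have "\<dots> \<in> sets borel" by measurable
      finally show ?thesis .
    qed
    note [measurable] = E
    have "emeasure \<nu> A = (\<integral>\<^sup>+x\<in>E. ennreal (Re (det (complex_hessian (\<lambda>y. \<psi> (quadric_map y)) x))) \<partial>lborel)"
    proof -
      have "\<forall>(U :: (complex ^ 2) set) \<phi>. holomorphic_chart kepler_ball U \<phi> \<longrightarrow> (\<forall>B\<in>sets \<nu>. B \<subseteq> \<phi> ` U \<longrightarrow>
           emeasure \<nu> B = (\<integral>\<^sup>+x\<in>{x\<in>U. \<phi> x \<in> B}.
                ennreal (Re (det (complex_hessian (\<lambda>y. \<psi> (\<phi> y)) x))) \<partial>lborel))"
        by (rule conjunct2[OF vol[unfolded is_volume_measure_def]])
      from this[rule_format, OF U(1) A] show ?thesis by (simp only: E_def)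
    qed
    also have "\<dots> = (\<integral>\<^sup>+x. 2 * k ((norm x)\<^sup>2) * indicator E x \<partial>lborel)"
      by (intro nn_integral_cong) (auto simp: det E_def split: split_indicator)
    also have "\<dots> = (\<integral>\<^sup>+p. 2 * k ((norm p)\<^sup>2) * indicator E (vec2 p) \<partial>lborel)"
      by (subst nn_integral_complex_2) (auto simp: norm_vec2)
    also have "\<dots> = (\<integral>\<^sup>+p. k ((norm p)\<^sup>2) * indicator E (vec2 p) + k ((norm p)\<^sup>2) * indicator E (vec2 p) \<partial>lborel)"
      by (simp add: mult_2 distrib_right)
    also have "\<dots> = (\<integral>\<^sup>+p. k ((norm p)\<^sup>2) * indicator E (vec2 p) \<partial>lborel) + (\<integral>\<^sup>+p. k ((norm p)\<^sup>2) * indicator E (vec2 p) \<partial>lborel)"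
      by (rule nn_integral_add) auto
    also have "\<dots> = (\<integral>\<^sup>+p. k ((norm p)\<^sup>2) * indicator E (vec2 p) \<partial>lborel) +
       (\<integral>\<^sup>+p. k ((norm (- p))\<^sup>2) * indicator E (vec2 (- p)) \<partial>lborel)"
      using nn_integral_rotate_pair[of "\<lambda>p. k ((norm p)\<^sup>2) * indicator E (vec2 p)" "-1" "-1"]
      by (simp add: uminus_prod_def)
    also have "\<dots> = (\<integral>\<^sup>+p. k ((norm p)\<^sup>2) * indicator E (vec2 p) + k ((norm (- p))\<^sup>2) * indicator E (vec2 (- p)) \<partial>lborel)"
      by (rule nn_integral_add[symmetric]) auto
    also have "\<dots> = (\<integral>\<^sup>+p. k ((norm p)\<^sup>2) * indicator (pair_ball \<inter> cover -` A) p \<partial>lborel)"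
    proof (rule nn_integral_cong)
      fix p
      have neg: "vec2 (- p) = - vec2 p" by (rule linear_neg[OF linear_vec2])
      have "indicator E (vec2 p) + indicator E (vec2 (- p)) = (indicator (pair_ball \<inter> cover -` A) p :: ennreal)"
      proof (cases "p \<in> pair_ball \<inter> cover -` A")
        case True
        then obtain x where "x \<in> ?U" "quadric_map x = quadric_map (vec2 p)" using A(2) by (auto simp: cover_def)
        then have "vec2 p \<in> ?U \<or> - vec2 p \<in> ?U" by (auto simp: quadric_map_eq_iff)
        moreover have "\<not> (vec2 p \<in> ?U \<and> - vec2 p \<in> ?U)" by (auto simp: linear_neg[OF h])
        moreover have "quadric_map (vec2 p) \<in> A" "quadric_map (- vec2 p) \<in> A"
          using True by (simp_all add: cover_def quadric_map_uminus)
        ultimately have "vec2 p \<in> E \<and> vec2 (- p) \<notin> E \<or> vec2 p \<notin> E \<and> vec2 (- p) \<in> E"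
          unfolding E_def neg by blast
        then show ?thesis using True by auto
      next
        case False
        have "- vec2 p \<in> punctured_ball \<longleftrightarrow> p \<in> pair_ball"
          using vec2_in_punctured_ball[of p] by (simp add: punctured_ball_def)
        then have "vec2 p \<notin> E" "vec2 (- p) \<notin> E"
          using False unfolding E_def neg by (simp_all add: cover_def quadric_map_uminus)
        then show ?thesis using False by simp
      qed
      then show "k ((norm p)\<^sup>2) * indicator E (vec2 p) + k ((norm (- p))\<^sup>2) * indicator E (vec2 (- p)) =
         k ((norm p)\<^sup>2) * indicator (pair_ball \<inter> cover -` A) p"
        by (simp flip: distrib_left)
    qed
    also have "\<dots> = emeasure N A" using N A by simp
    finally show ?thesis .
  qed
  have sN: "sets N = sets \<nu>" by (simp add: N_def sets\<nu>)
  have lin: "linear (\<lambda>x :: complex ^ 2. Re (x $ i))" "linear (\<lambda>x :: complex ^ 2. Im (x $ i))" for i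
    by (auto intro!: linearI)
  have S: "quadric_map ` {x \<in> punctured_ball. 0 < h x} \<in> sets \<nu>" if "linear h"
    for h :: "complex ^ 2 \<Rightarrow> real"
  proof -
    have "quadric_map ` {x \<in> punctured_ball. 0 < h x} = kepler_ball \<inter> quadric_map ` {x \<in> punctured_ball. 0 < h x}"
      using quadric_map_in_kepler_ball by auto
    then show ?thesis unfolding sets\<nu> sets_restrict_space using half_space_charts(4)[OF that] by blast
  qed
  have "\<nu> = N"
  proof (rule measure_eqI[OF sN[symmetric]])
    fix A assume A: "A \<in> sets \<nu>"
    then have "A \<subseteq> kepler_ball" unfolding sets\<nu> by (auto simp: sets_restrict_space)
    note sub = subset_trans[OF this half_spaces_cover]
    note S' = S[OF lin(1)] S[OF lin(2)]
    note c1 = agree_on_union[OF sN S(1)[OF lin(1)] S(1)[OF lin(2)] chart[OF lin(1)] chart[OF lin(2)]]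
    show "emeasure \<nu> A = emeasure N A"
      by (rule agree_on_union[OF sN _ _ c1 c1 A sub]) (auto intro: S')
  qed
  then show ?thesis by (simp only: N_def)
qed

section \<open>Holomorphic functions on the double cover\<close>

lemma surface_holomorphic_pullback:
  assumes g: "holomorphic_on_surface kepler_ball g" and p: "p \<in> pair_ball"
  obtains D where "((\<lambda>x. g (quadric_map x)) has_derivative D) (at (vec2 p))" "\<And>c v. D (c *s v) = c * D v"
proof -
  have lin: "linear (\<lambda>x. x \<bullet> vec2 p)" by (simp add: bounded_linear.linear bounded_linear_inner_left)
  have "holomorphic_chart kepler_ball {x \<in> punctured_ball. 0 < x \<bullet> vec2 p} quadric_map"
    by (rule half_space_charts(1)[OF lin])
  then have "cholomorphic_on (\<lambda>x. g (quadric_map x)) {x \<in> punctured_ball. 0 < x \<bullet> vec2 p}"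
    using g by (simp add: holomorphic_on_surface_def)
  moreover have "vec2 p \<in> {x \<in> punctured_ball. 0 < x \<bullet> vec2 p}"
    using p by (auto simp: pair_ball_def)
  ultimately show thesis using that unfolding cholomorphic_on_def by blast
qed

lemma pullback_has_derivative:
  assumes g: "holomorphic_on_surface kepler_ball g" and p: "p \<in> pair_ball"
  shows "isCont (\<lambda>p. g (cover p)) p"
    and "\<exists>d. ((\<lambda>a. g (cover (a, snd p))) has_field_derivative d) (at (fst p))"
    and "\<exists>d. ((\<lambda>b. g (cover (fst p, b))) has_field_derivative d) (at (snd p))"
proof -
  obtain D where D: "((\<lambda>x. g (quadric_map x)) has_derivative D) (at (vec2 p))" "\<And>c v. D (c *s v) = c * D v"
    by (rule surface_holomorphic_pullback[OF g p]) (rule that)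
  have v: "(vec2 has_derivative vec2) (at p)"
    by (rule bounded_linear_imp_has_derivative[OF bounded_linear_vec2])
  have "((\<lambda>p. g (cover p)) has_derivative (\<lambda>v. D (vec2 v))) (at p)"
    using has_derivative_compose[OF v D(1)] by (simp add: cover_def)
  then show "isCont (\<lambda>p. g (cover p)) p" by (rule has_derivative_continuous)
  have comp: "((\<lambda>s. g (cover (j s))) has_field_derivative D (vec2 w)) (at s)"
    if j: "(j has_derivative (\<lambda>v. (v * fst w, v * snd w))) (at s)" "j s = p" for j s w
  proof -
    have "((\<lambda>s. vec2 (j s)) has_derivative (\<lambda>v. vec2 (v * fst w, v * snd w))) (at s)"
      by (rule has_derivative_compose[OF j(1)]) (use v j(2) in simp)
    moreover have "((\<lambda>x. g (quadric_map x)) has_derivative D) (at (vec2 (j s)))" using D(1) j(2) by simp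
    ultimately have "((\<lambda>s. g (quadric_map (vec2 (j s)))) has_derivative (\<lambda>v. D (vec2 (v * fst w, v * snd w)))) (at s)"
      by (rule has_derivative_compose)
    moreover have "D (vec2 (v * fst w, v * snd w)) = D (vec2 w) * v" for v
    proof -
      have "vec2 (v * fst w, v * snd w) = v *s vec2 w" by (simp add: vec_eq_iff forall_2)
      then show ?thesis using D(2) by simp
    qed
    ultimately show ?thesis by (simp add: has_field_derivative_def cover_def)
  qed
  have "((\<lambda>a. (a, snd p)) has_derivative (\<lambda>v. (v * fst (1, 0), v * snd (1, 0)))) (at (fst p))"
    by (auto intro!: derivative_eq_intros)
  from comp[OF this] show "\<exists>d. ((\<lambda>a. g (cover (a, snd p))) has_field_derivative d) (at (fst p))" by auto
  have "((\<lambda>b. (fst p, b)) has_derivative (\<lambda>v. (v * fst (0, 1), v * snd (0, 1)))) (at (snd p))"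
    by (auto intro!: derivative_eq_intros)
  from comp[OF this] show "\<exists>d. ((\<lambda>b. g (cover (fst p, b))) has_field_derivative d) (at (snd p))" by auto
qed

lemma norm_square_pair: "(norm (p :: complex \<times> complex))\<^sup>2 = (cmod (fst p))\<^sup>2 + (cmod (snd p))\<^sup>2"
  by (simp add: norm_prod_def)

lemma pair_ball_iff: "p \<in> pair_ball \<longleftrightarrow> p \<noteq> 0 \<and> (cmod (fst p))\<^sup>2 + (cmod (snd p))\<^sup>2 < 1"
  unfolding pair_ball_def norm_square_pair[symmetric] by (simp add: power_less_one_iff)

text \<open>For \<open>a \<noteq> 0\<close> the whole disc of all admissible \<open>b\<close> lies in the punctured ball, including
  its centre.\<close>

lemma cover_mean_value:
  assumes g: "holomorphic_on_surface kepler_ball g" and a: "a \<noteq> 0" "(a, b) \<in> pair_ball"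
  shows "(\<integral>x. g (cover (a, turn x * b)) \<partial>unit_lebesgue) = g (cover (a, 0))"
proof -
  define R where "R = sqrt (1 - (cmod a)\<^sup>2)"
  have ab: "(cmod a)\<^sup>2 + (cmod b)\<^sup>2 < 1" using a(2) by (simp add: pair_ball_iff)
  have R: "cmod b < R" unfolding R_def using ab by (intro real_less_rsqrt) simp
  have "(\<lambda>b. g (cover (a, b))) holomorphic_on ball 0 R"
  proof (rule holomorphic_onI)
    fix s :: complex assume "s \<in> ball 0 R"
    then have "cmod s < R" by simp
    then have "(cmod s)\<^sup>2 < R\<^sup>2" by (intro power_strict_mono) auto
    also have "R\<^sup>2 = 1 - (cmod a)\<^sup>2"
      unfolding R_def using ab zero_le_power2[of "cmod b"] by (intro real_sqrt_pow2) linarith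
    finally have "(a, s) \<in> pair_ball" using a(1) by (simp add: pair_ball_iff zero_prod_def)
    from pullback_has_derivative(3)[OF g this]
    show "(\<lambda>b. g (cover (a, b))) field_differentiable at s within ball 0 R"
      by (auto simp: field_differentiable_def intro: has_field_derivative_at_within)
  qed
  from average_holomorphic[OF this R, of 0] show ?thesis by simp
qed

text \<open>The puncture is a removable singularity (a case of Hartogs' theorem): by the mean value
  property over the circle \<open>\<bar>b\<bar> = 1/2\<close>, the values near \<open>a = 0\<close> on the axis are averages over a
  compact subset of the punctured ball, hence bounded.\<close>

lemma axis_restriction_extends:
  assumes g: "holomorphic_on_surface kepler_ball g"
  obtains h0 where "h0 holomorphic_on ball 0 1" "\<And>a. a \<noteq> 0 \<Longrightarrow> cmod a < 1 \<Longrightarrow> h0 a = g (cover (a, 0))"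
proof -
  let ?S = "cball (0 :: complex) (1/2) \<times> sphere (0 :: complex) (1/2)"
  have S: "p \<in> pair_ball" if "p \<in> ?S" for p
  proof -
    have "cmod (fst p) \<le> 1/2" "cmod (snd p) = 1/2" using that by auto
    moreover from this(1) have "(cmod (fst p))\<^sup>2 \<le> (1/2)\<^sup>2" by (rule power_mono) simp
    moreover have "(cmod (snd p))\<^sup>2 = 1/4" unfolding calculation(2) by (simp add: power2_eq_square)
    moreover have "p \<noteq> 0" using calculation(2) by auto
    ultimately show ?thesis unfolding pair_ball_iff by (simp add: power_divide)
  qed
  have "compact ((\<lambda>p. g (cover p)) ` ?S)"
    by (intro compact_continuous_image continuous_at_imp_continuous_on ballI compact_Times)
       (use S pullback_has_derivative(1)[OF g] in auto)
  then obtain B where B: "\<And>p. p \<in> ?S \<Longrightarrow> cmod (g (cover p)) \<le> B"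
    by (metis (no_types, lifting) bounded_iff compact_imp_bounded image_eqI)
  have bound: "cmod (g (cover (a, 0))) \<le> B" if a: "a \<noteq> 0" "cmod a \<le> 1/2" for a
  proof -
    have mem: "(a, turn x * (1/2)) \<in> ?S" for x using a by (simp add: norm_mult norm_divide)
    have "g (cover (a, 0)) = (\<integral>x. g (cover (a, turn x * (1/2))) \<partial>unit_lebesgue)"
      using cover_mean_value[OF g a(1), of "1/2"] S[of "(a, 1/2)"] a by (simp add: norm_divide)
    also have "cmod \<dots> \<le> (\<integral>x. cmod (g (cover (a, turn x * (1/2)))) \<partial>unit_lebesgue)"
      by (rule integral_norm_bound)
    also have "\<dots> \<le> (\<integral>x. B \<partial>unit_lebesgue)"
    proof (rule integral_mono)
      have "continuous_on {0..1} (\<lambda>x. g (cover (a, turn x * (1/2))))"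
      proof (rule continuous_at_imp_continuous_on, rule ballI)
        fix x :: real
        have "isCont (\<lambda>x. (a, turn x * (1/2))) x"
          using continuous_on_turn[of UNIV "\<lambda>x. x"] by (intro continuous_intros) (auto simp: continuous_on_eq_continuous_at)
        from isCont_o2[OF this pullback_has_derivative(1)[OF g S[OF mem]]]
        show "isCont (\<lambda>x. g (cover (a, turn x * (1/2)))) x" .
      qed
      then show "integrable unit_lebesgue (\<lambda>x. cmod (g (cover (a, turn x * (1/2)))))"
        by (intro integrable_norm integrable_unit_lebesgue)
      show "integrable unit_lebesgue (\<lambda>x. B)" by (intro integrable_unit_lebesgue continuous_on_const)
    qed (rule B[OF mem])
    finally show ?thesis by (simp only: integral_const_unit_lebesgue)
  qed
  have hol: "(\<lambda>a. g (cover (a, 0))) holomorphic_on ball 0 1 - {0}"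
  proof (rule holomorphic_onI)
    fix a :: complex assume "a \<in> ball 0 1 - {0}"
    then have "(a, 0) \<in> pair_ball" by (auto simp: pair_ball_iff zero_prod_def power_less_one_iff)
    from pullback_has_derivative(2)[OF g this]
    show "(\<lambda>a. g (cover (a, 0))) field_differentiable at a within ball 0 1 - {0}"
      by (auto simp: field_differentiable_def intro: has_field_derivative_at_within)
  qed
  have "\<forall>\<^sub>F a in at 0. cmod (g (cover (a, 0))) \<le> B"
    unfolding eventually_at using bound by (intro exI[of _ "1/2"]) (auto simp: dist_norm)
  then obtain h0 where "h0 holomorphic_on ball 0 1" "\<forall>a\<in>ball 0 1 - {0}. h0 a = g (cover (a, 0))"
    using holomorphic_on_extend_bounded[OF hol] by auto
  then show thesis by (intro that[of h0]) auto
qed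

text \<open>These polynomials on \<open>\<complex>\<^sup>3\<close> pull back to the monomials \<open>a\<^bsup>2m\<^esup>\<close>.\<close>

definition basis_function :: "nat \<Rightarrow> complex ^ 3 \<Rightarrow> complex" where
  "basis_function m z = ((z $ 1 - \<i> * z $ 2) / of_real (sqrt 2)) ^ m"

lemma basis_function_cover: "basis_function m (cover p) = fst p ^ (2 * m)"
  unfolding basis_function_def cover_def quadric_map_squares(1) by (simp add: power_mult)

lemma holomorphic_basis_function: "holomorphic_on_surface M (basis_function m)"
  unfolding holomorphic_on_surface_def cholomorphic_on_def
proof (intro allI impI ballI)
  fix U :: "(complex ^ 2) set" and \<phi> x
  assume "holomorphic_chart M U \<phi>" and x: "x \<in> U"
  then have "\<exists>D. ((\<lambda>x. \<phi> x $ i) has_derivative D) (at x) \<and> (\<forall>c v. D (c *s v) = c * D v)" for i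
    unfolding holomorphic_chart_def cholomorphic_on_def by blast
  then obtain D where D: "\<And>i. ((\<lambda>x. \<phi> x $ i) has_derivative D i) (at x)" "\<And>i c v. D i (c *s v) = c * D i v"
    by metis
  define E where "E v = (D 1 v - \<i> * D 2 v) * (1 / of_real (sqrt 2))" for v
  have L: "((\<lambda>x. (\<phi> x $ 1 - \<i> * \<phi> x $ 2) * (1 / of_real (sqrt 2))) has_derivative E) (at x)"
    unfolding E_def[abs_def] by (intro has_derivative_mult_left has_derivative_diff has_derivative_mult_right D)
  have E: "E (c *s v) = c * E v" for c v by (simp add: E_def D(2) algebra_simps)
  have "((\<lambda>x. ((\<phi> x $ 1 - \<i> * \<phi> x $ 2) * (1 / of_real (sqrt 2))) ^ m) has_derivative
      (\<lambda>v. of_nat m * E v * ((\<phi> x $ 1 - \<i> * \<phi> x $ 2) * (1 / of_real (sqrt 2))) ^ (m - 1))) (at x)"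
    by (rule has_derivative_power[OF L])
  then show "\<exists>D. ((\<lambda>x. basis_function m (\<phi> x)) has_derivative D) (at x) \<and> (\<forall>c v. D (c *s v) = c * D v)"
    by (intro exI[of _ "\<lambda>v. of_nat m * E v * ((\<phi> x $ 1 - \<i> * \<phi> x $ 2) * (1 / of_real (sqrt 2))) ^ (m - 1)"])
       (simp add: basis_function_def E mult_ac)
qed

lemma borel_measurable_basis_function [measurable]: "basis_function m \<in> borel_measurable borel"
  unfolding basis_function_def[abs_def]
  by (intro borel_measurable_continuous_onI continuous_intros) auto

lemma AE_fst_nonzero: "AE p in (lborel :: (complex \<times> complex) measure). fst p \<noteq> 0"
proof -
  have "{0 :: complex} \<times> (UNIV :: complex set) \<in> null_sets (lborel \<Otimes>\<^sub>M lborel)"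
    using lborel.emeasure_pair_measure_Times[of "{0 :: complex}" "lborel :: complex measure" "UNIV :: complex set"]
    by (intro null_setsI) auto
  then have "{0 :: complex} \<times> (UNIV :: complex set) \<in> null_sets lborel" unfolding lborel_prod .
  then show ?thesis by (rule AE_I') auto
qed

section \<open>The Bergman kernel on the diagonal\<close>

text \<open>Preimages of open sets are images under the covering map of open sets.\<close>

lemma surface_holomorphic_measurable:
  fixes g :: "complex ^ 3 \<Rightarrow> complex"
  assumes g: "holomorphic_on_surface kepler_ball g"
  shows "g \<in> borel_measurable (restrict_space borel kepler_ball)"
proof (rule borel_measurableI)
  fix S :: "complex set" assume "open S"
  have cont: "continuous_on pair_ball (\<lambda>p. g (cover p))"
    using pullback_has_derivative(1)[OF g] by (intro continuous_at_imp_continuous_on) auto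
  have "open (pair_ball \<inter> (\<lambda>p. g (cover p)) -` S)"
    by (rule continuous_open_preimage[OF cont open_pair_ball \<open>open S\<close>])
  then have "cover ` (pair_ball \<inter> (\<lambda>p. g (cover p)) -` S) \<in> sets borel"
    by (rule image_open_borel[OF _ continuous_on_cover])
  moreover have "g -` S \<inter> space (restrict_space borel kepler_ball) = cover ` (pair_ball \<inter> (\<lambda>p. g (cover p)) -` S)"
  proof (intro equalityI subsetI)
    fix z assume "z \<in> g -` S \<inter> space (restrict_space borel kepler_ball)"
    then have z: "z \<in> kepler_ball" "g z \<in> S" by (auto simp: space_restrict_space)
    then show "z \<in> cover ` (pair_ball \<inter> (\<lambda>p. g (cover p)) -` S)" using cover_surj[OF z(1)] by auto
  qed (auto simp: space_restrict_space cover_in_kepler_ball)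
  ultimately show "g -` S \<inter> space (restrict_space borel kepler_ball) \<in> sets (restrict_space borel kepler_ball)"
  proof -
    let ?E = "cover ` (pair_ball \<inter> (\<lambda>p. g (cover p)) -` S)"
    assume E: "?E \<in> sets borel" "g -` S \<inter> space (restrict_space borel kepler_ball) = ?E"
    have "?E = kepler_ball \<inter> ?E" using cover_in_kepler_ball by auto
    then have "?E \<in> sets (restrict_space borel kepler_ball)"
      unfolding sets_restrict_space using E(1) by (rule image_eqI)
    then show ?thesis unfolding E(2) .
  qed
qed

lemma pair_ball_rotate:
  "cmod c = 1 \<Longrightarrow> cmod d = 1 \<Longrightarrow> (c * fst p, d * snd p) \<in> pair_ball \<longleftrightarrow> p \<in> pair_ball"
  "cmod c = 1 \<Longrightarrow> cmod d = 1 \<Longrightarrow> norm (c * fst p, d * snd p) = norm p"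
  by (auto simp: pair_ball_iff norm_mult prod_eq_iff norm_prod_def)

lemma continuous_on_cover_rotation:
  assumes g: "holomorphic_on_surface kepler_ball g" and p: "(a, b) \<in> pair_ball"
  shows "continuous_on A (\<lambda>x. g (cover (a, turn x * b)))"
proof (rule continuous_at_imp_continuous_on, rule ballI)
  fix x :: real
  have mem: "(a, turn x * b) \<in> pair_ball" using pair_ball_rotate(1)[of 1 "turn x" "(a, b)"] p by simp
  have "isCont (\<lambda>x. (a, turn x * b)) x"
    using continuous_on_turn[of UNIV "\<lambda>x. x"] by (intro continuous_intros) (auto simp: continuous_on_eq_continuous_at)
  from isCont_o2[OF this pullback_has_derivative(1)[OF g mem]]
  show "isCont (\<lambda>x. g (cover (a, turn x * b))) x" .
qed

definition weight :: "(real \<Rightarrow> real) \<Rightarrow> complex \<times> complex \<Rightarrow> real" where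
  "weight w p = indicator pair_ball p * w ((norm p)\<^sup>2)"

text \<open>The squared norm of the \<open>m\<close>-th basis function, infinite when that function is not square
  integrable.\<close>

definition basis_norm :: "(real \<Rightarrow> real) \<Rightarrow> nat \<Rightarrow> ennreal" where
  "basis_norm w m = (\<integral>\<^sup>+p. ennreal (weight w p * ((cmod (fst p))\<^sup>2) ^ (2 * m)) \<partial>lborel)"

context
  fixes w :: "real \<Rightarrow> real" and \<mu> :: "(complex ^ 3) measure"
  assumes w [measurable]: "w \<in> borel_measurable borel" and w0: "\<And>r. 0 \<le> w r"
    and \<mu>: "\<mu> = distr (density (restrict_space lborel pair_ball) (\<lambda>p. ennreal (w ((norm p)\<^sup>2))))
      (restrict_space borel kepler_ball) cover"
begin

lemma weight_nonneg [simp]: "0 \<le> weight w p"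
  by (simp add: weight_def w0)

lemma pair_ball_borel [measurable]: "pair_ball \<in> sets borel"
  using open_pair_ball by simp

lemma weight_measurable [measurable]: "weight w \<in> borel_measurable borel"
  unfolding weight_def[abs_def] by measurable

lemma weight_rotate: "cmod c = 1 \<Longrightarrow> cmod d = 1 \<Longrightarrow> weight w (c * fst p, d * snd p) = weight w p"
  unfolding weight_def by (simp add: pair_ball_rotate indicator_def)

lemma nn_integral_pullback:
  assumes G: "G \<in> borel_measurable (restrict_space borel kepler_ball)"
  shows "(\<integral>\<^sup>+z. G z \<partial>\<mu>) = (\<integral>\<^sup>+p. ennreal (weight w p) * G (cover p) \<partial>lborel)"
proof -
  have GC: "(\<lambda>p. G (cover p)) \<in> borel_measurable (restrict_space lborel pair_ball)"
    by (rule measurable_compose[OF cover_measurable_ball G])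
  have W: "(\<lambda>p. ennreal (w ((norm p)\<^sup>2))) \<in> borel_measurable (restrict_space lborel pair_ball)"
    by (intro measurable_restrict_space1) simp
  have "(\<integral>\<^sup>+z. G z \<partial>\<mu>) = (\<integral>\<^sup>+p. G (cover p) \<partial>density (restrict_space lborel pair_ball) (\<lambda>p. ennreal (w ((norm p)\<^sup>2))))"
    unfolding \<mu> by (rule nn_integral_distr) (use cover_measurable_ball G in simp_all)
  also have "\<dots> = (\<integral>\<^sup>+p. ennreal (w ((norm p)\<^sup>2)) * G (cover p) \<partial>restrict_space lborel pair_ball)"
    by (rule nn_integral_density[OF W GC])
  also have "\<dots> = (\<integral>\<^sup>+p. ennreal (weight w p) * G (cover p) \<partial>lborel)"
    by (subst nn_integral_restrict_space) (auto intro!: nn_integral_cong simp: weight_def split: split_indicator)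
  finally show ?thesis .
qed

lemma
  fixes G :: "complex ^ 3 \<Rightarrow> complex"
  assumes G: "G \<in> borel_measurable (restrict_space borel kepler_ball)"
  shows integrable_pullback: "integrable \<mu> G \<longleftrightarrow> integrable lborel (\<lambda>p. weight w p *\<^sub>R G (cover p))"
    and integral_pullback: "(\<integral>z. G z \<partial>\<mu>) = (\<integral>p. weight w p *\<^sub>R G (cover p) \<partial>lborel)"
proof -
  have GC: "(\<lambda>p. G (cover p)) \<in> borel_measurable (restrict_space lborel pair_ball)"
    by (rule measurable_compose[OF cover_measurable_ball G])
  have W: "(\<lambda>p. w ((norm p)\<^sup>2)) \<in> borel_measurable (restrict_space lborel pair_ball)"
    by (intro measurable_restrict_space1) simp
  have eq: "indicator pair_ball p *\<^sub>R w ((norm p)\<^sup>2) *\<^sub>R G (cover p) = weight w p *\<^sub>R G (cover p)" for p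
    by (simp add: weight_def)
  have C: "cover \<in> density (restrict_space lborel pair_ball) (\<lambda>p. ennreal (w ((norm p)\<^sup>2))) \<rightarrow>\<^sub>M restrict_space borel kepler_ball"
    using cover_measurable_ball by simp
  have "integrable \<mu> G \<longleftrightarrow> integrable (density (restrict_space lborel pair_ball) (\<lambda>p. ennreal (w ((norm p)\<^sup>2)))) (\<lambda>p. G (cover p))"
    unfolding \<mu> by (rule integrable_distr_eq[OF C G])
  also have "\<dots> \<longleftrightarrow> integrable (restrict_space lborel pair_ball) (\<lambda>p. w ((norm p)\<^sup>2) *\<^sub>R G (cover p))"
    by (rule integrable_density[OF GC W]) (simp add: w0)
  also have "\<dots> \<longleftrightarrow> integrable lborel (\<lambda>p. weight w p *\<^sub>R G (cover p))"
    by (subst integrable_restrict_space, simp, simp only: eq)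
  finally show "integrable \<mu> G \<longleftrightarrow> integrable lborel (\<lambda>p. weight w p *\<^sub>R G (cover p))" .
  have "(\<integral>z. G z \<partial>\<mu>) = (\<integral>p. G (cover p) \<partial>density (restrict_space lborel pair_ball) (\<lambda>p. ennreal (w ((norm p)\<^sup>2))))"
    unfolding \<mu> by (rule integral_distr[OF C G])
  also have "\<dots> = (\<integral>p. w ((norm p)\<^sup>2) *\<^sub>R G (cover p) \<partial>restrict_space lborel pair_ball)"
    by (rule integral_density[OF GC W]) (simp add: w0)
  also have "\<dots> = (\<integral>p. weight w p *\<^sub>R G (cover p) \<partial>lborel)"
    by (subst integral_restrict_space, simp, simp only: eq)
  finally show "(\<integral>z. G z \<partial>\<mu>) = (\<integral>p. weight w p *\<^sub>R G (cover p) \<partial>lborel)" .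
qed

lemma basis_function_in_bergman_space:
  assumes "basis_norm w m \<noteq> \<infinity>"
  shows "basis_function m \<in> bergman_space kepler_ball \<mu>"
proof -
  have meas: "(\<lambda>z. ennreal ((cmod (basis_function m z))\<^sup>2)) \<in> borel_measurable (restrict_space borel kepler_ball)"
    by (intro measurable_restrict_space1) simp
  have "(\<integral>\<^sup>+z. ennreal ((cmod (basis_function m z))\<^sup>2) \<partial>\<mu>) = basis_norm w m"
    unfolding nn_integral_pullback[OF meas] basis_norm_def
    by (intro nn_integral_cong)
       (simp add: basis_function_cover norm_power power_mult[symmetric] mult.commute ennreal_mult[symmetric])
  then have "integrable \<mu> (\<lambda>z. (cmod (basis_function m z))\<^sup>2)"
    using assms by (intro integrableI_bounded) (auto simp: \<mu> less_top intro!: measurable_restrict_space1)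
  then show ?thesis by (simp add: bergman_space_def holomorphic_basis_function)
qed

text \<open>Let \<open>h\<close> be the pullback of \<open>K(\<cdot>, y)\<close>, and let \<open>c\<^sub>n\<close> be the Taylor coefficients of its
  restriction to the axis \<open>b = 0\<close>. Averaging over rotations of \<open>b\<close> replaces \<open>h(a, b)\<close> by
  \<open>h(a, 0)\<close>, and averaging over rotations of \<open>a\<close> then extracts the coefficient \<open>c\<^sub>2\<^sub>m\<close>. If the \<open>m\<close>-th
  basis function is square integrable, its reproducing property thus determines
  \<open>c\<^sub>2\<^sub>m\<close>. If it is not, the same two averages, as an inequality for \<open>\<bar>h\<bar>\<^sup>2\<close>, show \<open>c\<^sub>2\<^sub>m = 0\<close>. The odd coefficients
  vanish because \<open>h\<close> is even, and \<open>K(y, y)\<close> is the value of the series at \<open>a0\<close>.\<close>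

lemma kernel_diagonal:
  assumes K: "is_bergman_kernel kepler_ball \<mu> K" and a0: "0 < a0" "a0 < 1"
  defines "y \<equiv> cover (complex_of_real a0, 0)"
  shows "(\<lambda>m. if basis_norm w m = \<infinity> then 0 else complex_of_real (a0 ^ (4 * m) / enn2real (basis_norm w m))) sums K y y"
proof -
  have y: "y \<in> kepler_ball"
    unfolding y_def using a0 by (intro cover_in_kepler_ball) (auto simp: pair_ball_iff zero_prod_def power_less_one_iff)
  have KB: "(\<lambda>x. K x y) \<in> bergman_space kepler_ball \<mu>"
    and rep: "\<And>g. g \<in> bergman_space kepler_ball \<mu> \<Longrightarrow> g y = (\<integral>x. g x * cnj (K x y) \<partial>\<mu>)"
    using K y by (auto simp: is_bergman_kernel_def)
  have hol: "holomorphic_on_surface kepler_ball (\<lambda>x. K x y)" and L2: "integrable \<mu> (\<lambda>z. (cmod (K z y))\<^sup>2)"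
    using KB by (auto simp: bergman_space_def)
  note Km = surface_holomorphic_measurable[OF hol]
  obtain h0 where h0: "h0 holomorphic_on ball 0 1" "\<And>a. a \<noteq> 0 \<Longrightarrow> cmod a < 1 \<Longrightarrow> h0 a = K (cover (a, 0)) y"
    using axis_restriction_extends[OF hol] by metis
  define c where "c n = (deriv ^^ n) h0 0 / fact n" for n
  have avg0: "(\<integral>x. h0 (turn x * a) * cnj (turn x) ^ n \<partial>unit_lebesgue) = c n * a ^ n" if "cmod a < 1" for a n
    using average_holomorphic[OF h0(1) that] by (simp add: c_def)
  have h0cont: "continuous_on A (\<lambda>x. h0 (turn x * a))" if "cmod a < 1" for A a
    by (rule continuous_on_compose2[OF holomorphic_on_imp_continuous_on[OF h0(1)]])
       (use that in \<open>auto intro!: continuous_intros simp: norm_mult\<close>)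
  define hS where "hS p = indicator pair_ball p *\<^sub>R K (cover p) y" for p
  have hS [measurable]: "hS \<in> borel_measurable borel"
    unfolding hS_def[abs_def] using pullback_has_derivative(1)[OF hol]
    by (intro borel_measurable_continuous_on_indicator continuous_at_imp_continuous_on) auto
  define g0 where "g0 a = indicator (ball 0 1) a *\<^sub>R h0 a" for a
  have g0 [measurable]: "g0 \<in> borel_measurable borel"
    unfolding g0_def[abs_def] using holomorphic_on_imp_continuous_on[OF h0(1)]
    by (intro borel_measurable_continuous_on_indicator) auto
  have fst1: "cmod (fst p) < 1" if "p \<in> pair_ball" for p
  proof -
    have "(cmod (fst p))\<^sup>2 < 1" using that zero_le_power2[of "cmod (snd p)"] unfolding pair_ball_iff by linarith
    then show ?thesis by (simp add: power_less_one_iff)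
  qed
  have hS_eq: "hS (fst p, turn x * snd p) = K (cover (fst p, turn x * snd p)) y" if "p \<in> pair_ball" for p x
    using that pair_ball_rotate(1)[of 1 "turn x" p] by (simp add: hS_def)
  have g0_eq: "g0 (turn x * fst p) = h0 (turn x * fst p)" "g0 (fst p) = h0 (fst p)" if "p \<in> pair_ball" for p x
    using fst1[OF that] by (simp_all add: g0_def norm_mult)
  have avgS: "(\<integral>x. hS (fst p, turn x * snd p) \<partial>unit_lebesgue) = g0 (fst p)" if p: "p \<in> pair_ball" "fst p \<noteq> 0" for p
    using cover_mean_value[OF hol p(2), of "snd p"] p h0(2)[OF p(2) fst1[OF p(1)]]
    by (simp add: hS_eq g0_eq)
  have coeff_fin: "complex_of_real a0 ^ (2 * m) = c (2 * m) * of_real (enn2real (basis_norm w m))"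
    if fin: "basis_norm w m \<noteq> \<infinity>" for m
  proof -
    let ?e = "basis_function m"
    have ey: "?e y = complex_of_real a0 ^ (2 * m)" by (simp add: y_def basis_function_cover)
    have Gm: "(\<lambda>z. ?e z * cnj (K z y)) \<in> borel_measurable (restrict_space borel kepler_ball)"
    proof -
      have "?e \<in> borel_measurable (restrict_space borel kepler_ball)" by (intro measurable_restrict_space1) simp
      moreover have "(\<lambda>z. cnj (K z y)) \<in> borel_measurable (restrict_space borel kepler_ball)"
        by (rule borel_measurable_continuous_on[OF _ Km]) (intro continuous_intros)
      ultimately show ?thesis by measurable
    qed
    have eq: "?e y = (\<integral>z. ?e z * cnj (K z y) \<partial>\<mu>)" by (rule rep[OF basis_function_in_bergman_space[OF fin]])
    \<comment> \<open>A nonzero Bochner integral can only come from an integrable function.\<close>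
    then have int: "integrable \<mu> (\<lambda>z. ?e z * cnj (K z y))"
      using not_integrable_integral_eq[of \<mu> "\<lambda>z. ?e z * cnj (K z y)"] ey a0 by force
    define Q where "Q p = weight w p *\<^sub>R (cnj (fst p) ^ (2 * m) * hS p)" for p
    have Qcnj: "Q p = cnj (weight w p *\<^sub>R (?e (cover p) * cnj (K (cover p) y)))" for p
      by (simp add: Q_def basis_function_cover hS_def weight_def split: split_indicator)
    have Qi: "integrable lborel Q"
      unfolding Qcnj[abs_def] using int unfolding integrable_pullback[OF Gm]
      by (intro integrable_cnj)
    have Qv: "(\<integral>p. Q p \<partial>lborel) = cnj (?e y)"
      unfolding Qcnj eq integral_pullback[OF Gm]
      using int unfolding integrable_pullback[OF Gm] by (rule integral_bounded_linear[OF bounded_linear_cnj])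
    define Q2 where "Q2 p = weight w p *\<^sub>R (cnj (fst p) ^ (2 * m) * g0 (fst p))" for p
    have [measurable]: "Q2 \<in> borel_measurable borel"
    proof -
      have "(\<lambda>p. cnj (fst p)) \<in> borel_measurable (borel :: (complex \<times> complex) measure)"
        by (intro borel_measurable_continuous_onI continuous_intros)
      moreover have "(\<lambda>p. g0 (fst p)) \<in> borel_measurable (borel :: (complex \<times> complex) measure)"
        by (rule measurable_compose[OF _ g0]) (intro borel_measurable_continuous_onI continuous_intros)
      ultimately show ?thesis unfolding Q2_def[abs_def] by measurable
    qed
    \<comment> \<open>The mean value property fails on the null set \<open>a = 0\<close>, where the disc meets the puncture.\<close>
    have step1: "AE p in lborel. (\<integral>x. Q ((\<lambda>_. 1) x * fst p, turn x * snd p) \<partial>unit_lebesgue) = Q2 p"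
      using AE_fst_nonzero
    proof eventually_elim
      case (elim p)
      show ?case
      proof (cases "p \<in> pair_ball")
        case True
        have "(\<integral>x. Q (1 * fst p, turn x * snd p) \<partial>unit_lebesgue) =
            (\<integral>x. (weight w p *\<^sub>R cnj (fst p) ^ (2 * m)) * hS (fst p, turn x * snd p) \<partial>unit_lebesgue)"
          unfolding Q_def weight_rotate[OF norm_one norm_turn] by simp
        also have "\<dots> = (weight w p *\<^sub>R cnj (fst p) ^ (2 * m)) * (\<integral>x. hS (fst p, turn x * snd p) \<partial>unit_lebesgue)"
          by (rule integral_mult_right_zero)
        finally show ?thesis by (simp add: avgS[OF True elim] Q2_def)
      next
        case False
        then have "weight w p = 0" by (simp add: weight_def)
        then show ?thesis unfolding Q_def weight_rotate[OF norm_one norm_turn] by (simp add: Q2_def)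
      qed
    qed
    note av1 = integrable_average[where c = "\<lambda>_. 1" and d = turn and G = Q, OF _ _ _ _ Qi]
      integral_average[where c = "\<lambda>_. 1" and d = turn and G = Q, OF _ _ _ _ Qi]
    have Q2i: "integrable lborel Q2"
      by (rule integrable_cong_AE_imp[OF av1(1)]) (use step1 in auto)
    have "(\<integral>p. Q p \<partial>lborel) = (\<integral>p. (\<integral>x. Q ((\<lambda>_. 1) x * fst p, turn x * snd p) \<partial>unit_lebesgue) \<partial>lborel)"
      by (rule av1(2)[symmetric]) auto
    also have "\<dots> = (\<integral>p. Q2 p \<partial>lborel)"
      by (rule integral_cong_AE) (use step1 borel_measurable_integrable[OF av1(1)] in auto)
    also have "\<dots> = (\<integral>p. (\<integral>x. Q2 (turn x * fst p, (\<lambda>_. 1) x * snd p) \<partial>unit_lebesgue) \<partial>lborel)"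
      by (rule integral_average[symmetric, OF _ _ _ _ Q2i]) auto
    also have "\<dots> = (\<integral>p. c (2 * m) * of_real (weight w p * ((cmod (fst p))\<^sup>2) ^ (2 * m)) \<partial>lborel)"
    proof (rule Bochner_Integration.integral_cong[OF refl])
      fix p :: "complex \<times> complex"
      have "(\<integral>x. Q2 (turn x * fst p, 1 * snd p) \<partial>unit_lebesgue) =
          (\<integral>x. (weight w p *\<^sub>R cnj (fst p) ^ (2 * m)) * (g0 (turn x * fst p) * cnj (turn x) ^ (2 * m)) \<partial>unit_lebesgue)"
        unfolding Q2_def weight_rotate[OF norm_turn norm_one] by (simp add: power_mult_distrib mult_ac)
      also have "\<dots> = (weight w p *\<^sub>R cnj (fst p) ^ (2 * m)) * (\<integral>x. g0 (turn x * fst p) * cnj (turn x) ^ (2 * m) \<partial>unit_lebesgue)"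
        by (rule integral_mult_right_zero)
      also have "\<dots> = c (2 * m) * of_real (weight w p * ((cmod (fst p))\<^sup>2) ^ (2 * m))"
      proof (cases "p \<in> pair_ball")
        case True
        have "(\<integral>x. g0 (turn x * fst p) * cnj (turn x) ^ (2 * m) \<partial>unit_lebesgue) = c (2 * m) * fst p ^ (2 * m)"
          unfolding g0_eq[OF True] by (rule avg0[OF fst1[OF True]])
        moreover have "complex_of_real (((cmod (fst p))\<^sup>2) ^ (2 * m)) = cnj (fst p) ^ (2 * m) * fst p ^ (2 * m)"
        proof -
          have "complex_of_real (((cmod (fst p))\<^sup>2) ^ (2 * m)) = complex_of_real ((cmod (fst p))\<^sup>2) ^ (2 * m)"
            by (rule of_real_power)
          then show ?thesis by (simp only: complex_norm_square power_mult_distrib mult.commute)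
        qed
        ultimately show ?thesis by (simp add: scaleR_conv_of_real mult_ac)
      qed (simp add: weight_def)
      finally show "(\<integral>x. Q2 (turn x * fst p, (\<lambda>_. 1) x * snd p) \<partial>unit_lebesgue) =
          c (2 * m) * of_real (weight w p * ((cmod (fst p))\<^sup>2) ^ (2 * m))" by simp
    qed
    also have "\<dots> = c (2 * m) * (\<integral>p. of_real (weight w p * ((cmod (fst p))\<^sup>2) ^ (2 * m)) \<partial>lborel)"
      by (rule integral_mult_right_zero)
    also have "(\<integral>p. complex_of_real (weight w p * ((cmod (fst p))\<^sup>2) ^ (2 * m)) \<partial>lborel) = of_real (enn2real (basis_norm w m))"
    proof -
      have m: "(\<lambda>p. weight w p * ((cmod (fst p))\<^sup>2) ^ (2 * m)) \<in> borel_measurable lborel"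
      proof -
        have "(\<lambda>p. ((cmod (fst p))\<^sup>2) ^ (2 * m)) \<in> borel_measurable (borel :: (complex \<times> complex) measure)"
          by (intro borel_measurable_continuous_onI continuous_intros)
        then show ?thesis by simp
      qed
      show ?thesis unfolding basis_norm_def
        by (subst integral_complex_of_real, subst integral_eq_nn_integral[OF m]) auto
    qed
    finally show ?thesis using Qv ey by simp
  qed
  have coeff_inf: "c (2 * m) = 0" if inf: "basis_norm w m = \<infinity>" for m
  proof (rule ccontr)
    assume nz: "c (2 * m) \<noteq> 0"
    define G1 where "G1 p = ennreal (weight w p) * ennreal ((cmod (hS p))\<^sup>2)" for p
    define G2 where "G2 p = ennreal (weight w p) * ennreal ((cmod (g0 (fst p)))\<^sup>2)" for p
    have [measurable]: "G1 \<in> borel_measurable borel" unfolding G1_def[abs_def] by measurable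
    have [measurable]: "G2 \<in> borel_measurable borel"
    proof -
      have "(\<lambda>p. g0 (fst p)) \<in> borel_measurable (borel :: (complex \<times> complex) measure)"
        by (rule measurable_compose[OF _ g0]) (intro borel_measurable_continuous_onI continuous_intros)
      then show ?thesis unfolding G2_def[abs_def] by measurable
    qed
    have "(\<integral>\<^sup>+p. G1 p \<partial>lborel) = (\<integral>\<^sup>+z. ennreal ((cmod (K z y))\<^sup>2) \<partial>\<mu>)"
    proof -
      have "(\<lambda>z. ennreal ((cmod (K z y))\<^sup>2)) \<in> borel_measurable (restrict_space borel kepler_ball)"
        using Km by measurable
      from nn_integral_pullback[OF this] show ?thesis
        by (auto simp: G1_def hS_def weight_def intro!: nn_integral_cong split: split_indicator)
    qed
    also have "\<dots> < \<infinity>" using L2 by (simp add: integrable_iff_bounded)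
    finally have G1: "(\<integral>\<^sup>+p. G1 p \<partial>lborel) < \<infinity>" .
    have "(\<integral>\<^sup>+p. G2 p \<partial>lborel) \<le> (\<integral>\<^sup>+p. (\<integral>\<^sup>+x. G1 ((\<lambda>_. 1) x * fst p, turn x * snd p) \<partial>unit_lebesgue) \<partial>lborel)"
    proof (rule nn_integral_mono_AE, use AE_fst_nonzero in eventually_elim)
      case (elim p)
      show ?case
      proof (cases "p \<in> pair_ball")
        case True
        have cont: "continuous_on {0..1} (\<lambda>x. hS (fst p, turn x * snd p))"
          unfolding hS_eq[OF True] by (rule continuous_on_cover_rotation[OF hol]) (simp add: True)
        have m: "(\<lambda>x. ennreal ((cmod (hS (fst p, turn x * snd p)))\<^sup>2)) \<in> borel_measurable unit_lebesgue"
          using borel_measurable_integrable[OF integrable_unit_lebesgue[OF cont]] by measurable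
        have "G2 p \<le> ennreal (weight w p) * (\<integral>\<^sup>+x. ennreal ((cmod (hS (fst p, turn x * snd p)))\<^sup>2) \<partial>unit_lebesgue)"
          unfolding G2_def avgS[OF True elim, symmetric]
          by (intro mult_left_mono norm_average_square_le[OF cont]) simp
        also have "\<dots> = (\<integral>\<^sup>+x. ennreal (weight w p) * ennreal ((cmod (hS (fst p, turn x * snd p)))\<^sup>2) \<partial>unit_lebesgue)"
          by (rule nn_integral_cmult[OF m, symmetric])
        also have "\<dots> = (\<integral>\<^sup>+x. G1 (1 * fst p, turn x * snd p) \<partial>unit_lebesgue)"
          unfolding G1_def weight_rotate[OF norm_one norm_turn] by simp
        finally show ?thesis by simp
      qed (simp add: G2_def weight_def)
    qed
    also have "\<dots> = (\<integral>\<^sup>+p. G1 p \<partial>lborel)" by (rule nn_integral_average) auto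
    finally have G2: "(\<integral>\<^sup>+p. G2 p \<partial>lborel) < \<infinity>" using G1 by simp
    have "ennreal ((cmod (c (2 * m)))\<^sup>2) * basis_norm w m =
       (\<integral>\<^sup>+p. ennreal ((cmod (c (2 * m)))\<^sup>2) * ennreal (weight w p * ((cmod (fst p))\<^sup>2) ^ (2 * m)) \<partial>lborel)"
    proof -
      have "(\<lambda>p. ((cmod (fst p))\<^sup>2) ^ (2 * m)) \<in> borel_measurable (borel :: (complex \<times> complex) measure)"
        by (intro borel_measurable_continuous_onI continuous_intros)
      then have "(\<lambda>p. ennreal (weight w p * ((cmod (fst p))\<^sup>2) ^ (2 * m))) \<in> borel_measurable lborel" by simp
      then show ?thesis unfolding basis_norm_def by (rule nn_integral_cmult[symmetric])
    qed
    also have "\<dots> \<le> (\<integral>\<^sup>+p. (\<integral>\<^sup>+x. G2 (turn x * fst p, (\<lambda>_. 1) x * snd p) \<partial>unit_lebesgue) \<partial>lborel)"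
    proof (rule nn_integral_mono)
      fix p :: "complex \<times> complex"
      show "ennreal ((cmod (c (2 * m)))\<^sup>2) * ennreal (weight w p * ((cmod (fst p))\<^sup>2) ^ (2 * m)) \<le>
          (\<integral>\<^sup>+x. G2 (turn x * fst p, (\<lambda>_. 1) x * snd p) \<partial>unit_lebesgue)"
      proof (cases "p \<in> pair_ball")
        case True
        have cont: "continuous_on {0..1} (\<lambda>x. h0 (turn x * fst p) * cnj (turn x) ^ (2 * m))"
          using fst1[OF True] by (intro continuous_intros h0cont)
        have m: "(\<lambda>x. ennreal ((cmod (h0 (turn x * fst p) * cnj (turn x) ^ (2 * m)))\<^sup>2)) \<in> borel_measurable unit_lebesgue"
          using borel_measurable_integrable[OF integrable_unit_lebesgue[OF cont]] by measurable
        have "ennreal ((cmod (c (2 * m)))\<^sup>2) * ennreal (weight w p * ((cmod (fst p))\<^sup>2) ^ (2 * m)) =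
            ennreal (weight w p) * ennreal ((cmod (c (2 * m) * fst p ^ (2 * m)))\<^sup>2)"
          by (simp add: norm_mult norm_power power_mult_distrib ennreal_mult[symmetric] power_mult[symmetric] mult_ac)
        also have "\<dots> \<le> ennreal (weight w p) * (\<integral>\<^sup>+x. ennreal ((cmod (h0 (turn x * fst p) * cnj (turn x) ^ (2 * m)))\<^sup>2) \<partial>unit_lebesgue)"
          unfolding avg0[OF fst1[OF True], symmetric]
          by (intro mult_left_mono norm_average_square_le[OF cont]) simp
        also have "\<dots> = (\<integral>\<^sup>+x. ennreal (weight w p) * ennreal ((cmod (h0 (turn x * fst p) * cnj (turn x) ^ (2 * m)))\<^sup>2) \<partial>unit_lebesgue)"
          by (rule nn_integral_cmult[OF m, symmetric])
        also have "\<dots> = (\<integral>\<^sup>+x. G2 (turn x * fst p, 1 * snd p) \<partial>unit_lebesgue)"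
          unfolding G2_def weight_rotate[OF norm_turn norm_one]
          by (simp add: g0_eq[OF True] norm_mult norm_power)
        finally show ?thesis by simp
      qed (simp add: weight_def)
    qed
    also have "\<dots> = (\<integral>\<^sup>+p. G2 p \<partial>lborel)" by (rule nn_integral_average) auto
    finally have "ennreal ((cmod (c (2 * m)))\<^sup>2) * basis_norm w m < \<infinity>" using G2 by simp
    then show False using inf nz by (simp add: ennreal_mult_less_top)
  qed
  have odd0: "c n = 0" if "odd n" for n
  proof -
    have even: "h0 (- a) = h0 a" if "cmod a < 1" for a
    proof (cases "a = 0")
      case False
      have "cover (- a, 0) = cover (a, 0)"
        using quadric_map_uminus[of "vec2 (a, 0)"] linear_neg[OF linear_vec2, of "(a, 0)"] by (simp add: cover_def uminus_prod_def)
      then show ?thesis using h0(2)[of a] h0(2)[of "- a"] False that by simp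
    qed simp
    have "c n * (- (1/2)) ^ n = (\<integral>x. h0 (turn x * (- (1/2))) * cnj (turn x) ^ n \<partial>unit_lebesgue)"
      by (rule avg0[symmetric]) (simp add: norm_divide)
    also have "\<dots> = (\<integral>x. h0 (turn x * (1/2)) * cnj (turn x) ^ n \<partial>unit_lebesgue)"
      using even[of "turn _ * (1/2)"] by (simp add: norm_mult norm_divide)
    also have "\<dots> = c n * (1/2) ^ n" by (rule avg0) (simp add: norm_divide)
    finally show ?thesis using that by (simp add: power_minus_odd)
  qed
  have "(\<lambda>n. c n * complex_of_real a0 ^ n) sums h0 (complex_of_real a0)"
    using holomorphic_power_series[OF h0(1), of "complex_of_real a0"] a0 by (simp add: c_def)
  also have "h0 (complex_of_real a0) = K y y"
    using h0(2)[of "complex_of_real a0"] a0 by (simp add: y_def)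
  finally have "(\<lambda>m. c (2 * m) * complex_of_real a0 ^ (2 * m)) sums K y y"
  proof (subst sums_mono_reindex[of "\<lambda>m. 2 * m" "\<lambda>n. c n * complex_of_real a0 ^ n"])
    show "strict_mono (\<lambda>m :: nat. 2 * m)" by (simp add: strict_mono_def)
    show "c n * complex_of_real a0 ^ n = 0" if "n \<notin> range (\<lambda>m. 2 * m)" for n
      using odd0[of n] that by (metis evenE mult_zero_left rangeI)
  qed
  moreover have "c (2 * m) * complex_of_real a0 ^ (2 * m) =
      (if basis_norm w m = \<infinity> then 0 else complex_of_real (a0 ^ (4 * m) / enn2real (basis_norm w m)))" for m
  proof (cases "basis_norm w m = \<infinity>")
    case False
    have nz: "complex_of_real (enn2real (basis_norm w m)) \<noteq> 0" using coeff_fin[OF False] a0 by auto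
    have "c (2 * m) = complex_of_real a0 ^ (2 * m) / of_real (enn2real (basis_norm w m))"
      using coeff_fin[OF False] nz by (simp add: field_simps)
    moreover have "a0 ^ (4 * m) = a0 ^ (2 * m) * a0 ^ (2 * m)" by (simp flip: power_add)
    ultimately show ?thesis using False by simp
  qed (simp add: coeff_inf)
  ultimately show ?thesis by simp
qed

end

section \<open>Radial weights are not balanced\<close>

lemma left_expansion_at_1:
  fixes f :: "real \<Rightarrow> real"
  assumes an: "real_analytic_at_left f 1" and f1: "f 1 = 0"
    and d: "(f has_real_derivative -1) (at 1 within {0<..1})"
  obtains F :: "real fps" and \<epsilon> :: real where "0 < fps_conv_radius F" "0 < \<epsilon>"
    "\<And>t. 1 - \<epsilon> < t \<Longrightarrow> t < 1 \<Longrightarrow> f t = eval_fps F (t - 1)" "fps_nth F 0 = 0" "fps_nth F 1 = -1"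
proof -
  obtain \<epsilon> a where \<epsilon>: "0 < \<epsilon>" and s': "\<forall>t\<in>{1 - \<epsilon><..1}. (\<lambda>k. a k * (t - 1) ^ k) sums f t"
    using an[unfolded real_analytic_at_left_def] by (elim exE conjE) (rule that)
  have s: "(\<lambda>k. a k * (t - 1) ^ k) sums f t" if "1 - \<epsilon> < t" "t \<le> 1" for t
    using s' that by simp
  define F where "F = Abs_fps a"
  have "ereal \<epsilon> \<le> fps_conv_radius F"
    unfolding fps_conv_radius_def F_def
  proof (rule conv_radius_geI_ex)
    fix r assume r: "0 < r" "ereal r < ereal \<epsilon>"
    have "(\<lambda>k. a k * ((1 - r) - 1) ^ k) sums f (1 - r)"
      by (rule s) (use r in simp_all)
    then have "summable (\<lambda>k. a k * ((1 - r) - 1) ^ k)" by (rule sums_summable)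
    moreover have "(1 - r) - 1 = - r" by simp
    ultimately have "summable (\<lambda>n. fps_nth (Abs_fps a) n * (- r) ^ n)" by (simp only: fps_nth_Abs_fps)
    then show "\<exists>z. norm z = r \<and> summable (\<lambda>n. fps_nth (Abs_fps a) n * z ^ n)"
      by (intro exI[of _ "- r"] conjI) (use r in simp_all)
  qed
  then have rad: "0 < fps_conv_radius F"
    by (rule less_le_trans[rotated]) (simp add: \<epsilon>)
  have ev: "f t = eval_fps F (t - 1)" if "1 - \<epsilon> < t" "t \<le> 1" for t
    using s[OF that] by (simp add: eval_fps_def F_def sums_iff)
  have F0: "fps_nth F 0 = 0"
    using ev[of 1] \<epsilon> f1 by (simp add: eval_fps_at_0)
  have "((\<lambda>t. eval_fps F (t - 1)) has_real_derivative eval_fps (fps_euler 1 F) (1 - 1) / 1) (at 1)"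
  proof (rule has_real_derivative_eval_fps_euler)
    have "ereal \<bar>1 - 1\<bar> = 0" by simp
    then show "ereal \<bar>1 - 1\<bar> < fps_conv_radius F" using rad by (simp only:)
  qed simp
  then have "((\<lambda>t. eval_fps F (t - 1)) has_real_derivative fps_nth F 1) (at 1 within {0<..1})"
    by (simp add: eval_fps_at_0 fps_euler_1_nth has_field_derivative_at_within)
  then have "(f has_real_derivative fps_nth F 1) (at 1 within {0<..1})"
  proof (rule has_field_derivative_transform_within[OF _ \<epsilon>])
    fix t :: real assume "t \<in> {0<..1}" "dist t 1 < \<epsilon>"
    then show "eval_fps F (t - 1) = f t" by (intro ev[symmetric]) (simp_all add: dist_real_def)
  qed simp
  then have 1: "((\<lambda>y. (f y - f 1) / (y - 1)) \<longlongrightarrow> fps_nth F 1) (at 1 within {0<..1})"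
    by (simp add: has_field_derivative_iff)
  have 2: "((\<lambda>y. (f y - f 1) / (y - 1)) \<longlongrightarrow> -1) (at 1 within {0<..1})"
    using d by (simp add: has_field_derivative_iff)
  have "1 islimpt {0<..1::real}"
    unfolding islimpt_approachable
  proof (intro allI impI)
    fix e :: real assume "0 < e"
    then have "1 - min e 1 / 2 \<in> {0<..1} \<and> 1 - min e 1 / 2 \<noteq> 1 \<and> dist (1 - min e 1 / 2) 1 < e"
      by (simp add: dist_real_def) linarith
    then show "\<exists>x'\<in>{0<..1::real}. x' \<noteq> 1 \<and> dist x' 1 < e" by metis
  qed
  then have "at 1 within {0<..1::real} \<noteq> bot" by (simp add: trivial_limit_within)
  then have "fps_nth F 1 = -1" by (rule tendsto_unique[OF _ 1 2])
  with rad \<epsilon> ev F0 show thesis by (intro that[of F \<epsilon>]) simp_all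
qed

text \<open>The Hessian is \<open>g2 x\<^sup>* x + g1 1\<close>, with the eigenvalues \<open>g1\<close> and \<open>g1 + \<bar>x\<bar>\<^sup>2 g2\<close>.\<close>

lemma det_complex_hessian_radial:
  fixes x :: "complex ^ 2"
  assumes "\<And>r. 0 < r \<Longrightarrow> r < 1 \<Longrightarrow> (g has_real_derivative g1 r) (at r)"
    and "\<And>r. 0 < r \<Longrightarrow> r < 1 \<Longrightarrow> (g1 has_real_derivative g2 r) (at r)"
    and x: "x \<in> punctured_ball"
  shows "Re (det (complex_hessian (\<lambda>y. g ((norm y)\<^sup>2)) x)) =
    g1 ((norm x)\<^sup>2) * (g1 ((norm x)\<^sup>2) + (norm x)\<^sup>2 * g2 ((norm x)\<^sup>2))"
proof -
  define r where "r = (norm x)\<^sup>2"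
  have H: "complex_hessian (\<lambda>y. g ((norm y)\<^sup>2)) x $ j $ k =
     of_real (g2 r) * cnj (x $ j) * (x $ k) + (if j = k then of_real (g1 r) else 0)" for j k
    using complex_hessian_radial[OF assms(1,2), of x j k] x by (auto simp: punctured_ball_def r_def)
  have "det (complex_hessian (\<lambda>y. g ((norm y)\<^sup>2)) x) =
     of_real (g1 r) * (of_real (g1 r) + (x $ 1 * cnj (x $ 1) + x $ 2 * cnj (x $ 2)) * of_real (g2 r))"
    unfolding det_2 H by (simp add: algebra_simps)
  also have "x $ 1 * cnj (x $ 1) + x $ 2 * cnj (x $ 2) = of_real r"
    unfolding complex_norm_square[symmetric] r_def norm_square_complex_2 by simp
  also have "of_real (g1 r) * (of_real (g1 r) + of_real r * of_real (g2 r)) = complex_of_real (g1 r * (g1 r + r * g2 r))"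
    by simp
  finally show ?thesis unfolding Re_complex_of_real by (simp add: r_def)
qed

text \<open>At a point on the first coordinate axis the Hessian is diagonal, and its two diagonal
  entries are the eigenvalues.\<close>

lemma strictly_psh_radial:
  fixes \<psi> :: "complex ^ 3 \<Rightarrow> real"
  assumes d: "\<And>r. 0 < r \<Longrightarrow> r < 1 \<Longrightarrow> (g has_real_derivative g1 r) (at r)"
     "\<And>r. 0 < r \<Longrightarrow> r < 1 \<Longrightarrow> (g1 has_real_derivative g2 r) (at r)"
    and \<psi>: "\<And>y. \<psi> (quadric_map y) = g ((norm y)\<^sup>2)"
    and psh: "strictly_psh kepler_ball \<psi>" and r: "0 < r" "r < 1"
  shows "0 < g1 r" "0 < g1 r + r * g2 r"
proof -
  define x where "x = vec2 (complex_of_real (sqrt r), 0)"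
  have nx: "(norm x)\<^sup>2 = r" using r by (simp add: x_def norm_square_complex_2)
  have xp: "x \<in> punctured_ball" unfolding x_def vec2_in_punctured_ball pair_ball_iff using r by (simp add: zero_prod_def)
  have H: "complex_hessian (\<lambda>y. \<psi> (quadric_map y)) x $ j $ k =
     of_real (g2 r) * cnj (x $ j) * (x $ k) + (if j = k then of_real (g1 r) else 0)" for j k
    unfolding \<psi> using complex_hessian_radial[OF d, of x j k] xp nx by (auto simp: punctured_ball_def)
  have lin: "linear (\<lambda>x :: complex ^ 2. Re (x $ 1))" by (auto intro!: linearI)
  have "x \<in> {x \<in> punctured_ball. 0 < Re (x $ 1)}" using xp r by (simp add: x_def)
  then have pos: "0 < Re (\<Sum>j\<in>UNIV. \<Sum>k\<in>UNIV. complex_hessian (\<lambda>y. \<psi> (quadric_map y)) x $ j $ k * v $ j * cnj (v $ k))"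
    if "v \<noteq> 0" for v
    using psh half_space_charts(1)[OF lin] that unfolding strictly_psh_def by blast
  have sq: "complex_of_real (sqrt r) * complex_of_real (sqrt r) = of_real r"
    using r by (simp flip: of_real_mult)
  have xs: "x $ 1 = complex_of_real (sqrt r)" "x $ 2 = 0" by (simp_all add: x_def)
  have nz: "axis i (1 :: complex) \<noteq> 0" for i :: 2 by (simp add: axis_eq_0_iff)
  show "0 < g1 r"
    using pos[OF nz[of 2]] by (simp add: H sum_2 axis_def xs)
  show "0 < g1 r + r * g2 r"
    using pos[OF nz[of 1]] sq by (simp add: H sum_2 axis_def xs mult.assoc) (simp add: mult.commute)
qed

theorem corollary2:
  fixes f :: "real \<Rightarrow> real" and u :: "complex ^ 3 \<Rightarrow> real"
  assumes "smooth_on_open {0<..<1} f"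
    and "\<And>t. 0 < t \<Longrightarrow> t < 1 \<Longrightarrow> 0 < f t"
    and "real_analytic_at_left f 1"
    and "f 1 = 0"
    and "(f has_real_derivative -1) (at 1 within {0<..1})"
    and u_def: "\<And>z. u z = f ((norm z)\<^sup>2)"
    and "strictly_psh kepler_ball (\<lambda>z. ln (1 / u z))"
  shows "\<not> balanced kepler_ball u"
proof
  assume "balanced kepler_ball u"
  then obtain \<nu> K c where \<nu>: "is_volume_measure kepler_ball (\<lambda>z. ln (1 / u z)) \<nu>"
    and K: "is_bergman_kernel kepler_ball (density \<nu> (\<lambda>z. ennreal (u z ^ 3))) K"
    and c: "c \<noteq> 0" "\<And>z. z \<in> kepler_ball \<Longrightarrow> K z z = c / complex_of_real (u z ^ 3)"
    unfolding balanced_def by blast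
  note fpos = assms(2)
  define D where "D = deriv f"
  define D2 where "D2 = deriv D"
  have smooth: "((deriv ^^ k) f) differentiable (at t)" if "0 < t" "t < 1" for k t
    using assms(1) that by (auto simp: smooth_on_open_def)
  have df: "(f has_real_derivative D t) (at t)" and dD: "(D has_real_derivative D2 t) (at t)"
    if "0 < t" "t < 1" for t
    using smooth[OF that, of 0] smooth[OF that, of 1]
    by (simp_all add: D_def D2_def DERIV_deriv_iff_real_differentiable)
  have D2cont: "continuous_on {0<..<1} D2"
  proof (intro continuous_at_imp_continuous_on ballI)
    fix t :: real assume "t \<in> {0<..<1}"
    then have "D2 differentiable (at t)" using smooth[of t 2] by (simp add: D2_def D_def numeral_2_eq_2)
    then show "isCont D2 t" by (rule differentiable_imp_continuous_within)
  qed
  have fcont: "continuous_on {0<..<1} f" and Dcont: "continuous_on {0<..<1} D"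
    using DERIV_isCont[OF df] DERIV_isCont[OF dD] by (intro continuous_at_imp_continuous_on; simp)+
  define f1 where "f1 t = t * D t" for t
  define f2 where "f2 t = t * (D t + t * D2 t)" for t
  define V where "V t = - 2 * f1 t * (f1 t ^ 2 - f t * f2 t)" for t
  have Vcont: "continuous_on {0<..<1} V"
    unfolding V_def[abs_def] f1_def[abs_def] f2_def[abs_def] by (intro continuous_intros fcont Dcont D2cont)
  have d0: "(f has_real_derivative f1 t / t) (at t)" if "0 < t" "t < 1" for t
    using df[OF that] that by (simp add: f1_def)
  have d1: "(f1 has_real_derivative f2 t / t) (at t)" if "0 < t" "t < 1" for t
  proof -
    have "(f1 has_real_derivative t * D2 t + 1 * D t) (at t)"
      unfolding f1_def[abs_def] by (auto intro!: derivative_eq_intros dD[OF that])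
    then show ?thesis using that by (simp add: f2_def add.commute)
  qed
  \<comment> \<open>The potential on the double cover as a function of \<open>r = \<bar>x\<bar>\<^sup>2 = \<bar>z\<bar>\<close>, and its derivatives\<close>
  define g where "g r = ln (1 / f (r\<^sup>2))" for r
  define g1 where "g1 r = - (D (r\<^sup>2) * (2 * r)) / f (r\<^sup>2)" for r
  define g2 where "g2 r = - (((D2 (r\<^sup>2) * (2 * r)) * (2 * r) + 2 * D (r\<^sup>2)) * f (r\<^sup>2) - (D (r\<^sup>2) * (2 * r))\<^sup>2) / (f (r\<^sup>2))\<^sup>2" for r
  have sq01: "0 < r\<^sup>2" "r\<^sup>2 < 1" if "0 < r" "r < 1" for r :: real
    using that by (auto simp: power_less_one_iff)
  have dfr: "((\<lambda>r. f (r\<^sup>2)) has_real_derivative D (r\<^sup>2) * (2 * r)) (at r)"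
    and dDr: "((\<lambda>r. D (r\<^sup>2)) has_real_derivative D2 (r\<^sup>2) * (2 * r)) (at r)" if "0 < r" "r < 1" for r
    using DERIV_chain2[OF df[OF sq01[OF that]] DERIV_pow[of 2 r UNIV]]
      DERIV_chain2[OF dD[OF sq01[OF that]] DERIV_pow[of 2 r UNIV]] by simp_all
  have dg: "(g has_real_derivative g1 r) (at r)" if r: "0 < r" "r < 1" for r
  proof -
    have p: "0 < f (r\<^sup>2)" by (rule fpos[OF sq01[OF r]])
    have "((\<lambda>r. - ln (f (r\<^sup>2))) has_real_derivative g1 r) (at r)"
      unfolding g1_def by (auto intro!: derivative_eq_intros dfr[OF r] p simp: field_simps)
    then show ?thesis
    proof (rule has_field_derivative_transform_within_open[of _ _ _ "{0<..<1}"])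
      show "- ln (f (s\<^sup>2)) = g s" if "s \<in> {0<..<1}" for s
        using fpos[OF sq01[of s]] that by (simp add: g_def ln_div)
    qed (use r in auto)
  qed
  have dg1: "(g1 has_real_derivative g2 r) (at r)" if r: "0 < r" "r < 1" for r
  proof -
    have p: "f (r\<^sup>2) \<noteq> 0" using fpos[OF sq01[OF r]] by simp
    have "((\<lambda>r. - (D (r\<^sup>2) * (2 * r)) / f (r\<^sup>2)) has_real_derivative g2 r) (at r)"
      unfolding g2_def
      by (rule derivative_eq_intros dfr[OF r] dDr[OF r] p refl)+
         (use p in \<open>simp add: field_simps power2_eq_square\<close>)
    then show ?thesis unfolding g1_def[abs_def] .
  qed
  have g1_eq: "g1 r = - 2 * f1 (r\<^sup>2) / (r * f (r\<^sup>2))"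
    and g12_eq: "g1 r + r * g2 r = 4 * (f1 (r\<^sup>2) ^ 2 - f (r\<^sup>2) * f2 (r\<^sup>2)) / (r * f (r\<^sup>2) ^ 2)"
    if r: "0 < r" "r < 1" for r
  proof -
    have p: "f (r\<^sup>2) \<noteq> 0" using fpos[OF sq01[OF r]] by simp
    show "g1 r = - 2 * f1 (r\<^sup>2) / (r * f (r\<^sup>2))"
      using r p by (simp add: g1_def f1_def field_simps power2_eq_square)
    show "g1 r + r * g2 r = 4 * (f1 (r\<^sup>2) ^ 2 - f (r\<^sup>2) * f2 (r\<^sup>2)) / (r * f (r\<^sup>2) ^ 2)"
      using r p by (simp add: g1_def g2_def f1_def f2_def field_simps power2_eq_square)
  qed
  have gV: "g1 r * (g1 r + r * g2 r) = 4 * V (r\<^sup>2) / (r\<^sup>2 * f (r\<^sup>2) ^ 3)" if r: "0 < r" "r < 1" for r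
    unfolding g12_eq[OF r] unfolding g1_eq[OF r] V_def times_divide_times_eq
    by (simp add: power2_eq_square power3_eq_cube mult_ac right_diff_distrib)
  have \<psi>: "ln (1 / u (quadric_map y)) = g ((norm y)\<^sup>2)" for y
    by (simp add: u_def g_def norm_quadric_map)
  have pos: "0 < g1 r" "0 < g1 r + r * g2 r" if "0 < r" "r < 1" for r
    by (rule strictly_psh_radial[OF _ _ \<psi> assms(7) that]; erule (1) dg dg1)+
  have Vpos: "0 < V t" if t: "0 < t" "t < 1" for t
  proof -
    define r where "r = sqrt t"
    have r: "0 < r" "r < 1" "r\<^sup>2 = t" using t by (auto simp: r_def)
    have "0 < 4 * V t / (t * f t ^ 3)"
      using mult_pos_pos[OF pos(1)[OF r(1,2)] pos(2)[OF r(1,2)]] gV[OF r(1,2)] r(3) by simp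
    moreover have "0 < t * f t ^ 3" using t fpos[OF t] by simp
    ultimately show ?thesis by (auto simp: zero_less_divide_iff)
  qed
  \<comment> \<open>Half the determinant of the Hessian, without and with the weight \<open>u\<^sup>3\<close>: the map is two-to-one.\<close>
  define k where "k r = indicator {0<..<1} r *\<^sub>R (2 * V (r\<^sup>2) / (r\<^sup>2 * f (r\<^sup>2) ^ 3))" for r :: real
  define w where "w r = indicator {0<..<1} r *\<^sub>R (2 * V (r\<^sup>2) / r\<^sup>2)" for r :: real
  have sq_cont: "continuous_on {0<..<1} (\<lambda>r. h (r\<^sup>2))" if "continuous_on {0<..<1} h" for h :: "real \<Rightarrow> real"
  proof (rule continuous_on_compose2[OF that])
    show "(\<lambda>r. r\<^sup>2) ` {0<..<1} \<subseteq> {0<..<1::real}" using sq01 by auto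
  qed (intro continuous_intros)
  have nz: "r\<^sup>2 * f (r\<^sup>2) ^ 3 \<noteq> 0" "r\<^sup>2 \<noteq> 0" if "r \<in> {0<..<1}" for r
    using that fpos[OF sq01[of r]] by simp_all
  have "continuous_on {0<..<1} (\<lambda>r. 2 * V (r\<^sup>2) / (r\<^sup>2 * f (r\<^sup>2) ^ 3))"
    by (rule continuous_on_divide[OF continuous_on_mult[OF continuous_on_const sq_cont[OF Vcont]]
          continuous_on_mult[OF continuous_on_power[OF continuous_on_id] continuous_on_power[OF sq_cont[OF fcont]]]])
       (use nz(1) in blast)
  then have k [measurable]: "k \<in> borel_measurable borel"
    unfolding k_def[abs_def] by (rule borel_measurable_continuous_on_indicator[rotated]) simp
  have "continuous_on {0<..<1} (\<lambda>r. 2 * V (r\<^sup>2) / r\<^sup>2)"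
    by (rule continuous_on_divide[OF continuous_on_mult[OF continuous_on_const sq_cont[OF Vcont]]
          continuous_on_power[OF continuous_on_id]])
       (use nz(2) in blast)
  then have w [measurable]: "w \<in> borel_measurable borel"
    unfolding w_def[abs_def] by (rule borel_measurable_continuous_on_indicator[rotated]) simp
  have w0: "0 \<le> w r" for r
    using Vpos[OF sq01[of r]] by (auto simp: w_def less_imp_le split: split_indicator)
  have kw: "ennreal (k r) * ennreal (f (r\<^sup>2) ^ 3) = ennreal (w r)" for r
  proof (cases "r \<in> {0<..<1}")
    case True
    then have "0 < f (r\<^sup>2)" "0 < V (r\<^sup>2)" using fpos[OF sq01[of r]] Vpos[OF sq01[of r]] by auto
    then show ?thesis using True by (simp add: k_def w_def ennreal_mult[symmetric])
  qed (simp add: k_def w_def)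
  have \<nu>_eq: "\<nu> = distr (density (restrict_space lborel pair_ball) (\<lambda>p. ennreal (k ((norm p)\<^sup>2))))
      (restrict_space borel kepler_ball) cover"
  proof (rule volume_measure_pullback[OF \<nu>, where k = "\<lambda>r. ennreal (k r)"])
    fix x :: "complex ^ 2" assume x: "x \<in> punctured_ball"
    then have r: "0 < (norm x)\<^sup>2" "(norm x)\<^sup>2 < 1" by (auto simp: punctured_ball_def power_less_one_iff)
    have "Re (det (complex_hessian (\<lambda>y. ln (1 / u (quadric_map y))) x)) = 2 * k ((norm x)\<^sup>2)"
    proof -
      have "Re (det (complex_hessian (\<lambda>y. g ((norm y)\<^sup>2)) x)) =
          g1 ((norm x)\<^sup>2) * (g1 ((norm x)\<^sup>2) + (norm x)\<^sup>2 * g2 ((norm x)\<^sup>2))"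
        by (rule det_complex_hessian_radial[OF _ _ x]; erule (1) dg dg1)
      then show ?thesis unfolding \<psi> gV[OF r] using r by (simp add: k_def)
    qed
    then show "ennreal (Re (det (complex_hessian (\<lambda>y. ln (1 / u (quadric_map y))) x))) = 2 * ennreal (k ((norm x)\<^sup>2))"
      by (simp add: ennreal_mult')
  qed simp
  have u_meas: "(\<lambda>z. ennreal (u z ^ 3)) \<in> borel_measurable (restrict_space borel kepler_ball)"
  proof -
    have [measurable]: "(\<lambda>t. indicator {0<..<1} t *\<^sub>R f t) \<in> borel_measurable borel"
      by (rule borel_measurable_continuous_on_indicator[OF _ fcont]) simp
    have "(\<lambda>z :: complex ^ 3. ennreal ((indicator {0<..<1} ((norm z)\<^sup>2) *\<^sub>R f ((norm z)\<^sup>2)) ^ 3)) \<in>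
        borel_measurable (restrict_space borel kepler_ball)"
      by (intro measurable_restrict_space1) measurable
    then show ?thesis
    proof (rule measurable_cong[THEN iffD1, rotated])
      fix z :: "complex ^ 3" assume "z \<in> space (restrict_space borel kepler_ball)"
      then have "0 < norm z" "norm z < 1" by (auto simp: space_restrict_space kepler_ball_def kepler_manifold_def)
      then show "ennreal ((indicator {0<..<1} ((norm z)\<^sup>2) *\<^sub>R f ((norm z)\<^sup>2)) ^ 3) = ennreal (u z ^ 3)"
        using sq01[of "norm z"] by (simp add: u_def)
    qed
  qed
  have \<mu>_eq: "density \<nu> (\<lambda>z. ennreal (u z ^ 3)) =
      distr (density (restrict_space lborel pair_ball) (\<lambda>p. ennreal (w ((norm p)\<^sup>2)))) (restrict_space borel kepler_ball) cover"
  proof -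
    have km: "(\<lambda>p. ennreal (k ((norm p)\<^sup>2))) \<in> borel_measurable (restrict_space lborel (pair_ball :: (complex \<times> complex) set))"
      by (intro measurable_restrict_space1) simp
    have um: "(\<lambda>p. ennreal (u (cover p) ^ 3)) \<in> borel_measurable (restrict_space lborel pair_ball)"
      by (rule measurable_compose[OF cover_measurable_ball u_meas])
    have "density \<nu> (\<lambda>z. ennreal (u z ^ 3)) = distr (density (density (restrict_space lborel pair_ball)
        (\<lambda>p. ennreal (k ((norm p)\<^sup>2)))) (\<lambda>p. ennreal (u (cover p) ^ 3))) (restrict_space borel kepler_ball) cover"
      unfolding \<nu>_eq by (rule density_distr) (use u_meas cover_measurable_ball in simp_all)
    also have "density (density (restrict_space lborel pair_ball) (\<lambda>p. ennreal (k ((norm p)\<^sup>2)))) (\<lambda>p. ennreal (u (cover p) ^ 3))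
       = density (restrict_space lborel pair_ball) (\<lambda>p. ennreal (k ((norm p)\<^sup>2)) * ennreal (u (cover p) ^ 3))"
      by (rule density_density_eq[OF km um])
    also have "(\<lambda>p. ennreal (k ((norm p)\<^sup>2)) * ennreal (u (cover p) ^ 3)) = (\<lambda>p. ennreal (w ((norm p)\<^sup>2)))"
      by (simp only: u_def norm_cover kw)
    finally show ?thesis .
  qed
  define J where "J m = (\<integral>\<^sup>+t\<in>{0<..<1}. ennreal (t ^ m * (V t / t)) \<partial>lborel)" for m
  have norm_J: "basis_norm w m = ennreal (pi\<^sup>2 / (2 * real m + 1)) * J m" for m
  proof -
    define h where "h t = indicator {0<..<1} t *\<^sub>R (t ^ m * (V t / t))" for t :: real
    have h: "h \<in> borel_measurable borel"
      unfolding h_def[abs_def] by (intro borel_measurable_continuous_on_indicator continuous_intros Vcont) auto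
    have "basis_norm w m = (\<integral>\<^sup>+p. ennreal (((cmod (fst p))\<^sup>2) ^ (2 * m)) * ennreal (w ((cmod (fst p))\<^sup>2 + (cmod (snd p))\<^sup>2)) \<partial>lborel)"
      unfolding basis_norm_def
    proof (intro nn_integral_cong)
      fix p :: "complex \<times> complex"
      have "weight w p = w ((norm p)\<^sup>2)"
        unfolding weight_def
        by (auto simp: w_def pair_ball_def power_less_one_iff split: split_indicator)
      then show "ennreal (weight w p * ((cmod (fst p))\<^sup>2) ^ (2 * m)) =
         ennreal (((cmod (fst p))\<^sup>2) ^ (2 * m)) * ennreal (w ((cmod (fst p))\<^sup>2 + (cmod (snd p))\<^sup>2))"
        using w0 by (simp add: ennreal_mult[symmetric] mult.commute norm_square_pair)
    qed
    also have "\<dots> = ennreal (pi\<^sup>2 / (real (2 * m) + 1)) * (\<integral>\<^sup>+r. ennreal (w r) * ennreal (r ^ (2 * m + 1)) * indicator {0<..} r \<partial>lborel)"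
      by (rule nn_integral_monomial_radial) simp
    also have "(\<integral>\<^sup>+r. ennreal (w r) * ennreal (r ^ (2 * m + 1)) * indicator {0<..} r \<partial>lborel) =
       (\<integral>\<^sup>+r. ennreal (h (r\<^sup>2) * (2 * r) * indicator {0..1} r) \<partial>lborel)"
    proof (rule nn_integral_cong)
      fix r :: real
      show "ennreal (w r) * ennreal (r ^ (2 * m + 1)) * indicator {0<..} r = ennreal (h (r\<^sup>2) * (2 * r) * indicator {0..1} r)"
      proof (cases "0 < r \<and> r < 1")
        case True
        then have "w r * r ^ (2 * m + 1) = h (r\<^sup>2) * (2 * r)"
          using sq01[of r] by (simp add: w_def h_def power_mult power2_eq_square)
        then show ?thesis using True w0[of r] by (simp add: ennreal_mult[symmetric] del: power_Suc)
      next
        case False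
        then have "h (r\<^sup>2) * (2 * r) * indicator {0..1} r = 0"
          by (cases "r = 0 \<or> r = 1") (auto simp: h_def split: split_indicator)
        then show ?thesis using False by (auto simp: w_def split: split_indicator)
      qed
    qed
    also have "\<dots> = (\<integral>\<^sup>+t. ennreal (h t * indicator {0\<^sup>2..1\<^sup>2} t) \<partial>lborel)"
    proof (rule nn_integral_substitution[symmetric])
      show "set_borel_measurable borel {0\<^sup>2..1\<^sup>2} h" unfolding set_borel_measurable_def using h by simp
      show "((\<lambda>r. r\<^sup>2) has_real_derivative 2 * r) (at r)" for r :: real
        by (auto intro!: derivative_eq_intros)
    qed (auto intro!: continuous_intros)
    also have "\<dots> = J m"
      unfolding J_def by (intro nn_integral_cong) (auto simp: h_def split: split_indicator)
    finally show ?thesis by simp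
  qed
  have J_inf: "basis_norm w m = \<infinity> \<longleftrightarrow> J m = \<infinity>" for m
  proof -
    have "0 < pi\<^sup>2 / (2 * real m + 1)" by (intro divide_pos_pos) auto
    then show ?thesis unfolding norm_J by (auto simp: ennreal_mult_eq_top_iff)
  qed
  have J_real: "enn2real (basis_norm w m) = pi\<^sup>2 / (2 * real m + 1) * enn2real (J m)" for m
    unfolding norm_J enn2real_mult by simp
  have series: "(\<lambda>m. complex_of_real ((if J m = \<infinity> then 0 else (2 * real m + 1) / enn2real (J m)) * t ^ m))
      sums (of_real (pi\<^sup>2) * (c / of_real (f t ^ 3)))" if t: "0 < t" "t < 1" for t
  proof -
    define a0 where "a0 = sqrt (sqrt t)"
    have a0: "0 < a0" "a0 < 1" using t by (auto simp: a0_def)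
    have a4: "a0 ^ 4 = t"
    proof -
      have "a0 ^ 4 = (a0\<^sup>2)\<^sup>2" by simp
      then show ?thesis using t by (simp add: a0_def del: power_mult)
    qed
    let ?y = "cover (complex_of_real a0, 0)"
    have y: "?y \<in> kepler_ball"
      using a0 by (intro cover_in_kepler_ball) (auto simp: pair_ball_iff zero_prod_def power_less_one_iff)
    have "u ?y = f t"
      using a4 by (simp add: u_def norm_cover norm_square_pair)
    then have "K ?y ?y = c / of_real (f t ^ 3)" using c(2)[OF y] by simp
    with kernel_diagonal[OF w w0 \<mu>_eq K a0]
    have "(\<lambda>m. if basis_norm w m = \<infinity> then 0 else complex_of_real (a0 ^ (4 * m) / enn2real (basis_norm w m))) sums
       (c / of_real (f t ^ 3))" by simp
    then have "(\<lambda>m. of_real (pi\<^sup>2) * (if basis_norm w m = \<infinity> then 0 else complex_of_real (a0 ^ (4 * m) / enn2real (basis_norm w m)))) sums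
       (of_real (pi\<^sup>2) * (c / of_real (f t ^ 3)))" by (rule sums_mult)
    moreover have "of_real (pi\<^sup>2) * (if basis_norm w m = \<infinity> then 0 else complex_of_real (a0 ^ (4 * m) / enn2real (basis_norm w m))) =
       complex_of_real ((if J m = \<infinity> then 0 else (2 * real m + 1) / enn2real (J m)) * t ^ m)" for m
    proof (cases "J m = \<infinity>")
      case False
      have nb: "basis_norm w m \<noteq> \<infinity>" using False J_inf by blast
      have eq: "pi\<^sup>2 * (a0 ^ (4 * m) / enn2real (basis_norm w m)) = (2 * real m + 1) / enn2real (J m) * t ^ m"
        unfolding J_real power_mult a4 by simp
      show ?thesis by (simp only: nb False if_False of_real_mult[symmetric] eq)
    next
      case True
      then have nb: "basis_norm w m = \<infinity>" using J_inf by blast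
      show ?thesis by (simp only: nb True if_True) simp
    qed
    ultimately show ?thesis by simp
  qed
  \<comment> \<open>The series has nonnegative real terms, so \<open>c\<close> is real and positive.\<close>
  define C where "C = pi\<^sup>2 * Re c"
  have sums: "(\<lambda>m. (if J m = \<infinity> then 0 else (2 * real m + 1) / enn2real (J m)) * t ^ m) sums (C / f t ^ 3)"
    and im: "Im c = 0" if t: "0 < t" "t < 1" for t
  proof -
    have ft: "f t \<noteq> 0" using fpos[OF t] by simp
    have v: "of_real (pi\<^sup>2) * (c / of_real (f t ^ 3)) = of_real (pi\<^sup>2 / f t ^ 3) * c" by simp
    show "(\<lambda>m. (if J m = \<infinity> then 0 else (2 * real m + 1) / enn2real (J m)) * t ^ m) sums (C / f t ^ 3)"
      using sums_Re[OF series[OF t]] unfolding v by (simp add: C_def)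
    have "(\<lambda>m. 0 :: real) sums (pi\<^sup>2 / f t ^ 3 * Im c)"
      using sums_Im[OF series[OF t]] unfolding v by simp
    then have "pi\<^sup>2 / f t ^ 3 * Im c = 0" using sums_unique2 sums_zero by blast
    then show "Im c = 0" using ft by simp
  qed
  have "0 < C"
  proof -
    have "0 \<le> C / f (1/2) ^ 3"
      by (rule sums_le[OF _ sums_zero sums[of "1/2"]]) auto
    then have "0 \<le> C" using fpos[of "1/2"] by (simp add: zero_le_divide_iff)
    moreover have "C \<noteq> 0" using c(1) im[of "1/2"] by (auto simp: C_def complex_eq_iff)
    ultimately show ?thesis by simp
  qed
  obtain F \<epsilon> where F: "0 < fps_conv_radius F" "0 < \<epsilon>"
    "\<And>t. 1 - \<epsilon> < t \<Longrightarrow> t < 1 \<Longrightarrow> f t = eval_fps F (t - 1)" "fps_nth F 0 = 0" "fps_nth F 1 = -1"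
    using left_expansion_at_1[OF assms(3-5)] by metis
  show False
    by (rule no_balanced_profile[where J = J and V = V and f = f and ?f1.0 = f1 and ?f2.0 = f2
          and F = F and \<epsilon> = \<epsilon> and c = C];
        (rule J_def V_def F(1) F(2) F(4) F(5) Vcont \<open>0 < C\<close> | erule (1) fpos d0 d1 Vpos sums F(3)))
qed

end
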